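(* Any compact metric space $(X,d)$ is the limit, for the quantum propinquity, of a sequence of $(2,0)$-quasi-Leibniz quantum compact metric spaces consisting of full matrix algebras: there exists a sequence $(\mathfrak{A}_n,\mathsf{L}_n)_{n\in\mathbb{N}}$ of $(2,0)$-quasi-Leibniz quantum compact metric spaces such that each $\mathfrak{A}_n$ is a full matrix algebra over $\mathbb{C}$ and $$\lim_{n\to\infty}\mathsf{\Lambda}_{2,0}\left((\mathfrak{A}_n,\mathsf{L}_n),(C(X),\mathsf{Lip}_d)\right)=0.$$
   Context: Metric spaces are nonempty. A full matrix algebra is the C*-algebra of $k\times k$ complex matrices for some $k\geq 1$. For a unital C*-algebra $\mathfrak{A}$: $1_{\mathfrak{A}}$ is the unit, $\|\cdot\|_{\mathfrak{A}}$ the norm, $\mathfrak{sa}(\mathfrak{A})$ the space of self-adjoint elements, $\mathscr{S}(\mathfrak{A})$ the state space. For a compact metric space $(X,d)$ and $f\in C(X)$, $\mathsf{Lip}_d(f) = \sup\{ |f(x)-f(y)|/d(x,y) : x,y\in X, x\neq y\}\in[0,\infty]$ (equal to $0$ if $X$ is one point). The pair $(C(X),\mathsf{Lip}_d)$ is a Leibniz (i.e. $(1,0)$-quasi-Leibniz) quantum compact metric space in the sense below, with $\mathsf{Lip}_d$ restricted to the real-valued Lipschitz functions. Quasi-Leibniz quantum compact metric spaces. Let $F:[0,\infty)^4\to[0,\infty)$ be weakly increasing for the product order. An $F$-quasi-Leibniz quantum compact metric space $(\mathfrak{A},\mathsf{L})$ is a unital C*-algebra $\mathfrak{A}$ with a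 seminorm $\mathsf{L}$ defined on a dense Jordan-Lie subalgebra $\mathrm{dom}(\mathsf{L})$ of $\mathfrak{sa}(\mathfrak{A})$ (convention: $\mathsf{L}=\infty$ on $\mathfrak{sa}(\mathfrak{A})\setminus\mathrm{dom}(\mathsf{L})$) such that: (i) $\{a\in\mathrm{dom}(\mathsf{L}) : \mathsf{L}(a)=0\} = \mathbb{R}1_{\mathfrak{A}}$; (ii) $\mathsf{mk}_{\mathsf{L}}(\varphi,\psi) = \sup\{|\varphi(a)-\psi(a)| : a\in\mathrm{dom}(\mathsf{L}), \mathsf{L}(a)\leq 1\}$ defines a metric on $\mathscr{S}(\mathfrak{A})$ which metrizes the weak* topology; (iii) $\mathsf{L}$ is lower semicontinuous for $\|\cdot\|_{\mathfrak{A}}$; (iv) for all $a,b\in\mathrm{dom}(\mathsf{L})$, $\max\{\mathsf{L}(\frac{ab+ba}{2}),\mathsf{L}(\frac{ab-ba}{2i})\}\leq F(\|a\|_{\mathfrak{A}},\|b\|_{\mathfrak{A}},\mathsf{L}(a),\mathsf{L}(b))$. It is called $(C,D)$-quasi-Leibniz ($C\geq 1$, $D\geq 0$) when $F(x,y,l_x,l_y)=C(x l_y+y l_x)+D l_x l_y$. Bridges. A bridge $\gamma=(\mathfrak{D},\pi_{\mathfrak{A}},\pi_{\mathfrak{B}},x)$ from a unital C*-algebra $\mathfrak{A}$ to a unital C*-algebra $\mathfrak{B}$ consists of a unital C*-algebra $\mathfrak{D}$, unital *-monomorphisms $\pi_{\mathfrak{A}}:\mathfrak{A}\hookrightarrow\mathfrak{D}$,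 $\pi_{\mathfrak{B}}:\mathfrak{B}\hookrightarrow\mathfrak{D}$, and $x\in\mathfrak{D}$ such that $\mathscr{S}(\mathfrak{D}|x)=\{\varphi\in\mathscr{S}(\mathfrak{D}) : \forall d\in\mathfrak{D},\ \varphi(xd)=\varphi(dx)=\varphi(d)\}\neq\emptyset$. Given quantum compact metric spaces $(\mathfrak{A},\mathsf{L}_{\mathfrak{A}})$, $(\mathfrak{B},\mathsf{L}_{\mathfrak{B}})$, the length $\lambda(\gamma|\mathsf{L}_{\mathfrak{A}},\mathsf{L}_{\mathfrak{B}})$ is the maximum of the height, i.e. the maximum over $\mathfrak{C}\in\{\mathfrak{A},\mathfrak{B}\}$ of the Hausdorff distance, for $\mathsf{mk}_{\mathsf{L}_{\mathfrak{C}}}$, between $\mathscr{S}(\mathfrak{C})$ and $\{\varphi\circ\pi_{\mathfrak{C}} : \varphi\in\mathscr{S}(\mathfrak{D}|x)\}$, and the reach, i.e. the maximum of $\sup_{a}\inf_{b}\|\pi_{\mathfrak{A}}(a)x-x\pi_{\mathfrak{B}}(b)\|_{\mathfrak{D}}$ and $\sup_b\inf_a\|\pi_{\mathfrak{A}}(a)x-x\pi_{\mathfrak{B}}(b)\|_{\mathfrak{D}}$, where $a$ ranges over $\{a\in\mathfrak{sa}(\mathfrak{A}):\mathsf{L}_{\mathfrak{A}}(a)\leq 1\}$ and $b$ over $\{b\in\mathfrak{sa}(\mathfrak{B}):\mathsf{L}_{\mathfrak{B}}(b)\leq 1\}$. Quantum propinquity. $\mathsf{\Lambda}_F$ is the largest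 class function on pairs of $F$-quasi-Leibniz quantum compact metric spaces which: (1) is nonnegative, symmetric, and bounded above by the maximum of the diameters of the two state spaces for their metrics $\mathsf{mk}$; (2) satisfies the triangle inequality; (3) satisfies $\mathsf{\Lambda}_F((\mathfrak{A},\mathsf{L}_{\mathfrak{A}}),(\mathfrak{B},\mathsf{L}_{\mathfrak{B}}))\leq\lambda(\gamma|\mathsf{L}_{\mathfrak{A}},\mathsf{L}_{\mathfrak{B}})$ for every bridge $\gamma$ from $\mathfrak{A}$ to $\mathfrak{B}$; (4) vanishes if and only if there is a *-isomorphism $\theta:\mathfrak{A}\to\mathfrak{B}$ with $\mathsf{L}_{\mathfrak{B}}\circ\theta=\mathsf{L}_{\mathfrak{A}}$. (Equivalently, it is the infimum, over finite chains of $F$-quasi-Leibniz quantum compact metric spaces joining the two spaces with a bridge between consecutive ones, of the sum of the lengths of the bridges.) For $F(x,y,l_x,l_y)=C(x l_y+y l_x)+D l_x l_y$ one writes $\mathsf{\Lambda}_{C,D}$. *)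

theory Defs
  imports
    "HOL-Analysis.Analysis"
    "HOL-Algebra.Module"
    "Jordan_Normal_Form.Schur_Decomposition"
begin

section \<open>Unital C*-algebras\<close>

record 'a cstar = "(complex, 'a) module" +
  adj :: "'a \<Rightarrow> 'a"
  nrm :: "'a \<Rightarrow> real"

text \<open>The locale \<^locale>\<open>Metric_space\<close> requires distances to be symmetric and nonnegative on the whole
  type, hence the value \<open>0\<close> outside the carrier.\<close>

definition nrm_dist :: "'a cstar \<Rightarrow> 'a \<Rightarrow> 'a \<Rightarrow> real" where
  "nrm_dist A a b = (if a \<in> carrier A \<and> b \<in> carrier A then nrm A (a \<ominus>\<^bsub>A\<^esub> b) else 0)"

definition nrm_topology :: "'a cstar \<Rightarrow> 'a topology" where
  "nrm_topology A = Metric_space.mtopology (carrier A) (nrm_dist A)"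

text \<open>The zero algebra is excluded: it has no states.\<close>

locale unital_cstar_algebra = ring A for A :: "'a cstar" (structure) +
  assumes one_neq_zero: "\<one> \<noteq> \<zero>"
    and smult_closed: "a \<in> carrier A \<Longrightarrow> z \<odot> a \<in> carrier A"
    and smult_add_left: "a \<in> carrier A \<Longrightarrow> (z + w) \<odot> a = z \<odot> a \<oplus> w \<odot> a"
    and smult_add_right: "a \<in> carrier A \<Longrightarrow> b \<in> carrier A \<Longrightarrow> z \<odot> (a \<oplus> b) = z \<odot> a \<oplus> z \<odot> b"
    and smult_smult: "a \<in> carrier A \<Longrightarrow> (z * w) \<odot> a = z \<odot> (w \<odot> a)"
    and smult_one: "a \<in> carrier A \<Longrightarrow> 1 \<odot> a = a"
    and smult_mult_left: "a \<in> carrier A \<Longrightarrow> b \<in> carrier A \<Longrightarrow> (z \<odot> a) \<otimes> b = z \<odot> (a \<otimes> b)"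
    and smult_mult_right: "a \<in> carrier A \<Longrightarrow> b \<in> carrier A \<Longrightarrow> a \<otimes> (z \<odot> b) = z \<odot> (a \<otimes> b)"
    and adj_closed: "a \<in> carrier A \<Longrightarrow> adj A a \<in> carrier A"
    and adj_adj: "a \<in> carrier A \<Longrightarrow> adj A (adj A a) = a"
    and adj_add: "a \<in> carrier A \<Longrightarrow> b \<in> carrier A \<Longrightarrow> adj A (a \<oplus> b) = adj A a \<oplus> adj A b"
    and adj_smult: "a \<in> carrier A \<Longrightarrow> adj A (z \<odot> a) = cnj z \<odot> adj A a"
    and adj_mult: "a \<in> carrier A \<Longrightarrow> b \<in> carrier A \<Longrightarrow> adj A (a \<otimes> b) = adj A b \<otimes> adj A a"
    and nrm_nonneg: "a \<in> carrier A \<Longrightarrow> 0 \<le> nrm A a"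
    and nrm_eq_zero: "a \<in> carrier A \<Longrightarrow> nrm A a = 0 \<longleftrightarrow> a = \<zero>"
    and nrm_triangle: "a \<in> carrier A \<Longrightarrow> b \<in> carrier A \<Longrightarrow> nrm A (a \<oplus> b) \<le> nrm A a + nrm A b"
    and nrm_smult: "a \<in> carrier A \<Longrightarrow> nrm A (z \<odot> a) = cmod z * nrm A a"
    and nrm_mult: "a \<in> carrier A \<Longrightarrow> b \<in> carrier A \<Longrightarrow> nrm A (a \<otimes> b) \<le> nrm A a * nrm A b"
    and cstar_identity: "a \<in> carrier A \<Longrightarrow> nrm A (adj A a \<otimes> a) = (nrm A a)\<^sup>2"
    and complete: "Metric_space.mcomplete (carrier A) (nrm_dist A)"

definition self_adjoint :: "'a cstar \<Rightarrow> 'a set" where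
  "self_adjoint A = {a \<in> carrier A. adj A a = a}"

definition unital_star_mono :: "'a cstar \<Rightarrow> 'b cstar \<Rightarrow> ('a \<Rightarrow> 'b) \<Rightarrow> bool" where
  "unital_star_mono A D \<pi> \<longleftrightarrow>
     \<pi> \<in> Ring.ring_hom A D \<and>
     (\<forall>z. \<forall>a\<in>carrier A. \<pi> (z \<odot>\<^bsub>A\<^esub> a) = z \<odot>\<^bsub>D\<^esub> \<pi> a) \<and>
     (\<forall>a\<in>carrier A. \<pi> (adj A a) = adj D (\<pi> a)) \<and>
     inj_on \<pi> (carrier A)"

text \<open>Functionals on an algebra are extensional, so that each one is represented by exactly one
  HOL function.\<close>

definition states :: "'a cstar \<Rightarrow> ('a \<Rightarrow> complex) set" where
  "states A = {\<phi> \<in> extensional (carrier A).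
     (\<forall>a\<in>carrier A. \<forall>b\<in>carrier A. \<phi> (a \<oplus>\<^bsub>A\<^esub> b) = \<phi> a + \<phi> b) \<and>
     (\<forall>z. \<forall>a\<in>carrier A. \<phi> (z \<odot>\<^bsub>A\<^esub> a) = z * \<phi> a) \<and>
     (\<forall>a\<in>carrier A. \<phi> (adj A a \<otimes>\<^bsub>A\<^esub> a) \<in> \<real>\<^sub>\<ge>\<^sub>0) \<and>
     \<phi> \<one>\<^bsub>A\<^esub> = 1}"

definition weak_star_topology :: "'a cstar \<Rightarrow> ('a \<Rightarrow> complex) topology" where
  "weak_star_topology A =
     subtopology (product_topology (\<lambda>_. euclidean) (carrier A)) (states A)"


section \<open>Quasi-Leibniz quantum compact metric spaces\<close>

text \<open>A seminorm \<open>L\<close> takes the value \<open>\<infinity>\<close> at the self-adjoint elements outside its domain; its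
  values at other elements are irrelevant.\<close>

definition lip_dom :: "'a cstar \<Rightarrow> ('a \<Rightarrow> ennreal) \<Rightarrow> 'a set" where
  "lip_dom A L = {a \<in> self_adjoint A. L a < \<infinity>}"

definition lip_ball :: "'a cstar \<Rightarrow> ('a \<Rightarrow> ennreal) \<Rightarrow> 'a set" where
  "lip_ball A L = {a \<in> self_adjoint A. L a \<le> 1}"

definition mk :: "'a cstar \<Rightarrow> ('a \<Rightarrow> ennreal) \<Rightarrow> ('a \<Rightarrow> complex) \<Rightarrow> ('a \<Rightarrow> complex) \<Rightarrow> ennreal" where
  "mk A L \<phi> \<psi> = (SUP a\<in>lip_ball A L. ennreal (cmod (\<phi> a - \<psi> a)))"

definition jordan_prod :: "'a cstar \<Rightarrow> 'a \<Rightarrow> 'a \<Rightarrow> 'a" where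
  "jordan_prod A a b = (1 / 2) \<odot>\<^bsub>A\<^esub> (a \<otimes>\<^bsub>A\<^esub> b \<oplus>\<^bsub>A\<^esub> b \<otimes>\<^bsub>A\<^esub> a)"

definition lie_prod :: "'a cstar \<Rightarrow> 'a \<Rightarrow> 'a \<Rightarrow> 'a" where
  "lie_prod A a b = (1 / (2 * \<i>)) \<odot>\<^bsub>A\<^esub> (a \<otimes>\<^bsub>A\<^esub> b \<ominus>\<^bsub>A\<^esub> b \<otimes>\<^bsub>A\<^esub> a)"

type_synonym permissible_fun = "real \<Rightarrow> real \<Rightarrow> real \<Rightarrow> real \<Rightarrow> real"

text \<open>Only the restriction of \<open>F\<close> to nonnegative arguments matters.\<close>

definition permissible :: "permissible_fun \<Rightarrow> bool" where
  "permissible F \<longleftrightarrow>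
     (\<forall>x y l m. 0 \<le> x \<longrightarrow> 0 \<le> y \<longrightarrow> 0 \<le> l \<longrightarrow> 0 \<le> m \<longrightarrow> 0 \<le> F x y l m) \<and>
     (\<forall>x y l m x' y' l' m'. 0 \<le> x \<longrightarrow> 0 \<le> y \<longrightarrow> 0 \<le> l \<longrightarrow> 0 \<le> m \<longrightarrow>
        x \<le> x' \<longrightarrow> y \<le> y' \<longrightarrow> l \<le> l' \<longrightarrow> m \<le> m' \<longrightarrow> F x y l m \<le> F x' y' l' m')"

locale quasi_leibniz_qcms = unital_cstar_algebra A
  for F :: permissible_fun and A :: "'a cstar" (structure) and L :: "'a \<Rightarrow> ennreal" +
  assumes permissible: "permissible F"
    \<comment> \<open>the domain is a dense Jordan-Lie subalgebra and \<open>L\<close> is a seminorm on it\<close>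
    and dom_zero: "\<zero> \<in> lip_dom A L"
    and dom_add: "a \<in> lip_dom A L \<Longrightarrow> b \<in> lip_dom A L \<Longrightarrow> a \<oplus> b \<in> lip_dom A L"
    and dom_scale: "a \<in> lip_dom A L \<Longrightarrow> complex_of_real t \<odot> a \<in> lip_dom A L"
    and dom_jordan: "a \<in> lip_dom A L \<Longrightarrow> b \<in> lip_dom A L \<Longrightarrow> jordan_prod A a b \<in> lip_dom A L"
    and dom_lie: "a \<in> lip_dom A L \<Longrightarrow> b \<in> lip_dom A L \<Longrightarrow> lie_prod A a b \<in> lip_dom A L"
    and dom_dense: "self_adjoint A \<subseteq> nrm_topology A closure_of lip_dom A L"
    and lip_add: "a \<in> lip_dom A L \<Longrightarrow> b \<in> lip_dom A L \<Longrightarrow> L (a \<oplus> b) \<le> L a + L b"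
    and lip_scale: "a \<in> lip_dom A L \<Longrightarrow> L (complex_of_real t \<odot> a) = ennreal \<bar>t\<bar> * L a"
    and lip_kernel: "{a \<in> lip_dom A L. L a = 0} = range (\<lambda>t. complex_of_real t \<odot> \<one>)"
    and mk_finite: "\<phi> \<in> states A \<Longrightarrow> \<psi> \<in> states A \<Longrightarrow> mk A L \<phi> \<psi> < \<infinity>"
    and mk_metric: "Metric_space (states A) (\<lambda>\<phi> \<psi>. enn2real (mk A L \<phi> \<psi>))"
    and mk_weak_star:
      "Metric_space.mtopology (states A) (\<lambda>\<phi> \<psi>. enn2real (mk A L \<phi> \<psi>)) = weak_star_topology A"
    and lip_lsc:
      "openin (subtopology (nrm_topology A) (self_adjoint A)) {a \<in> self_adjoint A. r < L a}"
    and quasi_leibniz: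
      "a \<in> lip_dom A L \<Longrightarrow> b \<in> lip_dom A L \<Longrightarrow>
        max (L (jordan_prod A a b)) (L (lie_prod A a b))
          \<le> ennreal (F (nrm A a) (nrm A b) (enn2real (L a)) (enn2real (L b)))"

definition CD_fun :: "real \<Rightarrow> real \<Rightarrow> permissible_fun" where
  "CD_fun C D = (\<lambda>x y lx ly. C * (x * ly + y * lx) + D * lx * ly)"


section \<open>Bridges\<close>

definition level_states :: "'d cstar \<Rightarrow> 'd \<Rightarrow> ('d \<Rightarrow> complex) set" where
  "level_states D x = {\<phi> \<in> states D.
     \<forall>d\<in>carrier D. \<phi> (x \<otimes>\<^bsub>D\<^esub> d) = \<phi> d \<and> \<phi> (d \<otimes>\<^bsub>D\<^esub> x) = \<phi> d}"

definition bridge ::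
  "'a cstar \<Rightarrow> 'b cstar \<Rightarrow> 'd cstar \<Rightarrow> ('a \<Rightarrow> 'd) \<Rightarrow> ('b \<Rightarrow> 'd) \<Rightarrow> 'd \<Rightarrow> bool" where
  "bridge A B D \<pi>\<^sub>A \<pi>\<^sub>B x \<longleftrightarrow>
     unital_cstar_algebra D \<and> unital_star_mono A D \<pi>\<^sub>A \<and> unital_star_mono B D \<pi>\<^sub>B \<and>
     x \<in> carrier D \<and> level_states D x \<noteq> {}"

definition hausdorff :: "('s \<Rightarrow> 's \<Rightarrow> ennreal) \<Rightarrow> 's set \<Rightarrow> 's set \<Rightarrow> ennreal" where
  "hausdorff d S T = max (SUP s\<in>S. INF t\<in>T. d s t) (SUP t\<in>T. INF s\<in>S. d s t)"

definition side_height ::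
  "'a cstar \<Rightarrow> ('a \<Rightarrow> ennreal) \<Rightarrow> 'd cstar \<Rightarrow> ('a \<Rightarrow> 'd) \<Rightarrow> 'd \<Rightarrow> ennreal" where
  "side_height A L D \<pi> x =
     hausdorff (mk A L) (states A) ((\<lambda>\<phi>. restrict (\<phi> \<circ> \<pi>) (carrier A)) ` level_states D x)"

definition bridge_height ::
  "'a cstar \<Rightarrow> ('a \<Rightarrow> ennreal) \<Rightarrow> 'b cstar \<Rightarrow> ('b \<Rightarrow> ennreal) \<Rightarrow>
   'd cstar \<Rightarrow> ('a \<Rightarrow> 'd) \<Rightarrow> ('b \<Rightarrow> 'd) \<Rightarrow> 'd \<Rightarrow> ennreal" where
  "bridge_height A L\<^sub>A B L\<^sub>B D \<pi>\<^sub>A \<pi>\<^sub>B x = max (side_height A L\<^sub>A D \<pi>\<^sub>A x) (side_height B L\<^sub>B D \<pi>\<^sub>B x)"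

definition bridge_reach ::
  "'a cstar \<Rightarrow> ('a \<Rightarrow> ennreal) \<Rightarrow> 'b cstar \<Rightarrow> ('b \<Rightarrow> ennreal) \<Rightarrow>
   'd cstar \<Rightarrow> ('a \<Rightarrow> 'd) \<Rightarrow> ('b \<Rightarrow> 'd) \<Rightarrow> 'd \<Rightarrow> ennreal" where
  "bridge_reach A L\<^sub>A B L\<^sub>B D \<pi>\<^sub>A \<pi>\<^sub>B x =
     hausdorff (\<lambda>p q. ennreal (nrm D (p \<otimes>\<^bsub>D\<^esub> x \<ominus>\<^bsub>D\<^esub> x \<otimes>\<^bsub>D\<^esub> q)))
       (\<pi>\<^sub>A ` lip_ball A L\<^sub>A) (\<pi>\<^sub>B ` lip_ball B L\<^sub>B)"

definition bridge_length ::
  "'a cstar \<Rightarrow> ('a \<Rightarrow> ennreal) \<Rightarrow> 'b cstar \<Rightarrow> ('b \<Rightarrow> ennreal) \<Rightarrow>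
   'd cstar \<Rightarrow> ('a \<Rightarrow> 'd) \<Rightarrow> ('b \<Rightarrow> 'd) \<Rightarrow> 'd \<Rightarrow> ennreal" where
  "bridge_length A L\<^sub>A B L\<^sub>B D \<pi>\<^sub>A \<pi>\<^sub>B x =
     max (bridge_height A L\<^sub>A B L\<^sub>B D \<pi>\<^sub>A \<pi>\<^sub>B x) (bridge_reach A L\<^sub>A B L\<^sub>B D \<pi>\<^sub>A \<pi>\<^sub>B x)"


section \<open>The quantum propinquity\<close>

text \<open>The bridge algebras and the intermediate spaces of the chains have to live in a fixed type;
  one of the cardinality of the continuum suffices.
  Quantum compact metric spaces are separable, because their state spaces are compact and
  metrizable in the weak* topology, and a separable C*-algebra has at most continuum many
  elements, so it is isomorphic to one whose carrier is a set of complex sequences.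
  The algebra of a bridge may be replaced by its C*-subalgebra generated by the images of the two
  separable algebras, the pivot \<open>x\<close> and the unit. This does not change the length, since
  a state \<open>\<phi>\<close> belongs to \<open>level_states D x\<close> iff it vanishes at \<open>(1 - x)(1 - x)*\<close> and at
  \<open>(1 - x)*(1 - x)\<close>, and hence so do its restrictions and extensions.\<close>

type_synonym universe = "nat \<Rightarrow> complex"

type_synonym 'a lip_pair = "'a cstar \<times> ('a \<Rightarrow> ennreal)"

definition qcms :: "permissible_fun \<Rightarrow> 'a lip_pair \<Rightarrow> bool" where
  "qcms F P \<longleftrightarrow> quasi_leibniz_qcms F (fst P) (snd P)"

definition bridge_between :: "'a lip_pair \<Rightarrow> 'b lip_pair \<Rightarrow> ennreal \<Rightarrow> bool" where
  "bridge_between P Q r \<longleftrightarrow>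
     (\<exists>(D :: universe cstar) \<pi>\<^sub>P \<pi>\<^sub>Q x. bridge (fst P) (fst Q) D \<pi>\<^sub>P \<pi>\<^sub>Q x \<and>
        r = bridge_length (fst P) (snd P) (fst Q) (snd Q) D \<pi>\<^sub>P \<pi>\<^sub>Q x)"

inductive qcms_chain ::
  "permissible_fun \<Rightarrow> universe lip_pair \<Rightarrow> universe lip_pair \<Rightarrow> ennreal \<Rightarrow> bool" for F where
  single: "qcms F P \<Longrightarrow> qcms_chain F P P 0"
| step: "qcms_chain F P Q r \<Longrightarrow> qcms F R \<Longrightarrow> bridge_between Q R s \<Longrightarrow> qcms_chain F P R (r + s)"

text \<open>The infimum over all chains from \<open>P\<close> to \<open>Q\<close>, with or without intermediate spaces.
  It is meant for \<open>F\<close>-quasi-Leibniz quantum compact metric spaces \<open>P\<close> and \<open>Q\<close>.\<close>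

definition propinquity :: "permissible_fun \<Rightarrow> 'a lip_pair \<Rightarrow> 'b lip_pair \<Rightarrow> ennreal" where
  "propinquity F P Q =
     Inf ({r. bridge_between P Q r} \<union>
          {r + s + t |r s t. \<exists>S T. bridge_between P S r \<and> qcms_chain F S T s \<and> bridge_between T Q t})"


section \<open>Full matrix algebras and algebras of continuous functions\<close>

definition cvec_norm :: "complex vec \<Rightarrow> real" where
  "cvec_norm v = sqrt (Re (v \<bullet>c v))"

definition matrix_cstar :: "nat \<Rightarrow> complex mat cstar" where
  "matrix_cstar k = ring_mat TYPE(complex) k
     \<lparr>smult = (\<cdot>\<^sub>m),
      adj = mat_adjoint,
      nrm = (\<lambda>M. SUP v\<in>{v \<in> carrier_vec k. cvec_norm v \<le> 1}. cvec_norm (M *\<^sub>v v))\<rparr>"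

definition full_matrix_algebra :: "complex mat cstar \<Rightarrow> bool" where
  "full_matrix_algebra A \<longleftrightarrow> (\<exists>k\<ge>1. A = matrix_cstar k)"

definition cont_cstar :: "'x set \<Rightarrow> ('x \<Rightarrow> 'x \<Rightarrow> real) \<Rightarrow> ('x \<Rightarrow> complex) cstar" where
  "cont_cstar X d =
     \<lparr>carrier = {f \<in> extensional X. continuous_map (Metric_space.mtopology X d) euclidean f},
      mult = (\<lambda>f g. \<lambda>x\<in>X. f x * g x),
      one = (\<lambda>x\<in>X. 1),
      zero = (\<lambda>x\<in>X. 0),
      add = (\<lambda>f g. \<lambda>x\<in>X. f x + g x),
      smult = (\<lambda>z f. \<lambda>x\<in>X. z * f x),
      adj = (\<lambda>f. \<lambda>x\<in>X. cnj (f x)),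
      nrm = (\<lambda>f. SUP x\<in>X. cmod (f x))\<rparr>"

definition Lip :: "'x set \<Rightarrow> ('x \<Rightarrow> 'x \<Rightarrow> real) \<Rightarrow> ('x \<Rightarrow> complex) \<Rightarrow> ennreal" where
  "Lip X d f = (SUP (x, y)\<in>{(x, y). x \<in> X \<and> y \<in> X \<and> x \<noteq> y}. ennreal (cmod (f x - f y) / d x y))"

end

theory Submission
  imports Defs
begin

text \<open>The idea is to see nearly diagonal matrices as functions on a finite subset of \<open>X\<close>.  Choose an \<open>\<epsilon>\<close>-net
\<open>x\<^sub>0, \<dots>, x\<^bsub>k-1\<^esub>\<close> of distinct points of \<open>X\<close>.  On the \<open>k \<times> k\<close> matrices take the seminorm
\<open>max (Lip (diag a)) (\<parallel>a - diag a\<parallel> / r)\<close>, where \<open>Lip\<close> is the Lipschitz seminorm of the net applied to the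
diagonal of \<open>a\<close>.  A self-adjoint element of the unit ball is then a 1-Lipschitz function on the net, up to an error of
norm at most \<open>r\<close>.  If moreover \<open>2 r\<close> is at most the separation of the net, then the diagonal entries of
the product of two off-diagonal parts vary slowly enough to be absorbed by the second half of the
constant 2, so the seminorm is \<open>(2,0)\<close>-quasi-Leibniz (\<open>net_lip_mult_le\<close>).  The remaining
axioms hold because matrix algebras are finite-dimensional: the seminorm is dominated by the
norm, and its unit ball is bounded modulo scalars (\<open>quasi_leibniz_qcms\<close>).

A single bridge compares this space with \<open>C(X)\<close>.  Its algebra consists of the bounded
sequences of \<open>k \<times> k\<close> matrices.  A matrix is sent to the constant sequence, and a function \<open>f\<close> to the
sequence whose \<open>j\<close>-th term is the diagonal matrix with entries \<open>f (near_pt i j)\<close>.  Here each \<open>near_pt i j\<close> is within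
\<open>\<epsilon>\<close> of \<open>x i\<close>, and together these points are dense in \<open>X\<close>, so that no function is lost.  The pivot is
the unit, hence every state is in its 1-level set.

For a matrix in the unit ball, the McShane extension of its diagonal is a 1-Lipschitz function whose image
differs from that of the matrix by at most \<open>2 \<epsilon>\<close>; conversely the values of a
1-Lipschitz function on the net form a diagonal matrix in the unit ball.  This bounds the reach
(\<open>reach_le\<close>).  States of matrices extend exactly, by evaluation at one index of the sequence
(\<open>side_height_A\<close>).  States of \<open>C(X)\<close> are approximated by convex combinations of point evaluations, with
weights given by a partition of unity subordinate to the net (\<open>side_height_B\<close>).  Thus the length of
the bridge, and with it the propinquity, is at most \<open>2 \<epsilon>\<close>.\<close>

section \<open>The operator norm on square matrices\<close>

no_notation vec_nth (infixl \<open>$\<close> 90)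

lemma matrix_cstar_simps [simp]:
  "carrier (matrix_cstar k) = carrier_mat k k"
  "a \<otimes>\<^bsub>matrix_cstar k\<^esub> b = a * b"
  "\<one>\<^bsub>matrix_cstar k\<^esub> = 1\<^sub>m k"
  "\<zero>\<^bsub>matrix_cstar k\<^esub> = 0\<^sub>m k k"
  "a \<oplus>\<^bsub>matrix_cstar k\<^esub> b = a + b"
  "z \<odot>\<^bsub>matrix_cstar k\<^esub> a = z \<cdot>\<^sub>m a"
  "adj (matrix_cstar k) a = mat_adjoint a"
  by (simp_all add: matrix_cstar_def ring_mat_def)

lemma mat_adjoint_closed [simp]: "a \<in> carrier_mat k k \<Longrightarrow> mat_adjoint a \<in> carrier_mat k k"
  by (auto simp: mat_adjoint_def)

lemma mat_adjoint_index [simp]: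
  "a \<in> carrier_mat k k \<Longrightarrow> i < k \<Longrightarrow> j < k \<Longrightarrow> mat_adjoint a $$ (i, j) = cnj (a $$ (j, i))"
  by (auto simp: mat_adjoint_def mat_of_rows_index)

lemma cvec_norm_eq_L2_set:
  "v \<in> carrier_vec k \<Longrightarrow> cvec_norm v = L2_set (\<lambda>i. cmod (v $ i)) {0..<k}"
  by (simp add: cvec_norm_def L2_set_def scalar_prod_def complex_mult_cnj cmod_power2 Re_sum)

lemma cvec_norm_smult:
  assumes "v \<in> carrier_vec k"
  shows "cvec_norm (z \<cdot>\<^sub>v v) = cmod z * cvec_norm v"
proof -
  have "cvec_norm (z \<cdot>\<^sub>v v) = L2_set (\<lambda>i. cmod z * cmod (v $ i)) {0..<k}"
    using assms by (simp add: cvec_norm_eq_L2_set[where k=k] norm_mult cong: L2_set_cong_simp)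
  then show ?thesis
    using assms by (simp add: L2_set_right_distrib cvec_norm_eq_L2_set[where k=k])
qed

lemma cvec_norm_add_le:
  assumes "v \<in> carrier_vec k" "w \<in> carrier_vec k"
  shows "cvec_norm (v + w) \<le> cvec_norm v + cvec_norm w"
proof -
  have "cvec_norm (v + w) \<le> L2_set (\<lambda>i. cmod (v $ i) + cmod (w $ i)) {0..<k}"
    unfolding cvec_norm_eq_L2_set[OF add_carrier_vec[OF assms]]
    using assms by (intro L2_set_mono) (auto intro: norm_triangle_ineq)
  also have "\<dots> \<le> cvec_norm v + cvec_norm w"
    using assms by (simp add: cvec_norm_eq_L2_set[where k=k] L2_set_triangle_ineq)
  finally show ?thesis .
qed

lemma cvec_norm_nonneg: "v \<in> carrier_vec k \<Longrightarrow> 0 \<le> cvec_norm v"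
  by (simp add: cvec_norm_eq_L2_set)

lemma cvec_norm_eq_0: "v \<in> carrier_vec k \<Longrightarrow> cvec_norm v = 0 \<longleftrightarrow> v = 0\<^sub>v k"
  by (auto simp: cvec_norm_eq_L2_set L2_set_eq_0_iff)

lemma cvec_norm_zero [simp]: "cvec_norm (0\<^sub>v k) = 0"
  using cvec_norm_eq_0[of "0\<^sub>v k" k] by simp

lemma cmod_cscalar_prod_le:
  assumes "v \<in> carrier_vec k" "w \<in> carrier_vec k"
  shows "cmod (v \<bullet>c w) \<le> cvec_norm v * cvec_norm w"
proof -
  have "cmod (v \<bullet>c w) \<le> (\<Sum>i\<in>{0..<k}. \<bar>cmod (v $ i)\<bar> * \<bar>cmod (w $ i)\<bar>)"
    using assms by (auto simp: scalar_prod_def norm_mult intro!: sum_norm_le)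
  also have "\<dots> \<le> cvec_norm v * cvec_norm w"
    unfolding cvec_norm_eq_L2_set[OF assms(1)] cvec_norm_eq_L2_set[OF assms(2)]
    by (rule L2_set_mult_ineq)
  finally show ?thesis .
qed

lemma cscalar_prod_self:
  assumes "v \<in> carrier_vec k"
  shows "v \<bullet>c v = complex_of_real ((cvec_norm v)\<^sup>2)"
proof -
  have "v \<bullet>c v = complex_of_real (\<Sum>i\<in>{0..<k}. (cmod (v $ i))\<^sup>2)"
    using assms by (simp add: scalar_prod_def complex_norm_square[symmetric])
  then show ?thesis
    using assms by (simp add: cvec_norm_eq_L2_set L2_set_def sum_nonneg)
qed

lemma cscalar_prod_mat_adjoint:
  fixes a :: "complex mat"
  assumes a: "a \<in> carrier_mat k k" and v: "v \<in> carrier_vec k" and w: "w \<in> carrier_vec k"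
  shows "(a *\<^sub>v v) \<bullet>c w = v \<bullet>c (mat_adjoint a *\<^sub>v w)"
proof -
  have "(a *\<^sub>v v) \<bullet>c w = (\<Sum>i\<in>{0..<k}. \<Sum>j\<in>{0..<k}. a $$ (i, j) * v $ j * cnj (w $ i))"
    using a v w by (auto simp: scalar_prod_def sum_distrib_right intro!: sum.cong)
  also have "\<dots> = (\<Sum>j\<in>{0..<k}. \<Sum>i\<in>{0..<k}. a $$ (i, j) * v $ j * cnj (w $ i))"
    by (rule sum.swap)
  also have "\<dots> = v \<bullet>c (mat_adjoint a *\<^sub>v w)"
    using a v w carrier_matD[OF mat_adjoint_closed[OF a]]
    by (auto simp: scalar_prod_def sum_distrib_left conjugate_complex_def cnj_sum intro!: sum.cong)
  finally show ?thesis .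
qed

lemma nrm_matrix_cstar:
  "nrm (matrix_cstar k) a = (SUP v\<in>{v \<in> carrier_vec k. cvec_norm v \<le> 1}. cvec_norm (a *\<^sub>v v))"
  by (simp add: matrix_cstar_def ring_mat_def)

text \<open>A crude bound, whose purpose is to make the supremum in the operator norm finite and to show that
entrywise convergence implies convergence in norm.\<close>

lemma cvec_norm_mult_le_entries:
  assumes a: "a \<in> carrier_mat k k" and v: "v \<in> carrier_vec k"
  shows "cvec_norm (a *\<^sub>v v) \<le> (\<Sum>i<k. \<Sum>j<k. cmod (a $$ (i, j))) * cvec_norm v"
proof -
  have le: "cmod (v $ j) \<le> cvec_norm v" if "j < k" for j
    unfolding cvec_norm_eq_L2_set[OF v] by (rule member_le_L2_set) (use that in auto)
  have "cvec_norm (a *\<^sub>v v) \<le> (\<Sum>i\<in>{0..<k}. \<bar>cmod ((a *\<^sub>v v) $ i)\<bar>)"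
    unfolding cvec_norm_eq_L2_set[OF mult_mat_vec_carrier[OF a v]] by (rule L2_set_le_sum_abs)
  also have "\<dots> \<le> (\<Sum>i\<in>{0..<k}. \<Sum>j\<in>{0..<k}. cmod (a $$ (i, j)) * cvec_norm v)"
  proof (rule sum_mono)
    fix i assume i: "i \<in> {0..<k}"
    have "(a *\<^sub>v v) $ i = (\<Sum>j\<in>{0..<k}. a $$ (i, j) * v $ j)"
      using a v i by (simp add: scalar_prod_def)
    also have "cmod \<dots> \<le> (\<Sum>j\<in>{0..<k}. cmod (a $$ (i, j)) * cvec_norm v)"
      by (rule sum_norm_le) (auto simp: norm_mult intro!: mult_left_mono le)
    finally show "\<bar>cmod ((a *\<^sub>v v) $ i)\<bar> \<le> (\<Sum>j\<in>{0..<k}. cmod (a $$ (i, j)) * cvec_norm v)"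
      by simp
  qed
  finally show ?thesis by (simp add: sum_distrib_right lessThan_atLeast0)
qed

lemma cvec_norm_le_nrm:
  assumes a: "a \<in> carrier_mat k k" and v: "v \<in> carrier_vec k"
  shows "cvec_norm (a *\<^sub>v v) \<le> nrm (matrix_cstar k) a * cvec_norm v"
proof (cases "v = 0\<^sub>v k")
  case True
  then have "a *\<^sub>v v = 0\<^sub>v k" using a by auto
  with True show ?thesis by simp
next
  case False
  define c where "c = cvec_norm v"
  have c: "c > 0"
    using False v cvec_norm_nonneg[OF v] cvec_norm_eq_0[OF v] by (auto simp: c_def)
  define w where "w = complex_of_real (1 / c) \<cdot>\<^sub>v v"
  have w: "w \<in> carrier_vec k" using v by (simp add: w_def)
  have nw: "cvec_norm w = 1"
    using c v by (simp add: w_def cvec_norm_smult[where k=k] c_def norm_divide)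
  have bdd: "bdd_above ((\<lambda>v. cvec_norm (a *\<^sub>v v)) ` {v \<in> carrier_vec k. cvec_norm v \<le> 1})"
  proof (rule bdd_aboveI2)
    fix u assume u: "u \<in> {v \<in> carrier_vec k. cvec_norm v \<le> 1}"
    have "cvec_norm (a *\<^sub>v u) \<le> (\<Sum>i<k. \<Sum>j<k. cmod (a $$ (i, j))) * cvec_norm u"
      using cvec_norm_mult_le_entries[OF a] u by blast
    also have "\<dots> \<le> (\<Sum>i<k. \<Sum>j<k. cmod (a $$ (i, j)))"
      using u by (intro mult_left_le) (auto intro!: sum_nonneg)
    finally show "cvec_norm (a *\<^sub>v u) \<le> (\<Sum>i<k. \<Sum>j<k. cmod (a $$ (i, j)))" .
  qed
  have "cvec_norm (a *\<^sub>v w) \<le> nrm (matrix_cstar k) a"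
    unfolding nrm_matrix_cstar by (rule cSUP_upper[OF _ bdd]) (use w nw in auto)
  moreover have "cvec_norm (a *\<^sub>v w) = cvec_norm (a *\<^sub>v v) / c"
    unfolding w_def using a v c
    by (simp add: mult_mat_vec cvec_norm_smult[where k=k] norm_divide)
  ultimately show ?thesis
    using c by (simp add: divide_le_eq c_def)
qed

lemma nrm_matrix_le:
  assumes a: "a \<in> carrier_mat k k" and C: "0 \<le> C"
    and le: "\<And>v. v \<in> carrier_vec k \<Longrightarrow> cvec_norm (a *\<^sub>v v) \<le> C * cvec_norm v"
  shows "nrm (matrix_cstar k) a \<le> C"
  unfolding nrm_matrix_cstar
proof (rule cSUP_least)
  show "{v \<in> carrier_vec k. cvec_norm v \<le> 1} \<noteq> {}"
    using cvec_norm_zero[of k] zero_carrier_vec[of k] by (metis (mono_tags, lifting) empty_iff mem_Collect_eq zero_le_one)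
  fix v assume v: "v \<in> {v \<in> carrier_vec k. cvec_norm v \<le> 1}"
  then have "cvec_norm (a *\<^sub>v v) \<le> C * cvec_norm v" using le by blast
  also have "\<dots> \<le> C" using v C by (intro mult_left_le) auto
  finally show "cvec_norm (a *\<^sub>v v) \<le> C" .
qed

lemma cvec_norm_unit_vec: "j < k \<Longrightarrow> cvec_norm (unit_vec k j) = 1"
proof -
  assume j: "j < k"
  have "(\<Sum>i\<in>{0..<k}. (cmod (unit_vec k j $ i))\<^sup>2) = (\<Sum>i\<in>{0..<k}. if i = j then 1 else 0)"
    using j by (intro sum.cong) auto
  then show ?thesis using j by (simp add: cvec_norm_eq_L2_set[where k=k] L2_set_def)
qed

lemma nrm_matrix_nonneg:
  assumes "a \<in> carrier_mat k k" shows "0 \<le> nrm (matrix_cstar k) a"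
proof (cases "k = 0")
  case True
  have "{v \<in> carrier_vec k. cvec_norm v \<le> 1} = {0\<^sub>v 0}" using True cvec_norm_zero[of 0] by auto
  with True assms show ?thesis by (auto simp: nrm_matrix_cstar cvec_norm_nonneg[of _ 0])
next
  case False
  have u: "unit_vec k 0 \<in> carrier_vec k" by simp
  have "0 \<le> nrm (matrix_cstar k) a * cvec_norm (unit_vec k 0)"
    using cvec_norm_le_nrm[OF assms u] cvec_norm_nonneg[of "a *\<^sub>v unit_vec k 0" k] assms
    by (auto intro: order_trans)
  with False show ?thesis by (simp add: cvec_norm_unit_vec)
qed

lemma nrm_matrix_le_entries:
  "a \<in> carrier_mat k k \<Longrightarrow> nrm (matrix_cstar k) a \<le> (\<Sum>i<k. \<Sum>j<k. cmod (a $$ (i, j)))"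
  by (intro nrm_matrix_le cvec_norm_mult_le_entries sum_nonneg) auto

lemma entry_le_nrm_matrix:
  assumes a: "a \<in> carrier_mat k k" and i: "i < k" and j: "j < k"
  shows "cmod (a $$ (i, j)) \<le> nrm (matrix_cstar k) a"
proof -
  have av: "a *\<^sub>v unit_vec k j \<in> carrier_vec k" using a by auto
  have "(a *\<^sub>v unit_vec k j) $ i = a $$ (i, j)"
    using a i j by simp
  then have "cmod (a $$ (i, j)) \<le> cvec_norm (a *\<^sub>v unit_vec k j)"
    unfolding cvec_norm_eq_L2_set[OF av] 
    by (metis (no_types, lifting) atLeastLessThan_iff finite_atLeastLessThan i le0 member_le_L2_set norm_ge_zero)
  also have "\<dots> \<le> nrm (matrix_cstar k) a"
    using cvec_norm_le_nrm[OF a, of "unit_vec k j"] by (simp add: cvec_norm_unit_vec[OF j])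
  finally show ?thesis .
qed

abbreviation diagonal :: "nat \<Rightarrow> (nat \<Rightarrow> complex) \<Rightarrow> complex mat" where
  "diagonal k c \<equiv> mat k k (\<lambda>(i, j). if i = j then c i else 0)"

lemma nrm_diagonal_le:
  assumes C: "0 \<le> C" and le: "\<And>i. i < k \<Longrightarrow> cmod (c i) \<le> C"
  shows "nrm (matrix_cstar k) (diagonal k c) \<le> C"
proof (rule nrm_matrix_le[OF _ C])
  let ?a = "diagonal k c"
  fix v :: "complex vec" assume v: "v \<in> carrier_vec k"
  have av: "?a *\<^sub>v v \<in> carrier_vec k" by (simp add: mult_mat_vec_carrier[OF _ v])
  have "(?a *\<^sub>v v) $ i = c i * v $ i" if "i < k" for i
    using v that by (simp add: scalar_prod_def if_distrib if_distribR cong: if_cong)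
  then have "cvec_norm (?a *\<^sub>v v) \<le> L2_set (\<lambda>i. C * cmod (v $ i)) {0..<k}"
    unfolding cvec_norm_eq_L2_set[OF av]
    by (intro L2_set_mono) (auto simp: norm_mult intro!: mult_right_mono le)
  also have "\<dots> = C * cvec_norm v"
    using v C by (simp add: cvec_norm_eq_L2_set[where k=k] L2_set_right_distrib)
  finally show "cvec_norm (?a *\<^sub>v v) \<le> C * cvec_norm v" .
qed simp
lemma nrm_matrix_mult_le:
  assumes a: "a \<in> carrier_mat k k" and b: "b \<in> carrier_mat k k"
  shows "nrm (matrix_cstar k) (a * b) \<le> nrm (matrix_cstar k) a * nrm (matrix_cstar k) b"
proof (rule nrm_matrix_le)
  show "0 \<le> nrm (matrix_cstar k) a * nrm (matrix_cstar k) b"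
    by (simp add: nrm_matrix_nonneg a b)
  fix v :: "complex vec" assume v: "v \<in> carrier_vec k"
  have bv: "b *\<^sub>v v \<in> carrier_vec k" using b v by (rule mult_mat_vec_carrier)
  have "cvec_norm (a * b *\<^sub>v v) = cvec_norm (a *\<^sub>v (b *\<^sub>v v))"
    using assoc_mult_mat_vec[OF a b v] by simp
  also have "\<dots> \<le> nrm (matrix_cstar k) a * cvec_norm (b *\<^sub>v v)"
    by (rule cvec_norm_le_nrm[OF a bv])
  also have "\<dots> \<le> nrm (matrix_cstar k) a * (nrm (matrix_cstar k) b * cvec_norm v)"
    by (intro mult_left_mono cvec_norm_le_nrm b v nrm_matrix_nonneg a)
  finally show "cvec_norm (a * b *\<^sub>v v) \<le> nrm (matrix_cstar k) a * nrm (matrix_cstar k) b * cvec_norm v"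
    by (simp add: mult.assoc)
qed (use a b in auto)

lemma nrm_matrix_add_le:
  assumes a: "a \<in> carrier_mat k k" and b: "b \<in> carrier_mat k k"
  shows "nrm (matrix_cstar k) (a + b) \<le> nrm (matrix_cstar k) a + nrm (matrix_cstar k) b"
proof (rule nrm_matrix_le)
  show "0 \<le> nrm (matrix_cstar k) a + nrm (matrix_cstar k) b"
    by (simp add: nrm_matrix_nonneg a b)
  fix v :: "complex vec" assume v: "v \<in> carrier_vec k"
  have "cvec_norm ((a + b) *\<^sub>v v) \<le> cvec_norm (a *\<^sub>v v) + cvec_norm (b *\<^sub>v v)"
    unfolding add_mult_distrib_mat_vec[OF a b v]
    by (rule cvec_norm_add_le[OF mult_mat_vec_carrier[OF a v] mult_mat_vec_carrier[OF b v]])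
  also have "\<dots> \<le> (nrm (matrix_cstar k) a + nrm (matrix_cstar k) b) * cvec_norm v"
    using cvec_norm_le_nrm[OF a v] cvec_norm_le_nrm[OF b v] by (simp add: distrib_right)
  finally show "cvec_norm ((a + b) *\<^sub>v v) \<le> (nrm (matrix_cstar k) a + nrm (matrix_cstar k) b) * cvec_norm v" .
qed (use a b in auto)

lemma nrm_matrix_smult_le:
  assumes a: "a \<in> carrier_mat k k"
  shows "nrm (matrix_cstar k) (z \<cdot>\<^sub>m a) \<le> cmod z * nrm (matrix_cstar k) a"
proof (rule nrm_matrix_le)
  show "0 \<le> cmod z * nrm (matrix_cstar k) a"
    by (simp add: nrm_matrix_nonneg a)
  fix v :: "complex vec" assume v: "v \<in> carrier_vec k"
  have "(z \<cdot>\<^sub>m a) *\<^sub>v v = z \<cdot>\<^sub>v (a *\<^sub>v v)"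
    using a v by (intro eq_vecI) auto
  then show "cvec_norm ((z \<cdot>\<^sub>m a) *\<^sub>v v) \<le> cmod z * nrm (matrix_cstar k) a * cvec_norm v"
    using cvec_norm_le_nrm[OF a v] mult_mat_vec_carrier[OF a v]
    by (simp add: cvec_norm_smult mult.assoc mult_left_mono)
qed (use a in auto)

lemma nrm_matrix_smult:
  assumes a: "a \<in> carrier_mat k k"
  shows "nrm (matrix_cstar k) (z \<cdot>\<^sub>m a) = cmod z * nrm (matrix_cstar k) a"
proof (cases "z = 0")
  case True
  then show ?thesis
    using nrm_matrix_smult_le[OF a, of z] nrm_matrix_nonneg[of "z \<cdot>\<^sub>m a" k] a by simp
next
  case False
  have "a = inverse z \<cdot>\<^sub>m (z \<cdot>\<^sub>m a)"
    using False a by (intro eq_matI) auto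
  then have "nrm (matrix_cstar k) a \<le> inverse (cmod z) * nrm (matrix_cstar k) (z \<cdot>\<^sub>m a)"
    using nrm_matrix_smult_le[of "z \<cdot>\<^sub>m a" k "inverse z"] a by (simp add: norm_inverse)
  then show ?thesis
    using nrm_matrix_smult_le[OF a, of z] False by (simp add: field_simps)
qed

text \<open>By \<open>\<parallel>a v\<parallel>\<^sup>2 = \<langle>v, a* (a v)\<rangle>\<close> and the Cauchy-Schwarz inequality.  Applied to \<open>a*\<close> as well, this yields
equality of the norms.\<close>

lemma nrm_matrix_mat_adjoint_le:
  assumes a: "a \<in> carrier_mat k k"
  shows "nrm (matrix_cstar k) a \<le> nrm (matrix_cstar k) (mat_adjoint a)"
proof (rule nrm_matrix_le[OF a])
  let ?n = "nrm (matrix_cstar k) (mat_adjoint a)"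
  show "0 \<le> ?n" by (simp add: nrm_matrix_nonneg a)
  fix v :: "complex vec" assume v: "v \<in> carrier_vec k"
  define w where "w = a *\<^sub>v v"
  have w: "w \<in> carrier_vec k" using a v by (simp add: w_def mult_mat_vec_carrier)
  have "complex_of_real ((cvec_norm w)\<^sup>2) = v \<bullet>c (mat_adjoint a *\<^sub>v w)"
    unfolding cscalar_prod_self[OF w, symmetric] by (simp add: w_def cscalar_prod_mat_adjoint[OF a v] w[unfolded w_def])
  then have "(cvec_norm w)\<^sup>2 = cmod (v \<bullet>c (mat_adjoint a *\<^sub>v w))"
    by (metis norm_of_real abs_power2)
  also have "\<dots> \<le> cvec_norm v * cvec_norm (mat_adjoint a *\<^sub>v w)"
    by (rule cmod_cscalar_prod_le[OF v mult_mat_vec_carrier[OF mat_adjoint_closed[OF a] w]])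
  also have "\<dots> \<le> cvec_norm v * (?n * cvec_norm w)"
    by (intro mult_left_mono cvec_norm_le_nrm cvec_norm_nonneg[OF v] w mat_adjoint_closed a)
  finally have "cvec_norm w * cvec_norm w \<le> (?n * cvec_norm v) * cvec_norm w"
    by (simp add: power2_eq_square mult_ac)
  then show "cvec_norm (a *\<^sub>v v) \<le> ?n * cvec_norm v"
    using cvec_norm_nonneg[OF w] cvec_norm_nonneg[OF v] \<open>0 \<le> ?n\<close>
    by (cases "cvec_norm w = 0") (auto simp: w_def[symmetric])
qed

lemma mat_adjoint_mat_adjoint [simp]: 
  assumes "a \<in> carrier_mat k k" shows "mat_adjoint (mat_adjoint a :: complex mat) = a"
  using assms carrier_matD[OF mat_adjoint_closed[OF assms]] carrier_matD[OF mat_adjoint_closed[OF mat_adjoint_closed[OF assms]]]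
  by (intro eq_matI) (auto simp: mat_adjoint_index[OF mat_adjoint_closed[OF assms]])

lemma nrm_matrix_mat_adjoint:
  "a \<in> carrier_mat k k \<Longrightarrow> nrm (matrix_cstar k) (mat_adjoint a) = nrm (matrix_cstar k) a"
  using nrm_matrix_mat_adjoint_le[of a k] nrm_matrix_mat_adjoint_le[of "mat_adjoint a" k] by simp

lemma nrm_matrix_cstar_identity:
  assumes a: "a \<in> carrier_mat k k"
  shows "nrm (matrix_cstar k) (mat_adjoint a * a) = (nrm (matrix_cstar k) a)\<^sup>2"
proof (rule antisym)
  show "nrm (matrix_cstar k) (mat_adjoint a * a) \<le> (nrm (matrix_cstar k) a)\<^sup>2"
    using nrm_matrix_mult_le[OF mat_adjoint_closed[OF a] a]
    by (simp add: nrm_matrix_mat_adjoint[OF a] power2_eq_square)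
  let ?b = "mat_adjoint a * a"
  have b: "?b \<in> carrier_mat k k" by (rule mult_carrier_mat[OF mat_adjoint_closed[OF a] a])
  note nb = nrm_matrix_nonneg[OF b]
  have "nrm (matrix_cstar k) a \<le> sqrt (nrm (matrix_cstar k) ?b)"
  proof (rule nrm_matrix_le[OF a])
    show "0 \<le> sqrt (nrm (matrix_cstar k) ?b)" using nb by simp
    fix v :: "complex vec" assume v: "v \<in> carrier_vec k"
    have w: "a *\<^sub>v v \<in> carrier_vec k" using a v by (rule mult_mat_vec_carrier)
    have "complex_of_real ((cvec_norm (a *\<^sub>v v))\<^sup>2) = v \<bullet>c (?b *\<^sub>v v)"
      unfolding cscalar_prod_self[OF w, symmetric] cscalar_prod_mat_adjoint[OF a v w]
      using assoc_mult_mat_vec[OF mat_adjoint_closed[OF a] a v] by simp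
    then have "(cvec_norm (a *\<^sub>v v))\<^sup>2 = cmod (v \<bullet>c (?b *\<^sub>v v))"
      by (metis norm_of_real abs_power2)
    also have "\<dots> \<le> cvec_norm v * cvec_norm (?b *\<^sub>v v)"
      by (rule cmod_cscalar_prod_le[OF v mult_mat_vec_carrier[OF b v]])
    also have "\<dots> \<le> cvec_norm v * (nrm (matrix_cstar k) ?b * cvec_norm v)"
      by (intro mult_left_mono cvec_norm_le_nrm[OF b v] cvec_norm_nonneg[OF v])
    finally have "(cvec_norm (a *\<^sub>v v))\<^sup>2 \<le> (sqrt (nrm (matrix_cstar k) ?b) * cvec_norm v)\<^sup>2"
      using nb by (simp add: power_mult_distrib power2_eq_square[of "cvec_norm v"] mult_ac)
    then show "cvec_norm (a *\<^sub>v v) \<le> sqrt (nrm (matrix_cstar k) ?b) * cvec_norm v"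
      by (rule power2_le_imp_le) (use nb cvec_norm_nonneg[OF v] in simp)
  qed
  then have "(nrm (matrix_cstar k) a)\<^sup>2 \<le> (sqrt (nrm (matrix_cstar k) ?b))\<^sup>2"
    by (rule power_mono) (rule nrm_matrix_nonneg[OF a])
  then show "(nrm (matrix_cstar k) a)\<^sup>2 \<le> nrm (matrix_cstar k) ?b"
    using nb by simp
qed

lemma nrm_matrix_eq_0:
  assumes a: "a \<in> carrier_mat k k"
  shows "nrm (matrix_cstar k) a = 0 \<longleftrightarrow> a = 0\<^sub>m k k"
proof
  assume "nrm (matrix_cstar k) a = 0"
  then have "a $$ (i, j) = 0" if "i < k" "j < k" for i j
    using entry_le_nrm_matrix[OF a that] by simp
  then show "a = 0\<^sub>m k k" using a by (intro eq_matI) auto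
next
  assume "a = 0\<^sub>m k k"
  then have "nrm (matrix_cstar k) a \<le> 0"
    using nrm_matrix_le_entries[OF a] by simp
  then show "nrm (matrix_cstar k) a = 0" using nrm_matrix_nonneg[OF a] by simp
qed

lemma ring_matrix_cstar: "ring (matrix_cstar k)"
  unfolding matrix_cstar_def by (rule ring_mat)

lemma matrix_cstar_minus [simp]:
  assumes a: "a \<in> carrier_mat k k" and b: "b \<in> carrier_mat k k"
  shows "a \<ominus>\<^bsub>matrix_cstar k\<^esub> b = a - b"
proof -
  interpret ring "matrix_cstar k" by (rule ring_matrix_cstar)
  have ab: "a - b \<in> carrier_mat k k" using b by (rule minus_carrier_mat)
  have "(a - b) + b = a" using a b by (intro eq_matI) auto
  then have "(a - b) \<oplus>\<^bsub>matrix_cstar k\<^esub> b = a" by simp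
  then show ?thesis
    using a b ab by (metis a_inv_closed add.m_assoc add.r_inv matrix_cstar_simps(1) minus_eq r_zero)
qed

text \<open>Stated from the norm axioms alone, because completeness with respect to this metric is itself one of the
axioms of a C*-algebra: the metric is needed before that structure is available.\<close>

lemma Metric_space_nrm_dist:
  assumes "ring A"
    and nonneg: "\<And>a. a \<in> carrier A \<Longrightarrow> 0 \<le> nrm A a"
    and zero: "\<And>a. a \<in> carrier A \<Longrightarrow> nrm A a = 0 \<longleftrightarrow> a = \<zero>\<^bsub>A\<^esub>"
    and tri: "\<And>a b. a \<in> carrier A \<Longrightarrow> b \<in> carrier A \<Longrightarrow> nrm A (a \<oplus>\<^bsub>A\<^esub> b) \<le> nrm A a + nrm A b"
    and neg: "\<And>a. a \<in> carrier A \<Longrightarrow> nrm A (\<ominus>\<^bsub>A\<^esub> a) = nrm A a"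
  shows "Metric_space (carrier A) (nrm_dist A)"
proof -
  interpret ring A by fact
  show ?thesis
  proof
    fix a b c
    show "0 \<le> nrm_dist A a b" by (simp add: nrm_dist_def nonneg)
    have "b \<ominus>\<^bsub>A\<^esub> a = \<ominus>\<^bsub>A\<^esub> (a \<ominus>\<^bsub>A\<^esub> b)" if "a \<in> carrier A" "b \<in> carrier A" 
      using that by (simp add: minus_eq minus_add a_comm)
    then show "nrm_dist A a b = nrm_dist A b a"
      by (simp add: nrm_dist_def neg)
    assume a: "a \<in> carrier A" and b: "b \<in> carrier A"
    show "nrm_dist A a b = 0 \<longleftrightarrow> a = b"
      using a b by (simp add: nrm_dist_def zero)
    assume c: "c \<in> carrier A"
    have "a \<ominus>\<^bsub>A\<^esub> c = (a \<ominus>\<^bsub>A\<^esub> b) \<oplus>\<^bsub>A\<^esub> (b \<ominus>\<^bsub>A\<^esub> c)"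
      using a b c by (simp add: minus_eq a_assoc r_neg1)
    then show "nrm_dist A a c \<le> nrm_dist A a b + nrm_dist A b c"
      using a b c tri[of "a \<ominus>\<^bsub>A\<^esub> b" "b \<ominus>\<^bsub>A\<^esub> c"] by (simp add: nrm_dist_def)
  qed
qed

lemma Metric_space_matrix: "Metric_space (carrier (matrix_cstar k)) (nrm_dist (matrix_cstar k))"
proof (rule Metric_space_nrm_dist[OF ring_matrix_cstar])
  interpret ring "matrix_cstar k" by (rule ring_matrix_cstar)
  fix a assume a: "a \<in> carrier (matrix_cstar k)"
  have "\<ominus>\<^bsub>matrix_cstar k\<^esub> a = 0\<^sub>m k k - a"
    using matrix_cstar_minus[of "0\<^sub>m k k" k a] a minus_eq[of "0\<^sub>m k k" a] l_zero[OF a_inv_closed[OF a]] by simp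
  also have "\<dots> = (- 1) \<cdot>\<^sub>m a" using a by (intro eq_matI) auto
  finally show "nrm (matrix_cstar k) (\<ominus>\<^bsub>matrix_cstar k\<^esub> a) = nrm (matrix_cstar k) a"
    using a by (simp add: nrm_matrix_smult)
qed (use nrm_matrix_nonneg nrm_matrix_eq_0 nrm_matrix_add_le in auto)

text \<open>A Cauchy sequence of matrices converges entrywise, and the norm is bounded by the sum of the
moduli of the entries.\<close>

lemma complete_matrix: "Metric_space.mcomplete (carrier (matrix_cstar k)) (nrm_dist (matrix_cstar k))"
proof -
  interpret Metric_space "carrier (matrix_cstar k)" "nrm_dist (matrix_cstar k)"
    by (rule Metric_space_matrix)
  show ?thesis
    unfolding mcomplete_def
  proof (intro allI impI)
    fix \<sigma> assume \<sigma>: "MCauchy \<sigma>"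
    then have car: "\<sigma> n \<in> carrier_mat k k" for n unfolding MCauchy_def by auto
    have "\<exists>l. (\<lambda>n. \<sigma> n $$ (i, j)) \<longlonglongrightarrow> l" if ij: "i < k" "j < k" for i j
    proof -
      have "Cauchy (\<lambda>n. \<sigma> n $$ (i, j))"
      proof (rule metric_CauchyI)
        fix e :: real assume "e > 0"
        then obtain N where N: "\<And>m n. N \<le> m \<Longrightarrow> N \<le> n \<Longrightarrow> nrm_dist (matrix_cstar k) (\<sigma> m) (\<sigma> n) < e"
          using \<sigma> unfolding MCauchy_def by blast
        have "dist (\<sigma> m $$ (i, j)) (\<sigma> n $$ (i, j)) < e" if "N \<le> m" "N \<le> n" for m n
        proof -
          have "cmod ((\<sigma> m - \<sigma> n) $$ (i, j)) \<le> nrm (matrix_cstar k) (\<sigma> m - \<sigma> n)"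
            using car ij by (intro entry_le_nrm_matrix minus_carrier_mat) auto
          then show ?thesis
            using N[OF that] car[of m] car[of n] ij by (simp add: nrm_dist_def dist_norm)
        qed
        then show "\<exists>M. \<forall>m\<ge>M. \<forall>n\<ge>M. dist (\<sigma> m $$ (i, j)) (\<sigma> n $$ (i, j)) < e" by blast
      qed
      then show ?thesis using Cauchy_convergent convergent_def by blast
    qed
    then obtain l where l: "\<And>i j. i < k \<Longrightarrow> j < k \<Longrightarrow> (\<lambda>n. \<sigma> n $$ (i, j)) \<longlonglongrightarrow> l i j"
      by metis
    define a where "a = mat k k (\<lambda>(i, j). l i j)"
    have a: "a \<in> carrier_mat k k" by (simp add: a_def)
    have "(\<lambda>n. \<Sum>i<k. \<Sum>j<k. cmod (\<sigma> n $$ (i, j) - l i j)) \<longlonglongrightarrow> (\<Sum>i<k. \<Sum>j<k. cmod (l i j - l i j))"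
      by (intro tendsto_intros l) auto
    then have lim0: "(\<lambda>n. \<Sum>i<k. \<Sum>j<k. cmod (\<sigma> n $$ (i, j) - l i j)) \<longlonglongrightarrow> 0" by simp
    have "nrm_dist (matrix_cstar k) (\<sigma> n) a \<le> (\<Sum>i<k. \<Sum>j<k. cmod (\<sigma> n $$ (i, j) - l i j))" for n
    proof -
      have "nrm (matrix_cstar k) (\<sigma> n - a) \<le> (\<Sum>i<k. \<Sum>j<k. cmod ((\<sigma> n - a) $$ (i, j)))"
        by (intro nrm_matrix_le_entries minus_carrier_mat a)
      also have "\<dots> = (\<Sum>i<k. \<Sum>j<k. cmod (\<sigma> n $$ (i, j) - l i j))"
        using car[of n] by (intro sum.cong) (auto simp: a_def)
      finally show ?thesis using car[of n] a by (simp add: nrm_dist_def)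
    qed
    then have "(\<lambda>n. nrm_dist (matrix_cstar k) (\<sigma> n) a) \<longlonglongrightarrow> 0"
      by (intro tendsto_sandwich[OF _ _ tendsto_const lim0]) (auto intro: always_eventually)
    then show "\<exists>x. limitin mtopology \<sigma> x sequentially"
      using a car unfolding limitin_metric_dist_null by auto
  qed
qed

lemma unital_cstar_algebra_matrix:
  assumes k: "1 \<le> k"
  shows "unital_cstar_algebra (matrix_cstar k)"
proof (intro unital_cstar_algebra.intro unital_cstar_algebra_axioms.intro ring_matrix_cstar complete_matrix)
  show "\<one>\<^bsub>matrix_cstar k\<^esub> \<noteq> \<zero>\<^bsub>matrix_cstar k\<^esub>"
  proof
    assume "\<one>\<^bsub>matrix_cstar k\<^esub> = \<zero>\<^bsub>matrix_cstar k\<^esub>"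
    then have "(1\<^sub>m k :: complex mat) $$ (0, 0) = 0\<^sub>m k k $$ (0, 0)" by simp
    with k show False by simp
  qed
next
  fix a b :: "complex mat" assume ab: "a \<in> carrier (matrix_cstar k)" "b \<in> carrier (matrix_cstar k)"
  note c = carrier_matD[OF mat_adjoint_closed[of a k]] carrier_matD[OF mat_adjoint_closed[of b k]]
  show "adj (matrix_cstar k) (a \<oplus>\<^bsub>matrix_cstar k\<^esub> b) = adj (matrix_cstar k) a \<oplus>\<^bsub>matrix_cstar k\<^esub> adj (matrix_cstar k) b"
    using ab c carrier_matD[OF mat_adjoint_closed[OF add_carrier_mat, of b k a]]
    by (intro eq_matI) (auto simp: mat_adjoint_index[OF add_carrier_mat])
  show "adj (matrix_cstar k) (a \<otimes>\<^bsub>matrix_cstar k\<^esub> b) = adj (matrix_cstar k) b \<otimes>\<^bsub>matrix_cstar k\<^esub> adj (matrix_cstar k) a"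
    using ab c carrier_matD[OF mat_adjoint_closed[OF mult_carrier_mat, of a k k b]]
    by (intro eq_matI) (auto simp: mat_adjoint_index[OF mult_carrier_mat] scalar_prod_def cnj_sum intro!: sum.cong)
next
  fix z and a :: "complex mat" assume a: "a \<in> carrier (matrix_cstar k)"
  show "adj (matrix_cstar k) (z \<odot>\<^bsub>matrix_cstar k\<^esub> a) = cnj z \<odot>\<^bsub>matrix_cstar k\<^esub> adj (matrix_cstar k) a"
    using a carrier_matD[OF mat_adjoint_closed[of a k]] carrier_matD[OF mat_adjoint_closed[of "z \<cdot>\<^sub>m a" k]]
    by (intro eq_matI) (auto simp: mat_adjoint_index[OF smult_carrier_mat])
qed (auto simp: nrm_matrix_nonneg nrm_matrix_eq_0 nrm_matrix_add_le nrm_matrix_smult nrm_matrix_mult_le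
      nrm_matrix_cstar_identity add_smult_distrib_right_mat add_smult_distrib_left_mat
      mult_smult_distrib mult_smult_assoc_mat intro!: eq_matI)

section \<open>The C*-algebra of bounded sequences\<close>

context unital_cstar_algebra
begin

lemma a_inv_eq_smult: 
  assumes a: "a \<in> carrier A" 
  shows "\<ominus> a = (- 1) \<odot> a"
proof -
  have "0 \<odot> a = (0 + 0) \<odot> a" by simp
  also have "\<dots> = 0 \<odot> a \<oplus> 0 \<odot> a" by (rule smult_add_left[OF a])
  finally have z: "0 \<odot> a = \<zero>" using smult_closed[OF a, of 0] by simp
  have "(- 1) \<odot> a \<oplus> a = (- 1 + 1) \<odot> a"
    unfolding smult_add_left[OF a] smult_one[OF a] ..
  then have "(- 1) \<odot> a \<oplus> a = \<zero>" using z by simp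
  then show ?thesis using a smult_closed[OF a, of "- 1"] by (simp add: minus_equality)
qed

lemma nrm_adj: 
  assumes a: "a \<in> carrier A" shows "nrm A (adj A a) = nrm A a"
proof -
  have le: "nrm A b \<le> nrm A (adj A b)" if b: "b \<in> carrier A" for b
  proof -
    have "nrm A b * nrm A b = nrm A (adj A b \<otimes> b)"
      by (simp add: cstar_identity b power2_eq_square)
    also have "\<dots> \<le> nrm A (adj A b) * nrm A b"
      by (simp add: nrm_mult b adj_closed)
    finally show ?thesis
      using nrm_nonneg[OF b] nrm_nonneg[OF adj_closed[OF b]] by (cases "nrm A b = 0") auto
  qed
  show ?thesis using le[OF a] le[OF adj_closed[OF a]] adj_adj[OF a] by simp
qed

lemma nrm_minus_cancel: "a \<in> carrier A \<Longrightarrow> nrm A (\<ominus> a) = nrm A a"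
  by (simp add: a_inv_eq_smult nrm_smult)

lemma Metric_space_nrm: "Metric_space (carrier A) (nrm_dist A)"
  by (rule Metric_space_nrm_dist)
    (auto simp: ring_axioms nrm_nonneg nrm_eq_zero nrm_triangle nrm_minus_cancel)

sublocale nrm: Metric_space "carrier A" "nrm_dist A"
  by (rule Metric_space_nrm)

end

definition bounded_seqs :: "'a cstar \<Rightarrow> (nat \<Rightarrow> 'a) set" where
  "bounded_seqs A = {s. (\<forall>j. s j \<in> carrier A) \<and> bdd_above (range (\<lambda>j. nrm A (s j)))}"

text \<open>The algebras of bridges live in a fixed type, so a sequence \<open>s\<close> is represented by a code
\<open>enc s\<close>, with \<open>enc\<close> injective on bounded sequences.  All operations are pointwise and the norm is the
supremum norm.\<close>

definition seq_cstar :: "((nat \<Rightarrow> 'a) \<Rightarrow> 'd) \<Rightarrow> 'a cstar \<Rightarrow> 'd cstar" where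
  "seq_cstar enc A = (let dec = inv_into (bounded_seqs A) enc in
     \<lparr>carrier = enc ` bounded_seqs A,
      mult = (\<lambda>p q. enc (\<lambda>j. dec p j \<otimes>\<^bsub>A\<^esub> dec q j)),
      one = enc (\<lambda>j. \<one>\<^bsub>A\<^esub>),
      zero = enc (\<lambda>j. \<zero>\<^bsub>A\<^esub>),
      add = (\<lambda>p q. enc (\<lambda>j. dec p j \<oplus>\<^bsub>A\<^esub> dec q j)),
      smult = (\<lambda>z p. enc (\<lambda>j. z \<odot>\<^bsub>A\<^esub> dec p j)),
      adj = (\<lambda>p. enc (\<lambda>j. adj A (dec p j))),
      nrm = (\<lambda>p. SUP j. nrm A (dec p j))\<rparr>)"

locale coded_sequences = unital_cstar_algebra A for A :: "'a cstar" (structure) +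
  fixes enc :: "(nat \<Rightarrow> 'a) \<Rightarrow> 'd"
  assumes inj: "inj_on enc (bounded_seqs A)"
begin

abbreviation D :: "'d cstar" where "D \<equiv> seq_cstar enc A"
abbreviation dec :: "'d \<Rightarrow> nat \<Rightarrow> 'a" where "dec \<equiv> inv_into (bounded_seqs A) enc"

lemma dec_enc [simp]: "s \<in> bounded_seqs A \<Longrightarrow> dec (enc s) = s"
  by (rule inv_into_f_f[OF inj])

lemma carrier_D: "carrier D = enc ` bounded_seqs A"
  by (simp add: seq_cstar_def Let_def)

lemma enc_closed [simp]: "s \<in> bounded_seqs A \<Longrightarrow> enc s \<in> carrier D"
  by (simp add: carrier_D)

lemma D_simps [simp]:
  "s \<in> bounded_seqs A \<Longrightarrow> t \<in> bounded_seqs A \<Longrightarrow> enc s \<otimes>\<^bsub>D\<^esub> enc t = enc (\<lambda>j. s j \<otimes> t j)"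
  "s \<in> bounded_seqs A \<Longrightarrow> t \<in> bounded_seqs A \<Longrightarrow> enc s \<oplus>\<^bsub>D\<^esub> enc t = enc (\<lambda>j. s j \<oplus> t j)"
  "s \<in> bounded_seqs A \<Longrightarrow> z \<odot>\<^bsub>D\<^esub> enc s = enc (\<lambda>j. z \<odot> s j)"
  "s \<in> bounded_seqs A \<Longrightarrow> adj D (enc s) = enc (\<lambda>j. adj A (s j))"
  "s \<in> bounded_seqs A \<Longrightarrow> nrm D (enc s) = (SUP j. nrm A (s j))"
  "\<one>\<^bsub>D\<^esub> = enc (\<lambda>j. \<one>)"
  "\<zero>\<^bsub>D\<^esub> = enc (\<lambda>j. \<zero>)"
  by (simp_all add: seq_cstar_def Let_def)

lemma bounded_seqsI:
  "(\<And>j. s j \<in> carrier A) \<Longrightarrow> (\<And>j. nrm A (s j) \<le> C) \<Longrightarrow> s \<in> bounded_seqs A"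
  by (auto simp: bounded_seqs_def intro!: bdd_aboveI2)

lemma bounded_seqsD: "s \<in> bounded_seqs A \<Longrightarrow> s j \<in> carrier A"
  by (auto simp: bounded_seqs_def)

lemma nrm_le_SUP: "s \<in> bounded_seqs A \<Longrightarrow> nrm A (s j) \<le> (SUP j. nrm A (s j))"
  by (auto simp: bounded_seqs_def intro!: cSUP_upper)

lemma SUP_nrm_nonneg: "s \<in> bounded_seqs A \<Longrightarrow> 0 \<le> (SUP j. nrm A (s j))"
  using nrm_le_SUP[of s 0] nrm_nonneg[OF bounded_seqsD[of s 0]] by simp

lemma bounded_seqs_const [simp]: "a \<in> carrier A \<Longrightarrow> (\<lambda>j. a) \<in> bounded_seqs A"
  by (rule bounded_seqsI[of _ "nrm A a"]) auto

lemma bounded_seqs_add [simp]: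
  assumes "s \<in> bounded_seqs A" "t \<in> bounded_seqs A"
  shows "(\<lambda>j. s j \<oplus> t j) \<in> bounded_seqs A"
proof (rule bounded_seqsI)
  fix j
  show "s j \<oplus> t j \<in> carrier A" using assms bounded_seqsD by simp
  show "nrm A (s j \<oplus> t j) \<le> (SUP j. nrm A (s j)) + (SUP j. nrm A (t j))"
    using nrm_triangle[OF bounded_seqsD[OF assms(1)] bounded_seqsD[OF assms(2)], of j j]
      nrm_le_SUP[OF assms(1), of j] nrm_le_SUP[OF assms(2), of j] by linarith
qed

lemma bounded_seqs_mult [simp]:
  assumes "s \<in> bounded_seqs A" "t \<in> bounded_seqs A"
  shows "(\<lambda>j. s j \<otimes> t j) \<in> bounded_seqs A"
proof (rule bounded_seqsI)
  fix j
  show "s j \<otimes> t j \<in> carrier A" using assms bounded_seqsD by simp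
  have "nrm A (s j \<otimes> t j) \<le> nrm A (s j) * nrm A (t j)"
    by (rule nrm_mult[OF bounded_seqsD[OF assms(1)] bounded_seqsD[OF assms(2)]])
  also have "\<dots> \<le> (SUP j. nrm A (s j)) * (SUP j. nrm A (t j))"
    by (intro mult_mono nrm_le_SUP assms nrm_nonneg bounded_seqsD SUP_nrm_nonneg)
  finally show "nrm A (s j \<otimes> t j) \<le> (SUP j. nrm A (s j)) * (SUP j. nrm A (t j))" .
qed

lemma bounded_seqs_smult [simp]:
  assumes "s \<in> bounded_seqs A"
  shows "(\<lambda>j. z \<odot> s j) \<in> bounded_seqs A"
proof (rule bounded_seqsI)
  fix j
  show "z \<odot> s j \<in> carrier A" using assms bounded_seqsD smult_closed by simp
  show "nrm A (z \<odot> s j) \<le> cmod z * (SUP j. nrm A (s j))"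
    unfolding nrm_smult[OF bounded_seqsD[OF assms]]
    by (intro mult_left_mono nrm_le_SUP assms) auto
qed

lemma bounded_seqs_adj [simp]:
  assumes "s \<in> bounded_seqs A"
  shows "(\<lambda>j. adj A (s j)) \<in> bounded_seqs A"
  using nrm_le_SUP[OF assms] nrm_adj[OF bounded_seqsD[OF assms]] bounded_seqsD[OF assms] adj_closed
  by (intro bounded_seqsI[of _ "SUP j. nrm A (s j)"]) auto

lemma bounded_seqs_a_inv: "s \<in> bounded_seqs A \<Longrightarrow> (\<lambda>j. \<ominus> s j) \<in> bounded_seqs A"
  using bounded_seqs_smult[of s "-1"] bounded_seqsD[of s] by (simp add: a_inv_eq_smult)

lemma enc_cases: "p \<in> carrier D \<Longrightarrow> (\<And>s. s \<in> bounded_seqs A \<Longrightarrow> p = enc s \<Longrightarrow> P) \<Longrightarrow> P"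
  by (auto simp: carrier_D)

lemma ring_D: "ring D"
proof (intro ringI abelian_groupI monoidI)
  fix p assume "p \<in> carrier D"
  then obtain s where s: "s \<in> bounded_seqs A" "p = enc s" by (rule enc_cases)
  note [simp] = s bounded_seqsD[OF s(1)]
  show "\<zero>\<^bsub>D\<^esub> \<oplus>\<^bsub>D\<^esub> p = p" "\<one>\<^bsub>D\<^esub> \<otimes>\<^bsub>D\<^esub> p = p" "p \<otimes>\<^bsub>D\<^esub> \<one>\<^bsub>D\<^esub> = p" by simp_all
  show "\<exists>q\<in>carrier D. q \<oplus>\<^bsub>D\<^esub> p = \<zero>\<^bsub>D\<^esub>"
    by (rule bexI[of _ "enc (\<lambda>j. \<ominus> s j)"]) (simp_all add: bounded_seqs_a_inv l_neg)
  fix q assume "q \<in> carrier D"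
  then obtain t where t: "t \<in> bounded_seqs A" "q = enc t" by (rule enc_cases)
  note [simp] = t bounded_seqsD[OF t(1)]
  show "p \<oplus>\<^bsub>D\<^esub> q \<in> carrier D" "p \<otimes>\<^bsub>D\<^esub> q \<in> carrier D" "p \<oplus>\<^bsub>D\<^esub> q = q \<oplus>\<^bsub>D\<^esub> p" by (simp_all add: a_comm)
  fix r assume "r \<in> carrier D"
  then obtain u where u: "u \<in> bounded_seqs A" "r = enc u" by (rule enc_cases)
  note [simp] = u bounded_seqsD[OF u(1)]
  show "p \<oplus>\<^bsub>D\<^esub> q \<oplus>\<^bsub>D\<^esub> r = p \<oplus>\<^bsub>D\<^esub> (q \<oplus>\<^bsub>D\<^esub> r)" "p \<otimes>\<^bsub>D\<^esub> q \<otimes>\<^bsub>D\<^esub> r = p \<otimes>\<^bsub>D\<^esub> (q \<otimes>\<^bsub>D\<^esub> r)"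
    "(p \<oplus>\<^bsub>D\<^esub> q) \<otimes>\<^bsub>D\<^esub> r = p \<otimes>\<^bsub>D\<^esub> r \<oplus>\<^bsub>D\<^esub> q \<otimes>\<^bsub>D\<^esub> r"
    "r \<otimes>\<^bsub>D\<^esub> (p \<oplus>\<^bsub>D\<^esub> q) = r \<otimes>\<^bsub>D\<^esub> p \<oplus>\<^bsub>D\<^esub> r \<otimes>\<^bsub>D\<^esub> q"
    by (simp_all add: a_assoc m_assoc l_distr r_distr)
qed auto

lemma D_minus [simp]:
  assumes s: "s \<in> bounded_seqs A" and t: "t \<in> bounded_seqs A"
  shows "enc s \<ominus>\<^bsub>D\<^esub> enc t = enc (\<lambda>j. s j \<ominus> t j)"
proof -
  interpret D: ring D by (rule ring_D)
  note [simp] = bounded_seqsD[OF s] bounded_seqsD[OF t]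
  have "enc (\<lambda>j. \<ominus> t j) \<oplus>\<^bsub>D\<^esub> enc t = \<zero>\<^bsub>D\<^esub>"
    using t by (simp add: bounded_seqs_a_inv l_neg del: D_simps(3-6))
  then have "\<ominus>\<^bsub>D\<^esub> enc t = enc (\<lambda>j. \<ominus> t j)"
    using t by (intro D.minus_equality) (auto simp: bounded_seqs_a_inv)
  then show ?thesis
    using s t by (simp add: D.minus_eq minus_eq bounded_seqs_a_inv)
qed

lemma bounded_seqs_minus: "s \<in> bounded_seqs A \<Longrightarrow> t \<in> bounded_seqs A \<Longrightarrow> (\<lambda>j. s j \<ominus> t j) \<in> bounded_seqs A"
  by (simp add: minus_eq bounded_seqs_a_inv)

lemma nrm_D_eq_0:
  assumes s: "s \<in> bounded_seqs A"
  shows "nrm D (enc s) = 0 \<longleftrightarrow> enc s = \<zero>\<^bsub>D\<^esub>"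
proof
  assume "nrm D (enc s) = 0"
  then have "nrm A (s j) = 0" for j
    using nrm_le_SUP[OF s, of j] nrm_nonneg[OF bounded_seqsD[OF s]] s by (simp add: antisym)
  then have "s = (\<lambda>j. \<zero>)" using nrm_eq_zero[OF bounded_seqsD[OF s]] by auto
  then show "enc s = \<zero>\<^bsub>D\<^esub>" by simp
next
  assume "enc s = \<zero>\<^bsub>D\<^esub>"
  then show "nrm D (enc s) = 0" by (simp add: nrm_eq_zero)
qed

lemma nrm_D_add_le:
  assumes s: "s \<in> bounded_seqs A" and t: "t \<in> bounded_seqs A"
  shows "nrm D (enc s \<oplus>\<^bsub>D\<^esub> enc t) \<le> nrm D (enc s) + nrm D (enc t)"
proof -
  have "(SUP j. nrm A (s j \<oplus> t j)) \<le> (SUP j. nrm A (s j)) + (SUP j. nrm A (t j))"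
  proof (rule cSUP_least)
    fix j
    show "nrm A (s j \<oplus> t j) \<le> (SUP j. nrm A (s j)) + (SUP j. nrm A (t j))"
      using nrm_triangle[OF bounded_seqsD[OF s] bounded_seqsD[OF t], of j j]
        nrm_le_SUP[OF s, of j] nrm_le_SUP[OF t, of j] by linarith
  qed simp
  then show ?thesis using s t by simp
qed

lemma nrm_D_smult:
  assumes s: "s \<in> bounded_seqs A"
  shows "nrm D (z \<odot>\<^bsub>D\<^esub> enc s) = cmod z * nrm D (enc s)"
proof -
  have "(SUP j. cmod z * nrm A (s j)) = cmod z * (SUP j. nrm A (s j))"
    using s by (intro continuous_at_Sup_mono[symmetric, where f="\<lambda>x. cmod z * x" and S="range (\<lambda>j. nrm A (s j))", unfolded image_image])
       (auto simp: bounded_seqs_def mono_def mult_left_mono intro!: continuous_intros)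
  then show ?thesis using s by (simp add: nrm_smult bounded_seqsD)
qed

lemma nrm_D_mult_le:
  assumes s: "s \<in> bounded_seqs A" and t: "t \<in> bounded_seqs A"
  shows "nrm D (enc s \<otimes>\<^bsub>D\<^esub> enc t) \<le> nrm D (enc s) * nrm D (enc t)"
proof -
  have "(SUP j. nrm A (s j \<otimes> t j)) \<le> (SUP j. nrm A (s j)) * (SUP j. nrm A (t j))"
  proof (rule cSUP_least)
    fix j
    have "nrm A (s j \<otimes> t j) \<le> nrm A (s j) * nrm A (t j)"
      by (rule nrm_mult[OF bounded_seqsD[OF s] bounded_seqsD[OF t]])
    also have "\<dots> \<le> (SUP j. nrm A (s j)) * (SUP j. nrm A (t j))"
      by (intro mult_mono nrm_le_SUP s t nrm_nonneg bounded_seqsD SUP_nrm_nonneg)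
    finally show "nrm A (s j \<otimes> t j) \<le> (SUP j. nrm A (s j)) * (SUP j. nrm A (t j))" .
  qed simp
  then show ?thesis using s t by simp
qed

lemma nrm_D_cstar_identity:
  assumes s: "s \<in> bounded_seqs A"
  shows "nrm D (adj D (enc s) \<otimes>\<^bsub>D\<^esub> enc s) = (nrm D (enc s))\<^sup>2"
proof -
  have "(SUP j. nrm A (adj A (s j) \<otimes> s j)) = (SUP j. (nrm A (s j))\<^sup>2)"
    by (simp add: cstar_identity bounded_seqsD[OF s])
  also have "\<dots> = (SUP j. nrm A (s j))\<^sup>2"
  proof (rule antisym)
    show "(SUP j. (nrm A (s j))\<^sup>2) \<le> (SUP j. nrm A (s j))\<^sup>2"
      by (intro cSUP_least power_mono nrm_le_SUP s nrm_nonneg bounded_seqsD) auto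
    have bdd: "bdd_above (range (\<lambda>j. (nrm A (s j))\<^sup>2))"
      by (intro bdd_aboveI2[of _ _ "(SUP j. nrm A (s j))\<^sup>2"] power_mono nrm_le_SUP s nrm_nonneg bounded_seqsD)
    have pos: "0 \<le> (SUP j. (nrm A (s j))\<^sup>2)"
      by (rule order_trans[OF zero_le_power2 cSUP_upper[OF UNIV_I bdd, of 0]])
    have "(SUP j. nrm A (s j)) \<le> sqrt (SUP j. (nrm A (s j))\<^sup>2)"
      by (intro cSUP_least real_le_rsqrt cSUP_upper bdd) auto
    then have "(SUP j. nrm A (s j))\<^sup>2 \<le> (sqrt (SUP j. (nrm A (s j))\<^sup>2))\<^sup>2"
      by (rule power_mono) (rule SUP_nrm_nonneg[OF s])
    then show "(SUP j. nrm A (s j))\<^sup>2 \<le> (SUP j. (nrm A (s j))\<^sup>2)"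
      using pos by simp
  qed
  finally show ?thesis using s by simp
qed

lemma Metric_space_D: "Metric_space (carrier D) (nrm_dist D)"
proof (rule Metric_space_nrm_dist[OF ring_D])
  interpret D: ring D by (rule ring_D)
  fix p assume "p \<in> carrier D"
  then obtain s where s: "s \<in> bounded_seqs A" "p = enc s" by (rule enc_cases)
  show "0 \<le> nrm D p" using s by (simp add: SUP_nrm_nonneg)
  show "(nrm D p = 0) = (p = \<zero>\<^bsub>D\<^esub>)" unfolding s(2) by (rule nrm_D_eq_0[OF s(1)])
  have "\<ominus>\<^bsub>D\<^esub> p = \<zero>\<^bsub>D\<^esub> \<ominus>\<^bsub>D\<^esub> p" using s by (simp only: D.minus_eq D.l_zero D.a_inv_closed enc_closed)
  also have "\<dots> = enc (\<lambda>j. \<zero> \<ominus> s j)" using s by simp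
  also have "\<dots> = enc (\<lambda>j. \<ominus> s j)" using bounded_seqsD[OF s(1)] by (simp add: minus_eq)
  finally show "nrm D (\<ominus>\<^bsub>D\<^esub> p) = nrm D p"
    using s by (simp add: bounded_seqs_a_inv nrm_minus_cancel bounded_seqsD)
  fix q assume "q \<in> carrier D"
  then obtain t where t: "t \<in> bounded_seqs A" "q = enc t" by (rule enc_cases)
  show "nrm D (p \<oplus>\<^bsub>D\<^esub> q) \<le> nrm D p + nrm D q"
    unfolding s(2) t(2) by (rule nrm_D_add_le[OF s(1) t(1)])
qed

lemma nrm_dist_D:
  "s \<in> bounded_seqs A \<Longrightarrow> t \<in> bounded_seqs A \<Longrightarrow> nrm_dist D (enc s) (enc t) = (SUP j. nrm_dist A (s j) (t j))"
  by (simp add: nrm_dist_def bounded_seqs_minus bounded_seqsD)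

text \<open>Terms of a Cauchy sequence converge at each index, and uniformly so over the indices: the Cauchy
condition in the supremum norm passes to the limit in one of its two arguments.\<close>

lemma complete_D: "Metric_space.mcomplete (carrier D) (nrm_dist D)"
proof -
  interpret M: Metric_space "carrier D" "nrm_dist D" by (rule Metric_space_D)
  show ?thesis
    unfolding M.mcomplete_def
  proof (intro allI impI)
    fix \<sigma> assume cau: "M.MCauchy \<sigma>"
    define s where "s n = dec (\<sigma> n)" for n
    have s: "s n \<in> bounded_seqs A" and \<sigma>: "\<sigma> n = enc (s n)" for n
    proof -
      have "\<sigma> n \<in> carrier D" using cau unfolding M.MCauchy_def by blast
      then show "s n \<in> bounded_seqs A" "\<sigma> n = enc (s n)"
        unfolding s_def carrier_D by (auto simp: inv_into_into f_inv_into_f)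
    qed
    note car = bounded_seqsD[OF s]
    have le: "nrm_dist A (s m j) (s n j) \<le> nrm_dist D (\<sigma> m) (\<sigma> n)" for m n j
      using nrm_le_SUP[OF bounded_seqs_minus[OF s[of m] s[of n]], of j]
      unfolding \<sigma> nrm_dist_D[OF s s] by (simp add: nrm_dist_def car)
    have "\<exists>l. limitin nrm.mtopology (\<lambda>n. s n j) l sequentially" for j
    proof -
      have "nrm.MCauchy (\<lambda>n. s n j)"
        unfolding nrm.MCauchy_def using cau le car unfolding M.MCauchy_def 
        by (meson image_subsetI order_le_less_trans)
      then show ?thesis using complete unfolding nrm.mcomplete_def by blast
    qed
    then obtain l where l: "\<And>j. limitin nrm.mtopology (\<lambda>n. s n j) (l j) sequentially" by metis
    have lcar: "l j \<in> carrier A" for j using l[of j] unfolding nrm.limitin_metric by blast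
    have unif: "\<exists>N. \<forall>n\<ge>N. \<forall>j. nrm_dist A (s n j) (l j) \<le> e" if "e > 0" for e
    proof -
      obtain N where N: "\<And>m n. N \<le> m \<Longrightarrow> N \<le> n \<Longrightarrow> nrm_dist D (\<sigma> m) (\<sigma> n) < e"
        using cau \<open>e > 0\<close> unfolding M.MCauchy_def by blast
      \<comment> \<open>The index \<open>m\<close> below may depend on \<open>j\<close>, but \<open>N\<close> does not.\<close>
      have "nrm_dist A (s n j) (l j) \<le> e" if n: "N \<le> n" for n j
      proof (rule field_le_epsilon)
        fix \<eta> :: real assume "\<eta> > 0"
        then have "eventually (\<lambda>m. nrm_dist A (s m j) (l j) < \<eta>) sequentially"
          using l[of j] unfolding nrm.limitin_metric by (auto elim: eventually_mono)
        then obtain m where m: "N \<le> m" "nrm_dist A (s m j) (l j) < \<eta>"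
          unfolding eventually_sequentially by (meson nle_le)
        have "nrm_dist A (s n j) (l j) \<le> nrm_dist A (s n j) (s m j) + nrm_dist A (s m j) (l j)"
          by (intro nrm.triangle car lcar)
        then show "nrm_dist A (s n j) (l j) \<le> e + \<eta>"
          using le[of n j m] N[OF n m(1)] m(2) by linarith
      qed
      then show ?thesis by blast
    qed
    have lb: "l \<in> bounded_seqs A"
    proof -
      obtain N where N: "\<And>j. nrm_dist A (s N j) (l j) \<le> 1" using unif[of 1] by auto
      show ?thesis
      proof (rule bounded_seqsI[OF lcar])
        fix j
        have "l j = (l j \<ominus> s N j) \<oplus> s N j"
          using lcar[of j] car[of N j] by (simp add: minus_eq a_assoc l_neg)
        then have "nrm A (l j) \<le> nrm A (l j \<ominus> s N j) + nrm A (s N j)"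
          using nrm_triangle[of "l j \<ominus> s N j" "s N j"] lcar[of j] car[of N j] by simp
        moreover have "nrm A (l j \<ominus> s N j) = nrm_dist A (s N j) (l j)"
          unfolding nrm.commute[of "s N j"] using lcar[of j] car[of N j] by (simp add: nrm_dist_def)
        ultimately show "nrm A (l j) \<le> 1 + (SUP j. nrm A (s N j))"
          using N[of j] nrm_le_SUP[OF s[of N], of j] by linarith
      qed
    qed
    have "\<exists>N. \<forall>n\<ge>N. \<sigma> n \<in> carrier D \<and> nrm_dist D (\<sigma> n) (enc l) < e" if "e > 0" for e
    proof -
      obtain N where N: "\<And>n j. n \<ge> N \<Longrightarrow> nrm_dist A (s n j) (l j) \<le> e / 2"
        using unif[of "e / 2"] \<open>e > 0\<close> by auto
      have "\<sigma> n \<in> carrier D \<and> nrm_dist D (\<sigma> n) (enc l) < e" if "n \<ge> N" for n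
      proof -
        have "nrm_dist D (\<sigma> n) (enc l) \<le> e / 2"
          unfolding \<sigma> nrm_dist_D[OF s lb] by (intro cSUP_least N that) auto
        then show ?thesis using \<open>e > 0\<close> by (simp add: \<sigma> s)
      qed
      then show ?thesis by blast
    qed
    then have "limitin M.mtopology \<sigma> (enc l) sequentially"
      unfolding M.limit_metric_sequentially using lb by simp
    then show "\<exists>x. limitin M.mtopology \<sigma> x sequentially" by blast
  qed
qed

lemma unital_cstar_algebra_D: "unital_cstar_algebra D"
proof (intro unital_cstar_algebra.intro unital_cstar_algebra_axioms.intro ring_D complete_D)
  show "\<one>\<^bsub>D\<^esub> \<noteq> \<zero>\<^bsub>D\<^esub>"
  proof
    assume "\<one>\<^bsub>D\<^esub> = \<zero>\<^bsub>D\<^esub>"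
    then have "dec (enc (\<lambda>j. \<one>)) = dec (enc (\<lambda>j. \<zero>))" by simp
    then have "(\<lambda>j::nat. \<one>) = (\<lambda>j. \<zero>)" by (subst (asm) (1 2) dec_enc) auto
    then show False using one_neq_zero by meson
  qed
next
  fix p z w assume "p \<in> carrier D"
  then obtain s where s: "s \<in> bounded_seqs A" "p = enc s" by (rule enc_cases)
  note [simp] = s bounded_seqsD[OF s(1)]
  show "z \<odot>\<^bsub>D\<^esub> p \<in> carrier D" "(z + w) \<odot>\<^bsub>D\<^esub> p = z \<odot>\<^bsub>D\<^esub> p \<oplus>\<^bsub>D\<^esub> w \<odot>\<^bsub>D\<^esub> p"
    "(z * w) \<odot>\<^bsub>D\<^esub> p = z \<odot>\<^bsub>D\<^esub> (w \<odot>\<^bsub>D\<^esub> p)" "1 \<odot>\<^bsub>D\<^esub> p = p" "adj D p \<in> carrier D" "adj D (adj D p) = p"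
    "adj D (z \<odot>\<^bsub>D\<^esub> p) = cnj z \<odot>\<^bsub>D\<^esub> adj D p"
    by (simp_all add: smult_add_left smult_smult smult_one adj_adj adj_smult)
  show "0 \<le> nrm D p" by (simp add: SUP_nrm_nonneg)
  show "(nrm D p = 0) = (p = \<zero>\<^bsub>D\<^esub>)" unfolding s(2) by (rule nrm_D_eq_0[OF s(1)])
  show "nrm D (z \<odot>\<^bsub>D\<^esub> p) = cmod z * nrm D p" unfolding s(2) by (rule nrm_D_smult[OF s(1)])
  show "nrm D (adj D p \<otimes>\<^bsub>D\<^esub> p) = (nrm D p)\<^sup>2" unfolding s(2) by (rule nrm_D_cstar_identity[OF s(1)])
  fix q assume "q \<in> carrier D"
  then obtain t where t: "t \<in> bounded_seqs A" "q = enc t" by (rule enc_cases)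
  note [simp] = t bounded_seqsD[OF t(1)]
  show "z \<odot>\<^bsub>D\<^esub> (p \<oplus>\<^bsub>D\<^esub> q) = z \<odot>\<^bsub>D\<^esub> p \<oplus>\<^bsub>D\<^esub> z \<odot>\<^bsub>D\<^esub> q"
    "(z \<odot>\<^bsub>D\<^esub> p) \<otimes>\<^bsub>D\<^esub> q = z \<odot>\<^bsub>D\<^esub> (p \<otimes>\<^bsub>D\<^esub> q)" "p \<otimes>\<^bsub>D\<^esub> (z \<odot>\<^bsub>D\<^esub> q) = z \<odot>\<^bsub>D\<^esub> (p \<otimes>\<^bsub>D\<^esub> q)"
    "adj D (p \<oplus>\<^bsub>D\<^esub> q) = adj D p \<oplus>\<^bsub>D\<^esub> adj D q" "adj D (p \<otimes>\<^bsub>D\<^esub> q) = adj D q \<otimes>\<^bsub>D\<^esub> adj D p"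
    by (simp_all add: smult_add_right smult_mult_left smult_mult_right adj_add adj_mult)
  show "nrm D (p \<oplus>\<^bsub>D\<^esub> q) \<le> nrm D p + nrm D q"
    unfolding s(2) t(2) by (rule nrm_D_add_le[OF s(1) t(1)])
  show "nrm D (p \<otimes>\<^bsub>D\<^esub> q) \<le> nrm D p * nrm D q"
    unfolding s(2) t(2) by (rule nrm_D_mult_le[OF s(1) t(1)])
qed

text \<open>Evaluation at an index is a unital *-homomorphism onto the coefficient algebra, so states can be pulled
back along it.  This provides all the states of the bridge algebra that are used.\<close>

lemma state_at_index:
  assumes \<phi>: "\<phi> \<in> states A"
  shows "restrict (\<lambda>p. \<phi> (dec p j)) (carrier D) \<in> states D" (is "?\<psi> \<in> _")
proof -
  interpret D: unital_cstar_algebra D by (rule unital_cstar_algebra_D)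
  have \<psi>: "?\<psi> (enc s) = \<phi> (s j)" if "s \<in> bounded_seqs A" for s
    using that by simp
  show ?thesis
    unfolding states_def
  proof (intro CollectI conjI ballI allI)
    show "?\<psi> \<in> extensional (carrier D)" by simp
    show "?\<psi> \<one>\<^bsub>D\<^esub> = 1" using \<phi> by (simp add: states_def)
    fix p assume "p \<in> carrier D"
    then obtain s where s: "s \<in> bounded_seqs A" "p = enc s" by (rule enc_cases)
    note [simp] = s bounded_seqsD[OF s(1)]
    show "?\<psi> (adj D p \<otimes>\<^bsub>D\<^esub> p) \<in> \<real>\<^sub>\<ge>\<^sub>0" using \<phi> by (simp add: states_def)
    show "?\<psi> (z \<odot>\<^bsub>D\<^esub> p) = z * ?\<psi> p" for z using \<phi> by (simp add: states_def)
    fix q assume "q \<in> carrier D"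
    then obtain t where t: "t \<in> bounded_seqs A" "q = enc t" by (rule enc_cases)
    note [simp] = t bounded_seqsD[OF t(1)]
    show "?\<psi> (p \<oplus>\<^bsub>D\<^esub> q) = ?\<psi> p + ?\<psi> q" using \<phi> by (simp add: states_def)
  qed
qed

lemma unital_star_mono_const: "unital_star_mono A D (\<lambda>a. enc (\<lambda>j. a))"
  unfolding unital_star_mono_def
proof (intro conjI ballI allI ring_hom_memI inj_onI)
  fix a b assume ab: "a \<in> carrier A" "b \<in> carrier A" "enc (\<lambda>j. a) = enc (\<lambda>j. b)"
  then have "dec (enc (\<lambda>j. a)) = dec (enc (\<lambda>j. b))" by simp
  then have "(\<lambda>j::nat. a) = (\<lambda>j. b)" by (subst (asm) (1 2) dec_enc) (use ab in auto)
  then show "a = b" by meson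
qed simp_all

end

lemma level_states_one: "unital_cstar_algebra D \<Longrightarrow> level_states D \<one>\<^bsub>D\<^esub> = states D"
proof -
  assume "unital_cstar_algebra D"
  then interpret unital_cstar_algebra D .
  show ?thesis by (auto simp: level_states_def)
qed

section \<open>A Lipschitz seminorm on matrices from a finite metric space\<close>

context unital_cstar_algebra
begin

lemma adj_minus: 
  assumes "a \<in> carrier A" "b \<in> carrier A"
  shows "adj A (a \<ominus> b) = adj A a \<ominus> adj A b"
  using assms adj_smult[of b "- 1"] by (simp add: minus_eq a_inv_eq_smult adj_add smult_closed adj_closed)

lemma self_adjoint_jordan:
  assumes "a \<in> self_adjoint A" "b \<in> self_adjoint A"
  shows "jordan_prod A a b \<in> self_adjoint A"
  using assms 
  by (simp add: self_adjoint_def jordan_prod_def smult_closed adj_smult adj_add adj_mult a_comm)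

lemma self_adjoint_lie:
  assumes "a \<in> self_adjoint A" "b \<in> self_adjoint A"
  shows "lie_prod A a b \<in> self_adjoint A"
proof -
  have ab: "a \<in> carrier A" "b \<in> carrier A" "adj A a = a" "adj A b = b"
    using assms by (auto simp: self_adjoint_def)
  have "adj A (lie_prod A a b) = cnj (1 / (2 * \<i>)) \<odot> (b \<otimes> a \<ominus> a \<otimes> b)"
    using ab by (simp add: lie_prod_def adj_smult adj_minus adj_mult)
  also have "b \<otimes> a \<ominus> a \<otimes> b = (- 1) \<odot> (a \<otimes> b \<ominus> b \<otimes> a)"
    using ab by (simp add: a_inv_eq_smult[symmetric] minus_eq minus_add a_comm)
  also have "cnj (1 / (2 * \<i>)) \<odot> \<dots> = lie_prod A a b"
    using ab by (simp add: smult_smult[symmetric] lie_prod_def)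
  finally show ?thesis
    using ab by (simp add: self_adjoint_def lie_prod_def smult_closed)
qed

end

definition diag_part :: "nat \<Rightarrow> complex mat \<Rightarrow> complex mat" where
  "diag_part k a = diagonal k (\<lambda>i. a $$ (i, i))"

definition offdiag_part :: "nat \<Rightarrow> complex mat \<Rightarrow> complex mat" where
  "offdiag_part k a = a - diag_part k a"

lemma diag_part_closed [simp]: "diag_part k a \<in> carrier_mat k k"
  by (simp add: diag_part_def)

lemma offdiag_part_closed [simp]: "a \<in> carrier_mat k k \<Longrightarrow> offdiag_part k a \<in> carrier_mat k k"
  by (simp add: offdiag_part_def minus_carrier_mat)

lemma diag_part_index [simp]:
  "i < k \<Longrightarrow> j < k \<Longrightarrow> diag_part k a $$ (i, j) = (if i = j then a $$ (i, i) else 0)"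
  by (simp add: diag_part_def)

lemma offdiag_part_index [simp]:
  "i < k \<Longrightarrow> j < k \<Longrightarrow> offdiag_part k a $$ (i, j) = (if i = j then 0 else a $$ (i, j))"
  by (simp add: offdiag_part_def diag_part_def)

lemma offdiag_part_dim [simp]: "dim_row (offdiag_part k a) = k" "dim_col (offdiag_part k a) = k"
  by (simp_all add: offdiag_part_def diag_part_def)

lemma diag_part_dim [simp]: "dim_row (diag_part k a) = k" "dim_col (diag_part k a) = k"
  by (simp_all add: diag_part_def)

lemma nrm_diag_part_le: "a \<in> carrier_mat k k \<Longrightarrow> nrm (matrix_cstar k) (diag_part k a) \<le> nrm (matrix_cstar k) a"
  unfolding diag_part_def by (intro nrm_diagonal_le nrm_matrix_nonneg entry_le_nrm_matrix)

lemma nrm_matrix_diff_le: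
  assumes a: "a \<in> carrier_mat k k" and b: "b \<in> carrier_mat k k"
  shows "nrm (matrix_cstar k) (a - b) \<le> nrm (matrix_cstar k) a + nrm (matrix_cstar k) b"
proof -
  have "a - b = a + (- 1) \<cdot>\<^sub>m b" using a b by (intro eq_matI) auto
  then show ?thesis
    using nrm_matrix_add_le[OF a, of "(- 1) \<cdot>\<^sub>m b"] b by (simp add: nrm_matrix_smult)
qed

lemma nrm_offdiag_part_le: 
  assumes a: "a \<in> carrier_mat k k" 
  shows "nrm (matrix_cstar k) (offdiag_part k a) \<le> 2 * nrm (matrix_cstar k) a"
  unfolding offdiag_part_def
  using nrm_matrix_diff_le[OF a diag_part_closed, of a] nrm_diag_part_le[OF a] by linarith

text \<open>The number \<open>e i j\<close> stands for the distance between the points \<open>i\<close> and \<open>j\<close> of a finite set, and \<open>r\<close> bounds the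
off-diagonal parts of unit ball elements.  It is tied to the separation of the points because
the entries of a product of two off-diagonal parts can only be compared with \<open>e\<close> through \<open>r\<close>.\<close>

locale matrix_net =
  fixes k :: nat and e :: "nat \<Rightarrow> nat \<Rightarrow> real" and r :: real
  assumes k: "1 \<le> k" and r: "0 < r"
    and sep: "\<And>i j. i < k \<Longrightarrow> j < k \<Longrightarrow> i \<noteq> j \<Longrightarrow> 2 * r \<le> e i j"
begin

abbreviation A :: "complex mat cstar" where "A \<equiv> matrix_cstar k"

text \<open>The index pairs on the diagonal contribute 0, which keeps the finite maximum meaningful for \<open>k = 1\<close>.\<close>

definition net_lip :: "complex mat \<Rightarrow> real" where
  "net_lip a = max (Max ((\<lambda>(i, j). if i = j then 0 else cmod (a $$ (i, i) - a $$ (j, j)) / e i j) ` ({..<k} \<times> {..<k})))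
             (nrm A (offdiag_part k a) / r)"

sublocale A: unital_cstar_algebra A by (rule unital_cstar_algebra_matrix[OF k])

lemma net_lip_le_iff:
  assumes a: "a \<in> carrier_mat k k"
  shows "net_lip a \<le> c \<longleftrightarrow> (\<forall>i<k. \<forall>j<k. i \<noteq> j \<longrightarrow> cmod (a $$ (i, i) - a $$ (j, j)) \<le> c * e i j) \<and>
      nrm A (offdiag_part k a) \<le> c * r"
proof -
  have e: "0 < e i j" if "i < k" "j < k" "i \<noteq> j" for i j using sep[OF that] r by linarith
  have "0 \<le> c" if "nrm A (offdiag_part k a) \<le> c * r"
    using that nrm_matrix_nonneg[OF offdiag_part_closed[OF a]] r by (metis order_trans zero_le_mult_iff not_le)
  moreover have "{..<k} \<times> {..<k} \<noteq> {}" using k by (auto simp: lessThan_empty_iff)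
  ultimately show ?thesis
    using e r unfolding net_lip_def by (subst max.bounded_iff, subst Max_le_iff) (auto simp: divide_le_eq)
qed

lemma net_lip_nonneg: "a \<in> carrier_mat k k \<Longrightarrow> 0 \<le> net_lip a"
  using r nrm_matrix_nonneg[of "offdiag_part k a" k] by (simp add: net_lip_def le_max_iff_disj)

lemma diag_diff_le_net_lip:
  "a \<in> carrier_mat k k \<Longrightarrow> i < k \<Longrightarrow> j < k \<Longrightarrow> i \<noteq> j \<Longrightarrow> cmod (a $$ (i, i) - a $$ (j, j)) \<le> net_lip a * e i j"
  using net_lip_le_iff[of a "net_lip a"] by blast

lemma offdiag_le_net_lip: "a \<in> carrier_mat k k \<Longrightarrow> nrm A (offdiag_part k a) \<le> net_lip a * r"
  using net_lip_le_iff[of a "net_lip a"] by blast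

lemma net_lip_add_le:
  assumes a: "a \<in> carrier_mat k k" and b: "b \<in> carrier_mat k k"
  shows "net_lip (a + b) \<le> net_lip a + net_lip b"
  unfolding net_lip_le_iff[OF add_carrier_mat[OF b]]
proof (intro conjI allI impI)
  fix i j assume ij: "i < k" "j < k" "i \<noteq> j"
  have "(a + b) $$ (i, i) - (a + b) $$ (j, j) = (a $$ (i, i) - a $$ (j, j)) + (b $$ (i, i) - b $$ (j, j))"
    using a b ij by simp
  then have "cmod ((a + b) $$ (i, i) - (a + b) $$ (j, j)) \<le> cmod (a $$ (i, i) - a $$ (j, j)) + cmod (b $$ (i, i) - b $$ (j, j))"
    by (simp only: norm_triangle_ineq)
  also have "\<dots> \<le> (net_lip a + net_lip b) * e i j"
    using diag_diff_le_net_lip[OF a ij] diag_diff_le_net_lip[OF b ij] by (simp add: distrib_right)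
  finally show "cmod ((a + b) $$ (i, i) - (a + b) $$ (j, j)) \<le> (net_lip a + net_lip b) * e i j" .
next
  have "offdiag_part k (a + b) = offdiag_part k a + offdiag_part k b"
    using a b by (intro eq_matI) auto
  then show "nrm A (offdiag_part k (a + b)) \<le> (net_lip a + net_lip b) * r"
    using nrm_matrix_add_le[OF offdiag_part_closed[OF a] offdiag_part_closed[OF b]]
      offdiag_le_net_lip[OF a] offdiag_le_net_lip[OF b] by (simp add: distrib_right)
qed

lemma net_lip_smult_le:
  assumes a: "a \<in> carrier_mat k k"
  shows "net_lip (z \<cdot>\<^sub>m a) \<le> cmod z * net_lip a"
  unfolding net_lip_le_iff[OF smult_carrier_mat[OF a]]
proof (intro conjI allI impI)
  fix i j assume ij: "i < k" "j < k" "i \<noteq> j"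
  have "(z \<cdot>\<^sub>m a) $$ (i, i) - (z \<cdot>\<^sub>m a) $$ (j, j) = z * (a $$ (i, i) - a $$ (j, j))"
    using a ij by (simp add: algebra_simps)
  then show "cmod ((z \<cdot>\<^sub>m a) $$ (i, i) - (z \<cdot>\<^sub>m a) $$ (j, j)) \<le> cmod z * net_lip a * e i j"
    using diag_diff_le_net_lip[OF a ij] by (simp add: norm_mult mult.assoc mult_left_mono)
next
  have "offdiag_part k (z \<cdot>\<^sub>m a) = z \<cdot>\<^sub>m offdiag_part k a"
    using a by (intro eq_matI) auto
  then show "nrm A (offdiag_part k (z \<cdot>\<^sub>m a)) \<le> cmod z * net_lip a * r"
    using offdiag_le_net_lip[OF a] by (simp add: nrm_matrix_smult a mult.assoc mult_left_mono)
qed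

lemma net_lip_smult:
  assumes a: "a \<in> carrier_mat k k"
  shows "net_lip (z \<cdot>\<^sub>m a) = cmod z * net_lip a"
proof (cases "z = 0")
  case True
  then show ?thesis using net_lip_smult_le[OF a, of z] net_lip_nonneg[of "z \<cdot>\<^sub>m a"] a by simp
next
  case False
  have "a = inverse z \<cdot>\<^sub>m (z \<cdot>\<^sub>m a)" using False a by (intro eq_matI) auto
  then have "net_lip a \<le> inverse (cmod z) * net_lip (z \<cdot>\<^sub>m a)"
    using net_lip_smult_le[of "z \<cdot>\<^sub>m a" "inverse z"] a by (simp add: norm_inverse)
  then show ?thesis using net_lip_smult_le[OF a, of z] False by (simp add: field_simps)
qed

text \<open>The diagonal and off-diagonal parts of \<open>a\<close> have norm at most \<open>\<parallel>a\<parallel>\<close> and \<open>2 \<parallel>a\<parallel>\<close>, and distinct points are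
at distance at least \<open>2 r\<close>.\<close>

lemma net_lip_le_nrm:
  assumes a: "a \<in> carrier_mat k k"
  shows "net_lip a \<le> 2 / r * nrm A a"
  unfolding net_lip_le_iff[OF a]
proof (intro conjI allI impI)
  fix i j assume ij: "i < k" "j < k" "i \<noteq> j"
  have "cmod (a $$ (i, i) - a $$ (j, j)) \<le> cmod (a $$ (i, i)) + cmod (a $$ (j, j))"
    by (rule norm_triangle_ineq4)
  also have "\<dots> \<le> 2 * nrm A a"
    using entry_le_nrm_matrix[OF a ij(1) ij(1)] entry_le_nrm_matrix[OF a ij(2) ij(2)] by linarith
  also have "\<dots> = nrm A a / r * (2 * r)" using r by simp
  also have "\<dots> \<le> nrm A a / r * e i j"
    by (intro mult_left_mono sep ij) (use r nrm_matrix_nonneg[OF a] in simp)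
  also have "\<dots> \<le> 2 / r * nrm A a * e i j"
  proof -
    have "0 \<le> e i j" using sep[OF ij] r by linarith
    then show ?thesis
    using r nrm_matrix_nonneg[OF a] by (intro mult_right_mono) (auto simp: divide_right_mono)
  qed
  finally show "cmod (a $$ (i, i) - a $$ (j, j)) \<le> 2 / r * nrm A a * e i j" .
next
  show "nrm A (offdiag_part k a) \<le> 2 / r * nrm A a * r"
    using nrm_offdiag_part_le[OF a] r by simp
qed

text \<open>Mixed products of a diagonal and an off-diagonal part have zero diagonal.\<close>

lemma mult_diag_index:
  assumes a: "a \<in> carrier_mat k k" and b: "b \<in> carrier_mat k k" and i: "i < k"
  shows "(a * b) $$ (i, i) = a $$ (i, i) * b $$ (i, i) + (offdiag_part k a * offdiag_part k b) $$ (i, i)"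
proof -
  have "(a * b) $$ (i, i) = (\<Sum>m\<in>{0..<k}. a $$ (i, m) * b $$ (m, i))"
    using a b i by (simp add: scalar_prod_def)
  also have "\<dots> = a $$ (i, i) * b $$ (i, i) + (\<Sum>m\<in>{0..<k} - {i}. a $$ (i, m) * b $$ (m, i))"
    using i by (intro sum.remove) auto
  also have "(\<Sum>m\<in>{0..<k} - {i}. a $$ (i, m) * b $$ (m, i))
      = (\<Sum>m\<in>{0..<k}. offdiag_part k a $$ (i, m) * offdiag_part k b $$ (m, i))"
    using i by (intro sum.mono_neutral_cong_left) auto
  also have "\<dots> = (offdiag_part k a * offdiag_part k b) $$ (i, i)"
    using a b i by (simp add: scalar_prod_def)
  finally show ?thesis .
qed

text \<open>Split \<open>b\<close> into its two parts: multiplication by a diagonal matrix commutes with taking off-diagonal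
parts.  Only the first summand suffers from the factor 2 in \<open>nrm_offdiag_part_le\<close>, which is why \<open>a\<close> is
left unsplit there; splitting it too would lead to the constant 3.\<close>

lemma offdiag_mult:
  assumes a: "a \<in> carrier_mat k k" and b: "b \<in> carrier_mat k k"
  shows "offdiag_part k (a * b) = offdiag_part k (a * offdiag_part k b) + offdiag_part k a * diag_part k b"
proof -
  have 1: "(a * b) $$ (i, j) = (a * offdiag_part k b) $$ (i, j) + a $$ (i, j) * b $$ (j, j)" if "i < k" "j < k" for i j
  proof -
    have "(a * b) $$ (i, j) = (\<Sum>m\<in>{0..<k}. a $$ (i, m) * b $$ (m, j))"
      using a b that by (simp add: scalar_prod_def)
    also have "\<dots> = (\<Sum>m\<in>{0..<k}. a $$ (i, m) * offdiag_part k b $$ (m, j) + (if m = j then a $$ (i, m) * b $$ (m, j) else 0))"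
      using that by (intro sum.cong) auto
    also have "\<dots> = (a * offdiag_part k b) $$ (i, j) + a $$ (i, j) * b $$ (j, j)"
      using a b that by (simp add: sum.distrib scalar_prod_def)
    finally show ?thesis .
  qed
  have 2: "(offdiag_part k a * diag_part k b) $$ (i, j) = offdiag_part k a $$ (i, j) * b $$ (j, j)" if "i < k" "j < k" for i j
  proof -
    have "(offdiag_part k a * diag_part k b) $$ (i, j) = (\<Sum>m\<in>{0..<k}. offdiag_part k a $$ (i, m) * diag_part k b $$ (m, j))"
      using that by (simp add: scalar_prod_def del: offdiag_part_index diag_part_index)
    also have "\<dots> = (\<Sum>m\<in>{0..<k}. if m = j then offdiag_part k a $$ (i, j) * b $$ (j, j) else 0)"
      using that by (intro sum.cong) auto
    finally show ?thesis using that by simp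
  qed
  show ?thesis
    by (intro eq_matI) (use a b in \<open>auto simp: 1 2 simp del: index_mult_mat(1)\<close>)
qed

text \<open>With \<open>u\<close> and \<open>v\<close> the off-diagonal parts of \<open>a\<close> and \<open>b\<close>, the diagonal of \<open>a b\<close> is the product of the
diagonals, which satisfies the Leibniz inequality, plus the diagonal of \<open>u v\<close>.  The
latter is bounded by \<open>\<parallel>u\<parallel> \<parallel>v\<parallel>\<close>, where either factor may be estimated by the
seminorm times \<open>r\<close> and the other by twice the norm; the factor \<open>r\<close> is compensated by the separation
of the points.\<close>

lemma net_lip_mult_le:
  assumes a: "a \<in> carrier_mat k k" and b: "b \<in> carrier_mat k k"
  shows "net_lip (a * b) \<le> 2 * (nrm A a * net_lip b + nrm A b * net_lip a)"
  unfolding net_lip_le_iff[OF mult_carrier_mat[OF a b]]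
proof (intro conjI allI impI)
  let ?S = "nrm A a * net_lip b + nrm A b * net_lip a"
  define u where "u = offdiag_part k a"
  define v where "v = offdiag_part k b"
  have u: "u \<in> carrier_mat k k" and v: "v \<in> carrier_mat k k" by (simp_all add: u_def v_def a b)
  have na: "0 \<le> nrm A a" and nb: "0 \<le> nrm A b" and nu: "0 \<le> nrm A u" and nv: "0 \<le> nrm A v"
    by (simp_all add: nrm_matrix_nonneg a b u v)
  have ul: "nrm A u \<le> net_lip a * r" and vl: "nrm A v \<le> net_lip b * r"
    unfolding u_def v_def by (simp_all add: offdiag_le_net_lip a b)
  have u2: "nrm A u \<le> 2 * nrm A a" and v2: "nrm A v \<le> 2 * nrm A b"
    unfolding u_def v_def by (simp_all add: nrm_offdiag_part_le a b)
  have S: "0 \<le> ?S" using na nb net_lip_nonneg[OF a] net_lip_nonneg[OF b] by simp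
  \<comment> \<open>The two estimates of the product are added, one for each summand of \<open>?S\<close>.\<close>
  have "nrm A u * nrm A v \<le> 2 * nrm A a * (net_lip b * r)"
    using u2 vl nu nv na by (intro mult_mono) auto
  moreover have "nrm A u * nrm A v \<le> net_lip a * r * (2 * nrm A b)"
    using v2 ul nu nv nb net_lip_nonneg[OF a] r by (intro mult_mono) auto
  ultimately have uv: "2 * (nrm A u * nrm A v) \<le> ?S * (2 * r)"
    by (simp add: algebra_simps)
  fix i j assume ij: "i < k" "j < k" "i \<noteq> j"
  have uvi: "cmod ((u * v) $$ (m, m)) \<le> nrm A u * nrm A v" if "m < k" for m
    using entry_le_nrm_matrix[OF mult_carrier_mat[OF u v] that that] nrm_matrix_mult_le[OF u v] by linarith
  have "cmod (a $$ (i, i) * b $$ (i, i) - a $$ (j, j) * b $$ (j, j))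
      = cmod (a $$ (i, i) * (b $$ (i, i) - b $$ (j, j)) + (a $$ (i, i) - a $$ (j, j)) * b $$ (j, j))"
    by (simp add: algebra_simps)
  also have "\<dots> \<le> cmod (a $$ (i, i)) * cmod (b $$ (i, i) - b $$ (j, j)) + cmod (a $$ (i, i) - a $$ (j, j)) * cmod (b $$ (j, j))"
    unfolding norm_mult[symmetric] by (rule norm_triangle_ineq)
  also have "\<dots> \<le> nrm A a * (net_lip b * e i j) + net_lip a * e i j * nrm A b"
    by (intro add_mono mult_mono entry_le_nrm_matrix diag_diff_le_net_lip a b ij na nb) 
       (use order_trans[OF norm_ge_zero diag_diff_le_net_lip[OF a ij]] in auto)
  finally have ab: "cmod (a $$ (i, i) * b $$ (i, i) - a $$ (j, j) * b $$ (j, j)) \<le> ?S * e i j"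
    by (simp add: algebra_simps)
  have "(a * b) $$ (i, i) - (a * b) $$ (j, j)
    = (a $$ (i, i) * b $$ (i, i) - a $$ (j, j) * b $$ (j, j)) + ((u * v) $$ (i, i) - (u * v) $$ (j, j))"
    unfolding mult_diag_index[OF a b ij(1)] mult_diag_index[OF a b ij(2)] u_def v_def by simp
  then have "cmod ((a * b) $$ (i, i) - (a * b) $$ (j, j))
    \<le> cmod (a $$ (i, i) * b $$ (i, i) - a $$ (j, j) * b $$ (j, j)) + cmod ((u * v) $$ (i, i) - (u * v) $$ (j, j))"
    by (simp only: norm_triangle_ineq)
  also have "\<dots> \<le> ?S * e i j + 2 * (nrm A u * nrm A v)"
    using ab norm_triangle_ineq4[of "(u * v) $$ (i, i)" "(u * v) $$ (j, j)"] uvi[OF ij(1)] uvi[OF ij(2)] by linarith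
  also have "\<dots> \<le> ?S * e i j + ?S * e i j"
    using uv mult_left_mono[OF sep[OF ij] S] by linarith
  finally show "cmod ((a * b) $$ (i, i) - (a * b) $$ (j, j)) \<le> 2 * ?S * e i j" by (simp add: algebra_simps)
next
  have av: "a * offdiag_part k b \<in> carrier_mat k k" using a b by (intro mult_carrier_mat[of _ k k]) auto
  have ub: "offdiag_part k a * diag_part k b \<in> carrier_mat k k" using a by (intro mult_carrier_mat[of _ k k]) auto
  have "nrm A (offdiag_part k (a * b)) \<le> nrm A (offdiag_part k (a * offdiag_part k b)) + nrm A (offdiag_part k a * diag_part k b)"
    unfolding offdiag_mult[OF a b] by (intro nrm_matrix_add_le offdiag_part_closed av ub)
  also have "\<dots> \<le> 2 * (nrm A a * nrm A (offdiag_part k b)) + nrm A (offdiag_part k a) * nrm A (diag_part k b)"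
    using nrm_offdiag_part_le[OF av] nrm_matrix_mult_le[OF a offdiag_part_closed[OF b]]
      nrm_matrix_mult_le[OF offdiag_part_closed[OF a] diag_part_closed, of b] by linarith
  also have "\<dots> \<le> 2 * (nrm A a * (net_lip b * r)) + (net_lip a * r) * nrm A b"
    by (intro add_mono mult_mono order_refl offdiag_le_net_lip nrm_diag_part_le nrm_matrix_nonneg a b)
       (use net_lip_nonneg[OF a] net_lip_nonneg[OF b] r nrm_matrix_nonneg[OF a] nrm_matrix_nonneg[OF offdiag_part_closed[OF b]] in auto)
  also have "\<dots> \<le> 2 * (nrm A a * net_lip b + nrm A b * net_lip a) * r"
    using nrm_matrix_nonneg[OF b] net_lip_nonneg[OF a] r by (simp add: algebra_simps)
  finally show "nrm A (offdiag_part k (a * b)) \<le> 2 * (nrm A a * net_lip b + nrm A b * net_lip a) * r" .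
qed

end

section \<open>Matrix algebras as quantum compact metric spaces\<close>

definition mat_unit :: "nat \<Rightarrow> nat \<times> nat \<Rightarrow> complex mat" where
  "mat_unit k p = mat k k (\<lambda>q. if q = p then 1 else 0)"

lemma mat_unit_closed [simp]: "mat_unit k p \<in> carrier_mat k k"
  by (simp add: mat_unit_def)

lemma statesD:
  assumes "\<phi> \<in> states (matrix_cstar k)"
  shows "a \<in> carrier_mat k k \<Longrightarrow> b \<in> carrier_mat k k \<Longrightarrow> \<phi> (a + b) = \<phi> a + \<phi> b"
    and "a \<in> carrier_mat k k \<Longrightarrow> \<phi> (z \<cdot>\<^sub>m a) = z * \<phi> a"
    and "\<phi> (1\<^sub>m k) = 1"
  using assms by (simp_all add: states_def)

lemma state_diff:
  assumes \<phi>: "\<phi> \<in> states (matrix_cstar k)" and a: "a \<in> carrier_mat k k" and b: "b \<in> carrier_mat k k"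
  shows "\<phi> (a - b) = \<phi> a - \<phi> b"
proof -
  have "a - b = a + (- 1) \<cdot>\<^sub>m b" using a b by (intro eq_matI) auto
  then show ?thesis using statesD[OF \<phi>] a b by simp
qed

lemma state_matrix_expand:
  assumes \<phi>: "\<phi> \<in> states (matrix_cstar k)" and a: "a \<in> carrier_mat k k"
  shows "\<phi> a = (\<Sum>p\<in>{..<k} \<times> {..<k}. a $$ p * \<phi> (mat_unit k p))"
proof -
  define R where "R S = mat k k (\<lambda>p. if p \<in> S then a $$ p else 0)" for S
  have R: "R S \<in> carrier_mat k k" for S by (simp add: R_def)
  have "\<phi> (R S) = (\<Sum>p\<in>S. a $$ p * \<phi> (mat_unit k p))" if "finite S" "S \<subseteq> {..<k} \<times> {..<k}" for S
    using that
  proof (induction S rule: finite_induct)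
    case empty
    have "R {} = 0 \<cdot>\<^sub>m R {}" by (intro eq_matI) (auto simp: R_def)
    then have "\<phi> (R {}) = 0 * \<phi> (R {})" using statesD(2)[OF \<phi> R] by metis
    then show ?case by simp
  next
    case (insert p S)
    have "R (insert p S) = a $$ p \<cdot>\<^sub>m mat_unit k p + R S"
      using insert.hyps by (intro eq_matI) (auto simp: R_def mat_unit_def)
    then show ?case
      using insert statesD[OF \<phi>] R by simp
  qed
  moreover have "R ({..<k} \<times> {..<k}) = a"
    using a by (intro eq_matI) (auto simp: R_def)
  ultimately show ?thesis by (metis finite_SigmaI finite_lessThan order_refl)
qed

context matrix_net
begin

abbreviation L :: "complex mat \<Rightarrow> ennreal" where "L \<equiv> \<lambda>a. ennreal (net_lip a)"
abbreviation mk_dist :: "(complex mat \<Rightarrow> complex) \<Rightarrow> (complex mat \<Rightarrow> complex) \<Rightarrow> real" where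
  "mk_dist \<equiv> \<lambda>\<phi> \<psi>. enn2real (mk A L \<phi> \<psi>)"

lemma lip_dom_eq: "lip_dom A L = self_adjoint A"
  by (auto simp: lip_dom_def)

lemma lip_ball_eq: "lip_ball A L = {a \<in> self_adjoint A. net_lip a \<le> 1}"
  by (auto simp: lip_ball_def)

lemma self_adjointD: "a \<in> self_adjoint A \<Longrightarrow> a \<in> carrier_mat k k"
  by (simp add: self_adjoint_def)

lemma net_lip_one: "net_lip (1\<^sub>m k) = 0"
proof -
  have "offdiag_part k (1\<^sub>m k) = 0\<^sub>m k k" by (intro eq_matI) auto
  then have "net_lip (1\<^sub>m k) \<le> 0" 
    using nrm_matrix_eq_0[of "0\<^sub>m k k" k] by (simp add: net_lip_le_iff)
  then show ?thesis using net_lip_nonneg[of "1\<^sub>m k"] by simp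
qed

lemma net_lip_eq_0:
  assumes a: "a \<in> carrier_mat k k" and "net_lip a = 0"
  shows "a = a $$ (0, 0) \<cdot>\<^sub>m 1\<^sub>m k"
proof (rule eq_matI)
  have "nrm A (offdiag_part k a) = 0"
    using offdiag_le_net_lip[OF a] assms(2) nrm_matrix_nonneg[OF offdiag_part_closed[OF a]] by simp
  then have off: "offdiag_part k a = 0\<^sub>m k k"
    using nrm_matrix_eq_0[OF offdiag_part_closed[OF a]] by simp
  fix i j assume "i < dim_row (a $$ (0, 0) \<cdot>\<^sub>m 1\<^sub>m k)" "j < dim_col (a $$ (0, 0) \<cdot>\<^sub>m 1\<^sub>m k)"
  then have ij: "i < k" "j < k" by auto
  have "a $$ (i, i) = a $$ (0, 0)"
    using diag_diff_le_net_lip[OF a ij(1), of 0] k assms(2) by (cases "i = 0") auto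
  moreover have "a $$ (i, j) = 0" if "i \<noteq> j"
    using arg_cong[OF off, of "\<lambda>x. x $$ (i, j)"] ij that by simp
  ultimately show "a $$ (i, j) = (a $$ (0, 0) \<cdot>\<^sub>m 1\<^sub>m k) $$ (i, j)" using ij by auto
qed (use a in auto)

text \<open>Two states agree on scalars, and subtracting the first diagonal entry from an element of the unit ball
leaves a matrix whose entries are bounded by a constant depending only on the net.\<close>

lemma mk_bound:
  "\<exists>C>0. \<forall>\<phi>\<in>states A. \<forall>\<psi>\<in>states A.
     mk A L \<phi> \<psi> \<le> ennreal (C * (\<Sum>p\<in>{..<k} \<times> {..<k}. cmod (\<phi> (mat_unit k p) - \<psi> (mat_unit k p))))"
proof -
  define C where "C = r + (\<Sum>i<k. \<bar>e i 0\<bar>)"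
  have C: "0 < C" using r by (simp add: C_def add_pos_nonneg sum_nonneg)
  have "cmod (\<phi> a - \<psi> a) \<le> C * (\<Sum>p\<in>{..<k} \<times> {..<k}. cmod (\<phi> (mat_unit k p) - \<psi> (mat_unit k p)))"
    if \<phi>: "\<phi> \<in> states A" and \<psi>: "\<psi> \<in> states A" and "a \<in> lip_ball A L" for \<phi> \<psi> a
  proof -
    have a: "a \<in> carrier_mat k k" and la: "net_lip a \<le> 1"
      using that(3) by (auto simp: lip_ball_eq self_adjointD)
    define b where "b = a - a $$ (0, 0) \<cdot>\<^sub>m 1\<^sub>m k"
    have b: "b \<in> carrier_mat k k" by (simp add: b_def minus_carrier_mat)
    have bC: "cmod (b $$ p) \<le> C" if pk: "p \<in> {..<k} \<times> {..<k}" for p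
    proof -
      obtain i j where p: "p = (i, j)" "i < k" "j < k" using pk by auto
      show ?thesis
      proof (cases "i = j")
        case False
        have "cmod (offdiag_part k a $$ (i, j)) \<le> nrm A (offdiag_part k a)"
          by (rule entry_le_nrm_matrix[OF offdiag_part_closed[OF a] p(2,3)])
        also have "\<dots> \<le> 1 * r" 
          using offdiag_le_net_lip[OF a] mult_right_mono[OF la, of r] r by linarith
        also have "\<dots> \<le> C" by (simp add: C_def sum_nonneg)
        finally show ?thesis using False p a by (simp add: b_def)
      next
        case True
        have "cmod (a $$ (i, i) - a $$ (0, 0)) \<le> C"
        proof (cases "i = 0")
          case False
          have "cmod (a $$ (i, i) - a $$ (0, 0)) \<le> net_lip a * e i 0"
            using diag_diff_le_net_lip[OF a p(2), of 0] k False by simp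
          also have "\<dots> \<le> 1 * \<bar>e i 0\<bar>" 
            using la sep[OF p(2), of 0] k False r by (intro mult_mono) auto
          also have "\<dots> \<le> (\<Sum>i<k. \<bar>e i 0\<bar>)"
            using p(2) member_le_sum[of i "{..<k}" "\<lambda>i. \<bar>e i 0\<bar>"] by simp
          also have "\<dots> \<le> C" using r by (simp add: C_def)
          finally show ?thesis .
        qed (use C in simp)
        then show ?thesis using True p a k by (simp add: b_def)
      qed
    qed
    have "\<phi> a - \<psi> a = \<phi> b - \<psi> b"
      using a by (simp add: b_def state_diff[OF \<phi>] state_diff[OF \<psi>] statesD[OF \<phi>] statesD[OF \<psi>])
    also have "\<dots> = (\<Sum>p\<in>{..<k} \<times> {..<k}. b $$ p * (\<phi> (mat_unit k p) - \<psi> (mat_unit k p)))"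
      unfolding state_matrix_expand[OF \<phi> b] state_matrix_expand[OF \<psi> b]
      by (simp add: sum_subtractf right_diff_distrib)
    also have "cmod \<dots> \<le> (\<Sum>p\<in>{..<k} \<times> {..<k}. C * cmod (\<phi> (mat_unit k p) - \<psi> (mat_unit k p)))"
      by (rule sum_norm_le) (auto simp: norm_mult intro!: mult_right_mono bC)
    finally show ?thesis by (simp add: sum_distrib_left)
  qed
  then show ?thesis
    using C unfolding mk_def by (intro exI[of _ C] conjI ballI SUP_least ennreal_leI) auto
qed

lemma mk_less_top: 
  assumes "\<phi> \<in> states A" "\<psi> \<in> states A" 
  shows "mk A L \<phi> \<psi> < \<infinity>"
proof -
  obtain C where "mk A L \<phi> \<psi> \<le> ennreal C" using mk_bound assms by blast
  then show ?thesis by (simp add: order_le_less_trans[OF _ ennreal_less_top])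
qed

text \<open>The element \<open>a / (net_lip a + 1)\<close> is in the unit ball; the summand 1 makes the denominator positive also
for scalar \<open>a\<close>.\<close>

lemma state_diff_le_mk_self_adjoint:
  assumes \<phi>: "\<phi> \<in> states A" and \<psi>: "\<psi> \<in> states A" and a: "a \<in> self_adjoint A"
  shows "cmod (\<phi> a - \<psi> a) \<le> (net_lip a + 1) * mk_dist \<phi> \<psi>"
proof -
  note ac = self_adjointD[OF a]
  define c where "c = net_lip a + 1"
  have c: "c > 0" using net_lip_nonneg[OF ac] by (simp add: c_def)
  define b where "b = complex_of_real (inverse c) \<cdot>\<^sub>m a"
  have "net_lip b = inverse c * net_lip a"
    using ac c by (simp add: b_def net_lip_smult norm_inverse)
  also have "\<dots> \<le> 1" using c by (simp add: c_def field_simps)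
  finally have b: "b \<in> lip_ball A L"
    using a A.adj_smult[of a "complex_of_real (inverse c)"] 
    by (simp add: lip_ball_eq self_adjoint_def b_def)
  have "ennreal (cmod (\<phi> b - \<psi> b)) \<le> mk A L \<phi> \<psi>"
    unfolding mk_def by (rule SUP_upper[OF b])
  then have "cmod (\<phi> b - \<psi> b) \<le> mk_dist \<phi> \<psi>"
    using mk_less_top[OF \<phi> \<psi>] by (metis enn2real_ennreal enn2real_mono norm_ge_zero infinity_ennreal_def)
  moreover have "\<phi> b - \<psi> b = complex_of_real (inverse c) * (\<phi> a - \<psi> a)"
    using ac by (simp add: b_def statesD[OF \<phi>] statesD[OF \<psi>] right_diff_distrib)
  ultimately have "inverse c * cmod (\<phi> a - \<psi> a) \<le> mk_dist \<phi> \<psi>"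
    using c by (simp add: norm_mult norm_inverse)
  then show ?thesis
    unfolding c_def[symmetric] using c by (simp add: field_simps)
qed

text \<open>Decompose \<open>a\<close> into its real and imaginary part.\<close>

lemma state_diff_le_mk:
  assumes a: "a \<in> carrier_mat k k"
  shows "\<exists>C>0. \<forall>\<phi>\<in>states A. \<forall>\<psi>\<in>states A. cmod (\<phi> a - \<psi> a) \<le> C * mk_dist \<phi> \<psi>"
proof -
  define h where "h = (1 / 2) \<cdot>\<^sub>m (a + mat_adjoint a)"
  define s where "s = (1 / (2 * \<i>)) \<cdot>\<^sub>m (a - mat_adjoint a)"
  note aa = mat_adjoint_closed[OF a]
  have hc: "h \<in> carrier_mat k k" and sc: "s \<in> carrier_mat k k"
    using aa by (simp_all add: h_def s_def minus_carrier_mat)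
  have "mat_adjoint h = h"
  proof (rule eq_matI)
    fix i j assume "i < dim_row h" "j < dim_col h"
    then have ij: "i < k" "j < k" using hc by auto
    show "mat_adjoint h $$ (i, j) = h $$ (i, j)"
      unfolding mat_adjoint_index[OF hc ij]
      using a ij carrier_matD[OF aa] by (simp add: h_def add.commute)
  qed (use hc carrier_matD[OF mat_adjoint_closed[OF hc]] in auto)
  then have h: "h \<in> self_adjoint A" using hc by (simp add: self_adjoint_def)
  have "mat_adjoint s = s"
  proof (rule eq_matI)
    fix i j assume "i < dim_row s" "j < dim_col s"
    then have ij: "i < k" "j < k" using sc by auto
    have half: "1 / (2 * \<i>) = - \<i> / 2" by (simp add: complex_eq_iff)
    have "cnj (1 / (2 * \<i>) * (x - cnj y)) = 1 / (2 * \<i>) * (y - cnj x)" for x y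
      unfolding half by (intro complex_eqI) (simp_all add: field_simps)
    then show "mat_adjoint s $$ (i, j) = s $$ (i, j)"
      unfolding mat_adjoint_index[OF sc ij]
      using a ij carrier_matD[OF aa] by (simp add: s_def)
  qed (use sc carrier_matD[OF mat_adjoint_closed[OF sc]] in auto)
  then have s: "s \<in> self_adjoint A" using sc by (simp add: self_adjoint_def)
  have ahs: "a = h + \<i> \<cdot>\<^sub>m s"
  proof (rule eq_matI)
    have eq: "x = 1 / 2 * (x + y) + \<i> * (1 / (2 * \<i>) * (x - y))" for x y
      by (simp add: field_simps)
    fix i j assume "i < dim_row (h + \<i> \<cdot>\<^sub>m s)" "j < dim_col (h + \<i> \<cdot>\<^sub>m s)"
    then have ij: "i < k" "j < k" using sc by auto
    have "(h + \<i> \<cdot>\<^sub>m s) $$ (i, j) = 1 / 2 * (a $$ (i, j) + mat_adjoint a $$ (i, j)) 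
        + \<i> * (1 / (2 * \<i>) * (a $$ (i, j) - mat_adjoint a $$ (i, j)))"
      using ij a carrier_matD[OF aa] by (simp add: h_def s_def del: mat_adjoint_index)
    then show "a $$ (i, j) = (h + \<i> \<cdot>\<^sub>m s) $$ (i, j)"
      using eq by metis
  qed (use a sc in auto)
  define C where "C = (net_lip h + 1) + (net_lip s + 1)"
  have "cmod (\<phi> a - \<psi> a) \<le> C * mk_dist \<phi> \<psi>" if \<phi>: "\<phi> \<in> states A" and \<psi>: "\<psi> \<in> states A" for \<phi> \<psi>
  proof -
    have "\<phi> a - \<psi> a = (\<phi> h - \<psi> h) + \<i> * (\<phi> s - \<psi> s)"
      using arg_cong[OF ahs, of \<phi>] arg_cong[OF ahs, of \<psi>] hc sc
      by (simp add: statesD[OF \<phi>] statesD[OF \<psi>] algebra_simps)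
    then have "cmod (\<phi> a - \<psi> a) \<le> cmod (\<phi> h - \<psi> h) + cmod (\<phi> s - \<psi> s)"
      using norm_triangle_ineq[of "\<phi> h - \<psi> h" "\<i> * (\<phi> s - \<psi> s)"] by (simp add: norm_mult)
    then show ?thesis
      using state_diff_le_mk_self_adjoint[OF \<phi> \<psi> h] state_diff_le_mk_self_adjoint[OF \<phi> \<psi> s]
      by (simp add: C_def distrib_right)
  qed
  moreover have "C > 0" using net_lip_nonneg[OF hc] net_lip_nonneg[OF sc] by (simp add: C_def)
  ultimately show ?thesis by blast
qed

lemma mk_commute: "mk A L \<phi> \<psi> = mk A L \<psi> \<phi>"
  by (simp add: mk_def norm_minus_commute)

lemma mk_triangle: "mk A L \<phi> \<omega> \<le> mk A L \<phi> \<psi> + mk A L \<psi> \<omega>"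
  unfolding mk_def[of A L \<phi> \<omega>]
proof (rule SUP_least)
  fix a assume a: "a \<in> lip_ball A L"
  have "ennreal (cmod (\<phi> a - \<omega> a)) \<le> ennreal (cmod (\<phi> a - \<psi> a)) + ennreal (cmod (\<psi> a - \<omega> a))"
    using norm_triangle_ineq[of "\<phi> a - \<psi> a" "\<psi> a - \<omega> a"] by (simp flip: ennreal_plus)
  also have "\<dots> \<le> mk A L \<phi> \<psi> + mk A L \<psi> \<omega>"
    unfolding mk_def by (intro add_mono SUP_upper a)
  finally show "ennreal (cmod (\<phi> a - \<omega> a)) \<le> mk A L \<phi> \<psi> + mk A L \<psi> \<omega>" .
qed

lemma Metric_space_mk: "Metric_space (states A) mk_dist"
proof
  fix \<phi> \<psi> \<omega>
  show "0 \<le> mk_dist \<phi> \<psi>" by simp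
  show "mk_dist \<phi> \<psi> = mk_dist \<psi> \<phi>" by (simp add: mk_commute)
  assume \<phi>: "\<phi> \<in> states A" and \<psi>: "\<psi> \<in> states A"
  show "mk_dist \<phi> \<psi> = 0 \<longleftrightarrow> \<phi> = \<psi>"
  proof
    assume m0: "mk_dist \<phi> \<psi> = 0"
    have "\<phi> a = \<psi> a" if "a \<in> carrier A" for a
      using state_diff_le_mk[of a] that \<phi> \<psi> m0 by fastforce
    then show "\<phi> = \<psi>" using \<phi> \<psi> by (auto simp: states_def intro: extensionalityI)
  next
    assume "\<phi> = \<psi>"
    then have "mk A L \<phi> \<psi> \<le> 0" unfolding mk_def by (intro SUP_least) simp
    then show "mk_dist \<phi> \<psi> = 0" by simp
  qed
  assume \<omega>: "\<omega> \<in> states A"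
  have "mk_dist \<phi> \<omega> \<le> enn2real (mk A L \<phi> \<psi> + mk A L \<psi> \<omega>)"
    using mk_less_top[OF \<phi> \<psi>] mk_less_top[OF \<psi> \<omega>] by (intro enn2real_mono mk_triangle) simp
  also have "\<dots> = mk_dist \<phi> \<psi> + mk_dist \<psi> \<omega>"
    using mk_less_top[OF \<phi> \<psi>] mk_less_top[OF \<psi> \<omega>] by (intro enn2real_plus) auto
  finally show "mk_dist \<phi> \<omega> \<le> mk_dist \<phi> \<psi> + mk_dist \<psi> \<omega>" .
qed

text \<open>Both topologies are the topology of pointwise convergence on finitely many matrices:
\<open>mk_bound\<close> controls the metric by the values at the matrix units, and \<open>state_diff_le_mk\<close> controls each
evaluation by the metric.\<close>

lemma mk_metrizes_weak_star: "Metric_space.mtopology (states A) mk_dist = weak_star_topology A"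
proof -
  interpret M: Metric_space "states A" mk_dist by (rule Metric_space_mk)
  let ?W = "weak_star_topology A"
  have ext: "\<phi> \<in> extensional (carrier A)" if "\<phi> \<in> states A" for \<phi>
    using that by (simp add: states_def)
  then have "states A \<subseteq> (\<Pi>\<^sub>E a\<in>carrier A. topspace euclidean)"
    by (auto simp: PiE_def simp del: matrix_cstar_simps)
  then have top_W: "topspace ?W = states A"
    unfolding weak_star_topology_def topspace_subtopology topspace_product_topology by blast
  have cont: "continuous_map M.mtopology ?W (\<lambda>\<phi>. \<phi>)"
    unfolding weak_star_topology_def
  proof (rule continuous_map_into_subtopology)
    show "continuous_map M.mtopology (product_topology (\<lambda>_. euclidean) (carrier A)) (\<lambda>\<phi>. \<phi>)"
      unfolding continuous_map_componentwise
    proof (intro conjI ballI)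
      show "(\<lambda>\<phi>. \<phi>) ` topspace M.mtopology \<subseteq> extensional (carrier A)"
        unfolding M.topspace_mtopology using ext by blast
      fix a assume a: "a \<in> carrier A"
      then obtain C where C: "C > 0" "\<And>\<phi> \<psi>. \<phi> \<in> states A \<Longrightarrow> \<psi> \<in> states A \<Longrightarrow> cmod (\<phi> a - \<psi> a) \<le> C * mk_dist \<phi> \<psi>"
        using state_diff_le_mk[of a] by auto
      have "continuous_map M.mtopology (Metric_space.mtopology UNIV dist) (\<lambda>\<phi>. \<phi> a)"
        unfolding M.metric_continuous_map[OF Met_TC.Metric_space_axioms]
      proof (intro conjI ballI allI impI)
        fix \<phi> and \<epsilon> :: real assume \<phi>: "\<phi> \<in> states A" and "\<epsilon> > 0"
        have "dist (\<phi> a) (\<psi> a) < \<epsilon>" if \<psi>: "\<psi> \<in> states A" "mk_dist \<phi> \<psi> < \<epsilon> / C" for \<psi>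
        proof -
          have "C * mk_dist \<phi> \<psi> < C * (\<epsilon> / C)" by (rule mult_strict_left_mono[OF that(2) C(1)])
          then show ?thesis using C(2)[OF \<phi> \<psi>(1)] C(1) by (simp add: dist_norm)
        qed
        then show "\<exists>\<delta>>0. \<forall>\<psi>. \<psi> \<in> states A \<and> mk_dist \<phi> \<psi> < \<delta> \<longrightarrow> dist (\<phi> a) (\<psi> a) < \<epsilon>"
          using C(1) \<open>\<epsilon> > 0\<close> by (intro exI[of _ "\<epsilon> / C"]) auto
      qed simp
      then show "continuous_map M.mtopology euclidean (\<lambda>\<phi>. \<phi> a)" by simp
    qed
  qed simp
  show ?thesis
    unfolding topology_eq
  proof (intro allI iffI)
    fix S assume S: "openin ?W S"
    have "S \<subseteq> states A" using openin_subset[OF S] top_W by simp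
    then show "openin M.mtopology S"
      using openin_continuous_map_preimage[OF cont S] by (simp add: Int_absorb1 Collect_conj_eq)
  next
    fix S assume S: "openin M.mtopology S"
    obtain C where C: "C > 0" "\<And>\<phi> \<psi>. \<phi> \<in> states A \<Longrightarrow> \<psi> \<in> states A \<Longrightarrow>
       mk A L \<phi> \<psi> \<le> ennreal (C * (\<Sum>p\<in>{..<k} \<times> {..<k}. cmod (\<phi> (mat_unit k p) - \<psi> (mat_unit k p))))"
      using mk_bound by blast
    show "openin ?W S"
    proof (subst openin_subopen, intro ballI)
      fix \<phi> assume "\<phi> \<in> S"
      then obtain \<rho> where \<rho>: "\<rho> > 0" "M.mball \<phi> \<rho> \<subseteq> S" and \<phi>: "\<phi> \<in> states A"
        using S unfolding M.openin_mtopology by blast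
      define g where "g \<psi> = (\<Sum>p\<in>{..<k} \<times> {..<k}. cmod (\<phi> (mat_unit k p) - \<psi> (mat_unit k p)))" for \<psi>
      have "continuous_map ?W euclideanreal g"
        unfolding g_def weak_star_topology_def
        by (intro continuous_map_sum continuous_map_norm continuous_map_diff continuous_map_from_subtopology
            continuous_map_product_projection) auto
      then have "openin ?W {\<psi> \<in> topspace ?W. g \<psi> \<in> {..<\<rho> / C}}"
        by (rule openin_continuous_map_preimage) simp
      moreover have "\<phi> \<in> {\<psi> \<in> topspace ?W. g \<psi> \<in> {..<\<rho> / C}}"
        using \<phi> \<rho>(1) C(1) by (simp add: top_W g_def)
      moreover have "{\<psi> \<in> topspace ?W. g \<psi> \<in> {..<\<rho> / C}} \<subseteq> S"
      proof
        fix \<psi> assume "\<psi> \<in> {\<psi> \<in> topspace ?W. g \<psi> \<in> {..<\<rho> / C}}"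
        then have \<psi>: "\<psi> \<in> states A" and g: "g \<psi> < \<rho> / C" by (auto simp: top_W)
        have "mk_dist \<phi> \<psi> \<le> C * g \<psi>"
          using C(2)[OF \<phi> \<psi>] C(1) by (intro enn2real_leI) (auto simp: g_def sum_nonneg)
        also have "\<dots> < \<rho>" using g C(1) by (simp add: field_simps)
        finally show "\<psi> \<in> S" using \<rho>(2) \<phi> \<psi> by (auto simp: M.in_mball)
      qed
      ultimately show "\<exists>T. openin ?W T \<and> \<phi> \<in> T \<and> T \<subseteq> S" by blast
    qed
  qed
qed

text \<open>The seminorm is even Lipschitz continuous, by \<open>net_lip_le_nrm\<close>.\<close>

lemma L_lower_semicontinuous:
  "openin (subtopology (nrm_topology A) (self_adjoint A)) {a \<in> self_adjoint A. s < L a}"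
proof -
  have "openin (nrm_topology A) {a \<in> carrier A. s < L a}"
    unfolding nrm_topology_def A.nrm.openin_mtopology
  proof (intro conjI allI impI)
    fix a assume "a \<in> {a \<in> carrier A. s < L a}"
    then have a: "a \<in> carrier_mat k k" and sa: "s < L a" by auto
    then obtain t where t: "s = ennreal t" "0 \<le> t" by (cases s) auto
    have tl: "t < net_lip a" using sa t by (simp add: ennreal_less_iff)
    have "b \<in> {a \<in> carrier A. s < L a}" if "b \<in> A.nrm.mball a ((net_lip a - t) * r / 2)" for b
    proof -
      have b: "b \<in> carrier_mat k k" using that unfolding A.nrm.in_mball by simp
      have "nrm_dist A a b < (net_lip a - t) * r / 2" using that unfolding A.nrm.in_mball by simp
      then have nd: "nrm A (a - b) < (net_lip a - t) * r / 2" using a b by (simp add: nrm_dist_def)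
      have "a = (a - b) + b" using a b by (intro eq_matI) auto
      then have "net_lip a \<le> net_lip (a - b) + net_lip b" using net_lip_add_le[of "a - b" b] b minus_carrier_mat[OF b] by metis
      moreover have "net_lip (a - b) \<le> 2 / r * nrm A (a - b)" by (rule net_lip_le_nrm[OF minus_carrier_mat[OF b]])
      moreover have "2 / r * nrm A (a - b) < net_lip a - t" using nd r by (simp add: field_simps)
      ultimately have "t < net_lip b" by linarith
      then show ?thesis using b t by (simp add: ennreal_less_iff)
    qed
    then show "\<exists>\<rho>>0. A.nrm.mball a \<rho> \<subseteq> {a \<in> carrier A. s < L a}"
      using tl r by (intro exI[of _ "(net_lip a - t) * r / 2"]) auto
  qed blast
  then show ?thesis
    unfolding openin_subtopology by (intro exI conjI) (auto simp: self_adjoint_def)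
qed

text \<open>The seminorm is finite everywhere, so the conditions on its domain reduce to properties of the
self-adjoint part.  The Jordan and Lie products are half the sum and half the difference of the two products,
up to a factor of modulus 1, and both of these satisfy \<open>net_lip_mult_le\<close>.\<close>

lemma quasi_leibniz_qcms: "quasi_leibniz_qcms (CD_fun 2 0) A L"
proof (intro quasi_leibniz_qcms.intro quasi_leibniz_qcms_axioms.intro A.unital_cstar_algebra_axioms
    mk_metrizes_weak_star Metric_space_mk mk_less_top L_lower_semicontinuous)
  show "permissible (CD_fun 2 0)"
    unfolding permissible_def CD_fun_def by (auto intro!: add_mono mult_mono)
  show "\<zero>\<^bsub>A\<^esub> \<in> lip_dom A L"
  proof -
    have "mat_adjoint (0\<^sub>m k k :: complex mat) = 0\<^sub>m k k"
      by (intro eq_matI) (auto simp: carrier_matD[OF mat_adjoint_closed[OF zero_carrier_mat]] mat_adjoint_index[OF zero_carrier_mat])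
    then show ?thesis unfolding lip_dom_eq by (simp add: self_adjoint_def)
  qed
  show "self_adjoint A \<subseteq> nrm_topology A closure_of lip_dom A L"
    unfolding lip_dom_eq nrm_topology_def
    by (rule closure_of_subset) (unfold A.nrm.topspace_mtopology, auto simp: self_adjoint_def)
  show "{a \<in> lip_dom A L. L a = 0} = range (\<lambda>t. complex_of_real t \<odot>\<^bsub>A\<^esub> \<one>\<^bsub>A\<^esub>)"
  proof (intro antisym subsetI)
    fix a assume "a \<in> {a \<in> lip_dom A L. L a = 0}"
    then have a: "a \<in> self_adjoint A" and "net_lip a = 0"
      using net_lip_nonneg[OF self_adjointD] by (auto simp: lip_dom_eq ennreal_eq_0_iff intro: antisym)
    then have eq: "a = a $$ (0, 0) \<cdot>\<^sub>m 1\<^sub>m k" using net_lip_eq_0[OF self_adjointD] by blast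
    have "a $$ (0, 0) = cnj (a $$ (0, 0))"
      using a k mat_adjoint_index[of a k 0 0] by (simp add: self_adjoint_def)
    then have "a $$ (0, 0) = complex_of_real (Re (a $$ (0, 0)))"
      by (metis Reals_cnj_iff of_real_Re)
    then show "a \<in> range (\<lambda>t. complex_of_real t \<odot>\<^bsub>A\<^esub> \<one>\<^bsub>A\<^esub>)"
      using eq by (metis matrix_cstar_simps(3,6) rangeI)
  next
    fix a assume "a \<in> range (\<lambda>t. complex_of_real t \<odot>\<^bsub>A\<^esub> \<one>\<^bsub>A\<^esub>)"
    then obtain t where t: "a = complex_of_real t \<cdot>\<^sub>m 1\<^sub>m k" by auto
    have "adj A \<one>\<^bsub>A\<^esub> = \<one>\<^bsub>A\<^esub>" 
      by (simp, intro eq_matI) (auto simp: carrier_matD[OF mat_adjoint_closed[OF one_carrier_mat]] mat_adjoint_index[OF one_carrier_mat])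
    then show "a \<in> {a \<in> lip_dom A L. L a = 0}"
      using A.adj_smult[of "1\<^sub>m k" "complex_of_real t"] 
      by (auto simp: t lip_dom_eq self_adjoint_def net_lip_smult net_lip_one)
  qed
next
  fix a t assume a: "a \<in> lip_dom A L"
  then have ac: "a \<in> carrier_mat k k" by (simp add: lip_dom_eq self_adjointD)
  show "complex_of_real t \<odot>\<^bsub>A\<^esub> a \<in> lip_dom A L"
    using a A.adj_smult[of a "complex_of_real t"] by (auto simp: lip_dom_eq self_adjoint_def)
  show "L (complex_of_real t \<odot>\<^bsub>A\<^esub> a) = ennreal \<bar>t\<bar> * L a"
    using ac by (simp add: net_lip_smult ennreal_mult' net_lip_nonneg)
next
  fix a b assume "a \<in> lip_dom A L" "b \<in> lip_dom A L"
  then have ab: "a \<in> self_adjoint A" "b \<in> self_adjoint A" by (simp_all add: lip_dom_eq)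
  note a = self_adjointD[OF ab(1)] and b = self_adjointD[OF ab(2)]
  show "a \<oplus>\<^bsub>A\<^esub> b \<in> lip_dom A L"
    using ab A.adj_add[of a b] by (auto simp: lip_dom_eq self_adjoint_def)
  show "jordan_prod A a b \<in> lip_dom A L" "lie_prod A a b \<in> lip_dom A L"
    using A.self_adjoint_jordan[OF ab] A.self_adjoint_lie[OF ab] by (simp_all add: lip_dom_eq)
  show "L (a \<oplus>\<^bsub>A\<^esub> b) \<le> L a + L b"
    using net_lip_add_le[OF a b] net_lip_nonneg[OF a] net_lip_nonneg[OF b] by (simp flip: ennreal_plus)
  let ?S = "2 * (nrm A a * net_lip b + nrm A b * net_lip a)"
  have mab: "a * b \<in> carrier_mat k k" and mba: "b * a \<in> carrier_mat k k"
    using a b by (auto intro: mult_carrier_mat)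
  have lab: "net_lip (a * b) \<le> ?S" and lba: "net_lip (b * a) \<le> ?S"
    using net_lip_mult_le[OF a b] net_lip_mult_le[OF b a] by (simp_all add: add.commute)
  have "net_lip (jordan_prod A a b) \<le> ?S"
    using net_lip_add_le[OF mab mba] lab lba mab mba by (simp add: jordan_prod_def net_lip_smult)
  moreover have "a * b - b * a = a * b + (- 1) \<cdot>\<^sub>m (b * a)"
    using mab mba by (intro eq_matI) auto
  then have "net_lip (a * b - b * a) \<le> net_lip (a * b) + net_lip (b * a)"
    using net_lip_add_le[OF mab, of "(- 1) \<cdot>\<^sub>m (b * a)"] mba by (simp add: net_lip_smult)
  then have "net_lip (lie_prod A a b) \<le> ?S"
    using lab lba mab mba minus_carrier_mat[OF mba, of "a * b"] by (simp add: lie_prod_def net_lip_smult norm_divide norm_mult)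
  ultimately show "max (L (jordan_prod A a b)) (L (lie_prod A a b))
      \<le> ennreal (CD_fun 2 0 (nrm A a) (nrm A b) (enn2real (L a)) (enn2real (L b)))"
    using net_lip_nonneg[OF a] net_lip_nonneg[OF b] by (auto simp: CD_fun_def intro!: ennreal_leI)
qed

end

section \<open>Diagonal matrices and continuous functions\<close>

lemma restrict_state:
  assumes \<pi>: "unital_star_mono A D \<pi>" and \<phi>: "\<phi> \<in> states D"
    and one: "\<one>\<^bsub>A\<^esub> \<in> carrier A"
    and add: "\<And>a b. a \<in> carrier A \<Longrightarrow> b \<in> carrier A \<Longrightarrow> a \<oplus>\<^bsub>A\<^esub> b \<in> carrier A"
    and mult: "\<And>a b. a \<in> carrier A \<Longrightarrow> b \<in> carrier A \<Longrightarrow> a \<otimes>\<^bsub>A\<^esub> b \<in> carrier A"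
    and smult: "\<And>z a. a \<in> carrier A \<Longrightarrow> z \<odot>\<^bsub>A\<^esub> a \<in> carrier A"
    and adj: "\<And>a. a \<in> carrier A \<Longrightarrow> adj A a \<in> carrier A"
  shows "restrict (\<phi> \<circ> \<pi>) (carrier A) \<in> states A"
proof -
  have h: "\<pi> \<in> Ring.ring_hom A D" and sm: "\<And>z a. a \<in> carrier A \<Longrightarrow> \<pi> (z \<odot>\<^bsub>A\<^esub> a) = z \<odot>\<^bsub>D\<^esub> \<pi> a"
    and ad: "\<And>a. a \<in> carrier A \<Longrightarrow> \<pi> (adj A a) = adj D (\<pi> a)"
    using \<pi> by (auto simp: unital_star_mono_def)
  note [simp] = ring_hom_closed[OF h] ring_hom_add[OF h] ring_hom_mult[OF h] ring_hom_one[OF h] sm ad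
    one add mult smult adj
  show ?thesis
    using \<phi> unfolding states_def by simp
qed

lemma hausdorff_le:
  assumes "\<And>s. s \<in> S \<Longrightarrow> \<exists>t\<in>T. d s t \<le> c" and "\<And>t. t \<in> T \<Longrightarrow> \<exists>s\<in>S. d s t \<le> c"
  shows "hausdorff d S T \<le> c"
  unfolding hausdorff_def using assms
  by (intro max.boundedI SUP_least) (meson INF_lower2)+

lemma mk_self: "mk A L \<phi> \<phi> \<le> c"
  unfolding mk_def by (intro SUP_least) simp

lemma diagonal_mult: "diagonal k c * diagonal k c' = diagonal k (\<lambda>i. c i * c' i)"
proof (rule eq_matI)
  fix i j assume "i < dim_row (diagonal k (\<lambda>i. c i * c' i))" "j < dim_col (diagonal k (\<lambda>i. c i * c' i))"
  then have ij: "i < k" "j < k" by auto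
  then have "(diagonal k c * diagonal k c') $$ (i, j) = (\<Sum>m\<in>{0..<k}. diagonal k c $$ (i, m) * diagonal k c' $$ (m, j))"
    by (simp add: scalar_prod_def)
  also have "\<dots> = (\<Sum>m\<in>{0..<k}. if m = i then (if i = j then c i * c' i else 0) else 0)"
    using ij by (intro sum.cong) auto
  finally show "(diagonal k c * diagonal k c') $$ (i, j) = diagonal k (\<lambda>i. c i * c' i) $$ (i, j)"
    using ij by simp
qed auto

lemma diagonal_adjoint: "mat_adjoint (diagonal k c) = diagonal k (\<lambda>i. cnj (c i))"
  using carrier_matD[OF mat_adjoint_closed[of "diagonal k c" k]]
  by (intro eq_matI) (auto simp: mat_adjoint_index[of "diagonal k c" k])

text \<open>Such a convex combination is a weighted mean of the vector states of the standard basis.\<close>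

lemma diagonal_state:
  assumes w: "\<And>i. i < k \<Longrightarrow> 0 \<le> w i" and one: "(\<Sum>i<k. w i) = 1"
  shows "restrict (\<lambda>a. \<Sum>i<k. complex_of_real (w i) * a $$ (i, i)) (carrier_mat k k) \<in> states (matrix_cstar k)"
    (is "?\<phi> \<in> _")
proof -
  have "(\<Sum>i<k. complex_of_real (w i)) = 1" using one by (simp flip: of_real_sum)
  moreover have "(\<Sum>i<k. complex_of_real (w i) * (mat_adjoint a * a) $$ (i, i)) \<in> \<real>\<^sub>\<ge>\<^sub>0" if a: "a \<in> carrier_mat k k" for a
  proof -
    have "(mat_adjoint a * a) $$ (i, i) = complex_of_real (\<Sum>m\<in>{0..<k}. (cmod (a $$ (m, i)))\<^sup>2)" if "i < k" for i
      using a that carrier_matD[OF mat_adjoint_closed[OF a]]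
      by (auto simp: scalar_prod_def complex_norm_square[symmetric] mult.commute intro!: sum.cong)
    then have "(\<Sum>i<k. complex_of_real (w i) * (mat_adjoint a * a) $$ (i, i))
        = complex_of_real (\<Sum>i<k. w i * (\<Sum>m\<in>{0..<k}. (cmod (a $$ (m, i)))\<^sup>2))"
      by simp
    then show ?thesis using w by (simp only: nonneg_Reals_of_real_iff) (auto intro!: sum_nonneg mult_nonneg_nonneg)
  qed
  moreover have "mat_adjoint a * a \<in> carrier_mat k k" if a: "a \<in> carrier_mat k k" for a :: "complex mat"
    by (rule mult_carrier_mat[OF mat_adjoint_closed[OF a] a])
  ultimately show ?thesis
    by (auto simp: states_def sum.distrib distrib_left sum_distrib_left mult_ac)
qed

text \<open>The entry \<open>(a, b)\<close> of the \<open>j\<close>-th matrix is stored at the position that encodes \<open>(j, (a, b))\<close>.\<close>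

definition encode_seq :: "(nat \<Rightarrow> complex mat) \<Rightarrow> universe" where
  "encode_seq s = (\<lambda>n. case prod_decode n of (j, p) \<Rightarrow> s j $$ prod_decode p)"

lemma inj_on_encode_seq: "inj_on encode_seq (bounded_seqs (matrix_cstar k))"
proof (rule inj_onI, rule ext)
  fix s t j
  assume st: "s \<in> bounded_seqs (matrix_cstar k)" "t \<in> bounded_seqs (matrix_cstar k)"
    and eq: "encode_seq s = encode_seq t"
  have "s j $$ (a, b) = t j $$ (a, b)" for a b
    using fun_cong[OF eq, of "prod_encode (j, prod_encode (a, b))"] by (simp add: encode_seq_def)
  moreover have "s j \<in> carrier_mat k k" "t j \<in> carrier_mat k k"
    using st by (auto simp: bounded_seqs_def)
  ultimately show "s j = t j" by (intro eq_matI) auto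
qed

lemma (in Metric_space) nonexpansive_continuous_map:
  assumes "\<And>p q. p \<in> M \<Longrightarrow> q \<in> M \<Longrightarrow> dist (f p) (f q) \<le> d p q"
  shows "continuous_map mtopology euclidean f"
proof -
  have "continuous_map mtopology (Met_TC.mtopology) f"
    unfolding metric_continuous_map[OF Met_TC.Metric_space_axioms]
    using assms by (auto intro: le_less_trans)
  then show ?thesis by simp
qed

context Metric_space
begin

abbreviation CM :: "('a \<Rightarrow> complex) cstar" where "CM \<equiv> cont_cstar M d"

lemma cont_simps [simp]:
  "f \<otimes>\<^bsub>CM\<^esub> g = (\<lambda>p\<in>M. f p * g p)"
  "f \<oplus>\<^bsub>CM\<^esub> g = (\<lambda>p\<in>M. f p + g p)"
  "\<one>\<^bsub>CM\<^esub> = (\<lambda>p\<in>M. 1)"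
  "\<zero>\<^bsub>CM\<^esub> = (\<lambda>p\<in>M. 0)"
  "z \<odot>\<^bsub>CM\<^esub> f = (\<lambda>p\<in>M. z * f p)"
  "adj CM f = (\<lambda>p\<in>M. cnj (f p))"
  by (simp_all add: cont_cstar_def)

lemma carrier_CM: "carrier CM = {f \<in> extensional M. continuous_map mtopology euclidean f}"
  by (simp add: cont_cstar_def)

lemma CM_restrictI: "continuous_map mtopology euclidean f \<Longrightarrow> restrict f M \<in> carrier CM"
  unfolding carrier_CM by (auto intro: continuous_map_eq)

lemma CM_compose: 
  assumes f: "f \<in> carrier CM" and g: "continuous_on UNIV g" 
  shows "(\<lambda>p\<in>M. g (f p)) \<in> carrier CM"
proof -
  have "continuous_map mtopology euclidean (g \<circ> f)"
    using f g by (intro continuous_map_compose[of _ euclidean]) (auto simp: carrier_CM)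
  then show ?thesis by (intro CM_restrictI) (simp add: o_def)
qed

lemma CM_closed [simp]:
  assumes f: "f \<in> carrier CM" and g: "g \<in> carrier CM"
  shows "(\<lambda>p\<in>M. f p + g p) \<in> carrier CM" "(\<lambda>p\<in>M. f p * g p) \<in> carrier CM"
proof -
  have "continuous_map mtopology euclidean f" "continuous_map mtopology euclidean g"
    using f g by (auto simp: carrier_CM)
  then have "continuous_map mtopology euclidean (\<lambda>p. f p + g p)" "continuous_map mtopology euclidean (\<lambda>p. f p * g p)"
    by (simp_all add: continuous_map_atin tendsto_add tendsto_mult)
  then show "(\<lambda>p\<in>M. f p + g p) \<in> carrier CM" "(\<lambda>p\<in>M. f p * g p) \<in> carrier CM"
    using CM_restrictI by blast+
qed

lemma CM_closed1 [simp]: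
  assumes f: "f \<in> carrier CM" 
  shows "(\<lambda>p\<in>M. z * f p) \<in> carrier CM" "(\<lambda>p\<in>M. cnj (f p)) \<in> carrier CM"
  by (intro CM_compose[OF f] continuous_intros)+

lemma CM_const [simp]: "(\<lambda>p\<in>M. c) \<in> carrier CM"
  by (intro CM_restrictI) simp

lemma CM_state_sum:
  assumes \<mu>: "\<mu> \<in> states CM" and h: "\<And>i. i \<in> S \<Longrightarrow> h i \<in> carrier CM" and S: "finite S"
  shows "(\<lambda>p\<in>M. \<Sum>i\<in>S. c i * h i p) \<in> carrier CM \<and> \<mu> (\<lambda>p\<in>M. \<Sum>i\<in>S. c i * h i p) = (\<Sum>i\<in>S. c i * \<mu> (h i))"
  using S h
proof (induction S rule: finite_induct)
  case empty
  have "\<mu> (0 \<odot>\<^bsub>CM\<^esub> (\<lambda>p\<in>M. 0)) = 0 * \<mu> (\<lambda>p\<in>M. 0)"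
    using \<mu> CM_const[of 0] unfolding states_def by blast
  then show ?case by (simp only: cont_simps sum.empty mult_zero_left CM_const simp_thms)
next
  case (insert i S)
  let ?s = "\<lambda>p\<in>M. \<Sum>i\<in>S. c i * h i p" and ?hi = "c i \<odot>\<^bsub>CM\<^esub> h i"
  have "?s \<in> carrier CM \<and> \<mu> ?s = (\<Sum>i\<in>S. c i * \<mu> (h i))"
    by (rule insert.IH) (rule insert.prems, simp)
  then have s: "?s \<in> carrier CM" "\<mu> ?s = (\<Sum>i\<in>S. c i * \<mu> (h i))" by blast+
  have hi: "?hi \<in> carrier CM" using insert.prems by simp
  have \<mu>hi: "\<mu> ?hi = c i * \<mu> (h i)" using \<mu> insert.prems[of i] unfolding states_def by blast
  have add: "\<mu> (?hi \<oplus>\<^bsub>CM\<^esub> ?s) = \<mu> ?hi + \<mu> ?s" using \<mu> hi s unfolding states_def by blast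
  have eq: "?hi \<oplus>\<^bsub>CM\<^esub> ?s = (\<lambda>p\<in>M. \<Sum>i\<in>insert i S. c i * h i p)"
    using insert.hyps by (auto simp: restrict_def)
  have closed: "?hi \<oplus>\<^bsub>CM\<^esub> ?s \<in> carrier CM"
    using CM_closed(1)[OF hi s(1)] by simp
  have "\<mu> (?hi \<oplus>\<^bsub>CM\<^esub> ?s) = (\<Sum>i\<in>insert i S. c i * \<mu> (h i))"
    unfolding add \<mu>hi s(2) using insert.hyps by (rule sum.insert[symmetric])
  with closed show ?case unfolding eq by (rule conjI)
qed

text \<open>A nonnegative function \<open>f\<close> equals \<open>s* s\<close> for its square root \<open>s\<close>.\<close>

lemma CM_state_nonneg:
  assumes \<mu>: "\<mu> \<in> states CM" and f: "f \<in> carrier CM" and nonneg: "\<And>p. p \<in> M \<Longrightarrow> f p \<in> \<real>\<^sub>\<ge>\<^sub>0"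
  shows "\<mu> f \<in> \<real>\<^sub>\<ge>\<^sub>0"
proof -
  define s where "s = (\<lambda>p\<in>M. complex_of_real (sqrt (Re (f p))))"
  have s: "s \<in> carrier CM"
    unfolding s_def by (rule CM_compose[OF f, of "\<lambda>z. complex_of_real (sqrt (Re z))"]) (intro continuous_intros)
  have "adj CM s \<otimes>\<^bsub>CM\<^esub> s = f"
  proof (rule extensionalityI[of _ M])
    show "f \<in> extensional M" using f by (simp add: carrier_CM)
    fix p assume p: "p \<in> M"
    then obtain q where q: "f p = complex_of_real q" "q \<ge> 0"
      using nonneg by (auto elim: nonneg_Reals_cases)
    show "(adj CM s \<otimes>\<^bsub>CM\<^esub> s) p = f p"
      using p q by (simp add: s_def flip: of_real_mult)
  qed simp
  then show ?thesis using \<mu> s unfolding states_def by fastforce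
qed

text \<open>Positivity applied to \<open>C + g\<close> and \<open>C - g\<close>.\<close>

lemma CM_state_bound:
  assumes \<mu>: "\<mu> \<in> states CM" and g: "g \<in> carrier CM" 
    and real: "\<And>p. p \<in> M \<Longrightarrow> g p \<in> \<real>" and le: "\<And>p. p \<in> M \<Longrightarrow> cmod (g p) \<le> C"
  shows "cmod (\<mu> g) \<le> C"
proof -
  have one: "(\<lambda>p\<in>M. 1) \<in> carrier CM" "\<mu> (\<lambda>p\<in>M. 1) = 1"
    using \<mu> unfolding states_def by auto
  have shift: "complex_of_real C + z * \<mu> g \<in> \<real>\<^sub>\<ge>\<^sub>0" if z: "z = 1 \<or> z = - 1" for z
  proof -
    define F where "F = complex_of_real C \<odot>\<^bsub>CM\<^esub> \<one>\<^bsub>CM\<^esub> \<oplus>\<^bsub>CM\<^esub> z \<odot>\<^bsub>CM\<^esub> g"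
    have 1: "complex_of_real C \<odot>\<^bsub>CM\<^esub> \<one>\<^bsub>CM\<^esub> \<in> carrier CM" "z \<odot>\<^bsub>CM\<^esub> g \<in> carrier CM"
      unfolding cont_simps by (intro CM_closed1 CM_const g)+
    have F: "F \<in> carrier CM" unfolding F_def using CM_closed(1)[OF 1] by simp
    have "\<mu> F = \<mu> (complex_of_real C \<odot>\<^bsub>CM\<^esub> \<one>\<^bsub>CM\<^esub>) + \<mu> (z \<odot>\<^bsub>CM\<^esub> g)"
      using \<mu> 1 unfolding states_def F_def by blast
    also have "\<mu> (complex_of_real C \<odot>\<^bsub>CM\<^esub> \<one>\<^bsub>CM\<^esub>) = complex_of_real C * \<mu> \<one>\<^bsub>CM\<^esub>"
      using \<mu> one(1) unfolding states_def cont_simps(3) by blast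
    also have "\<mu> (z \<odot>\<^bsub>CM\<^esub> g) = z * \<mu> g"
      using \<mu> g unfolding states_def by blast
    finally have "\<mu> F = complex_of_real C + z * \<mu> g" by (simp only: cont_simps one(2) mult_1_right)
    moreover have "\<mu> F \<in> \<real>\<^sub>\<ge>\<^sub>0"
    proof (rule CM_state_nonneg[OF \<mu> F])
      fix p assume p: "p \<in> M"
      then obtain q where q: "g p = complex_of_real q" using real by (auto elim: Reals_cases)
      have "\<bar>q\<bar> \<le> C" using le[OF p] q by simp
      then have "0 \<le> C + q" "0 \<le> C - q" by linarith+
      then show "F p \<in> \<real>\<^sub>\<ge>\<^sub>0"
        using z p q by (auto simp: F_def simp flip: of_real_add of_real_diff)
    qed
    ultimately show ?thesis by simp
  qed
  have "complex_of_real C + \<mu> g \<in> \<real>\<^sub>\<ge>\<^sub>0" "complex_of_real C - \<mu> g \<in> \<real>\<^sub>\<ge>\<^sub>0"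
    using shift[of 1] shift[of "- 1"] by simp_all
  then have "Im (\<mu> g) = 0" "\<bar>Re (\<mu> g)\<bar> \<le> C"
    by (auto simp: complex_nonneg_Reals_iff)
  then show ?thesis by (simp add: cmod_eq_Re)
qed

lemma CM_lip_ballD:
  assumes f: "f \<in> lip_ball CM (Lip M d)"
  shows "f \<in> carrier CM" "\<And>p. p \<in> M \<Longrightarrow> f p \<in> \<real>"
    "\<And>p q. p \<in> M \<Longrightarrow> q \<in> M \<Longrightarrow> cmod (f p - f q) \<le> d p q"
proof -
  show c: "f \<in> carrier CM" using f by (simp add: lip_ball_def self_adjoint_def)
  have adj: "(\<lambda>p\<in>M. cnj (f p)) = f" using f by (simp add: lip_ball_def self_adjoint_def)
  show "f p \<in> \<real>" if "p \<in> M" for p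
    using fun_cong[OF adj, of p] that by (simp add: Reals_cnj_iff)
  show "cmod (f p - f q) \<le> d p q" if "p \<in> M" "q \<in> M" for p q
  proof (cases "p = q")
    case False
    have "ennreal (cmod (f p - f q) / d p q) \<le> Lip M d f"
      unfolding Lip_def by (rule SUP_upper2[of "(p, q)"]) (use False that in auto)
    also have "\<dots> \<le> 1" using f by (simp add: lip_ball_def)
    finally have "cmod (f p - f q) / d p q \<le> 1" by simp
    moreover have "0 < d p q" using False that by (simp add: mdist_pos_less)
    ultimately show ?thesis by simp
  qed (use that in simp)
qed

lemma CM_lip_ballI:
  fixes f :: "'a \<Rightarrow> real"
  assumes lip: "\<And>p q. p \<in> M \<Longrightarrow> q \<in> M \<Longrightarrow> \<bar>f p - f q\<bar> \<le> d p q"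
  shows "(\<lambda>p\<in>M. complex_of_real (f p)) \<in> lip_ball CM (Lip M d)"
proof -
  have "dist (complex_of_real (f p)) (complex_of_real (f q)) \<le> d p q" if "p \<in> M" "q \<in> M" for p q
    using lip[OF that] by (simp add: dist_norm flip: of_real_diff)
  then have "(\<lambda>p\<in>M. complex_of_real (f p)) \<in> carrier CM"
    by (intro CM_restrictI nonexpansive_continuous_map)
  moreover have "Lip M d (\<lambda>p\<in>M. complex_of_real (f p)) \<le> 1"
    unfolding Lip_def
  proof (rule SUP_least, clarify)
    fix p q assume pq: "p \<in> M" "q \<in> M" "p \<noteq> q"
    then have "0 < d p q" by (simp add: mdist_pos_less)
    then show "ennreal (cmod ((\<lambda>p\<in>M. complex_of_real (f p)) p - (\<lambda>p\<in>M. complex_of_real (f p)) q) / d p q) \<le> 1"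
      using pq lip[of p q] by (simp add: divide_le_eq flip: of_real_diff)
  qed
  ultimately show ?thesis by (auto simp: lip_ball_def self_adjoint_def)
qed

text \<open>The function \<open>p \<mapsto> min\<^sub>i (g i + d (x i) p)\<close>.\<close>

lemma mcshane_extension:
  fixes g :: "nat \<Rightarrow> real"
  assumes k: "1 \<le> k" and x: "\<And>i. i < k \<Longrightarrow> x i \<in> M"
    and g: "\<And>i j. i < k \<Longrightarrow> j < k \<Longrightarrow> \<bar>g i - g j\<bar> \<le> d (x i) (x j)"
  shows "\<exists>f. (\<forall>p\<in>M. \<forall>q\<in>M. \<bar>f p - f q\<bar> \<le> d p q) \<and> (\<forall>i<k. f (x i) = g i)"
proof -
  let ?f = "\<lambda>p. Min ((\<lambda>i. g i + d (x i) p) ` {..<k})"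
  have fin: "finite ((\<lambda>i. g i + d (x i) p) ` {..<k})" and ne: "(\<lambda>i. g i + d (x i) p) ` {..<k} \<noteq> {}" for p
    using k by (auto simp: lessThan_empty_iff)
  have le: "?f p \<le> ?f q + d p q" if p: "p \<in> M" and q: "q \<in> M" for p q
  proof -
    obtain i where i: "i < k" "?f q = g i + d (x i) q" using Min_in[OF fin ne, of q] by auto
    have "?f p \<le> g i + d (x i) p" using i by (intro Min_le[OF fin]) auto
    also have "\<dots> \<le> g i + (d (x i) q + d q p)" using triangle[OF x[OF i(1)] q p] by simp
    finally show ?thesis using i(2) by (simp add: commute)
  qed
  have "\<bar>?f p - ?f q\<bar> \<le> d p q" if p: "p \<in> M" and q: "q \<in> M" for p q
    using le[OF p q] le[OF q p] commute[of p q] by linarith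
  moreover have "?f (x i) = g i" if i: "i < k" for i
  proof (rule Min_eqI[OF fin])
    show "g i \<in> (\<lambda>j. g j + d (x j) (x i)) ` {..<k}"
      using i x by (intro image_eqI[of _ _ i]) auto
    fix y assume "y \<in> (\<lambda>j. g j + d (x j) (x i)) ` {..<k}"
    then obtain j where "j < k" "y = g j + d (x j) (x i)" by auto
    then show "g i \<le> y" using g[OF i, of j] commute[of "x i" "x j"] by linarith
  qed
  ultimately show ?thesis by (intro exI[of _ ?f]) simp
qed

lemma compact_imp_bounded_CM:
  assumes "compact_space mtopology" and f: "f \<in> carrier CM"
  shows "\<exists>C. \<forall>p\<in>M. cmod (f p) \<le> C"
proof -
  have "compactin euclidean (f ` M)"
    using assms image_compactin[of mtopology M euclidean f] by (simp add: carrier_CM compact_space_def)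
  then have "bounded (f ` M)" by (simp add: compact_imp_bounded)
  then show ?thesis by (auto simp: bounded_iff)
qed

text \<open>The union of finite \<open>1/n\<close>-nets is countable and dense.\<close>

lemma compact_imp_dense_sequence:
  assumes "compact_space mtopology" and "M \<noteq> {}"
  shows "\<exists>z. (\<forall>j::nat. z j \<in> M) \<and> (\<forall>p\<in>M. \<forall>s>0. \<exists>j. d p (z j) < s)"
proof -
  have "\<forall>n::nat. \<exists>K. finite K \<and> K \<subseteq> M \<and> M \<subseteq> (\<Union>x\<in>K. mball x (inverse (real (Suc n))))"
    using assms unfolding compact_space_eq_mcomplete_mtotally_bounded mtotally_bounded_def by simp
  then obtain K where K: "\<And>n. finite (K n)" "\<And>n. K n \<subseteq> M" "\<And>n. M \<subseteq> (\<Union>x\<in>K n. mball x (inverse (real (Suc n))))"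
    by metis
  define U where "U = (\<Union>n. K n)"
  have "countable U" unfolding U_def using K(1) by (auto intro: countable_finite)
  have "U \<noteq> {}" using K(3) \<open>M \<noteq> {}\<close> by (fastforce simp: U_def)
  show ?thesis
  proof (intro exI[of _ "from_nat_into U"] conjI allI ballI impI)
    show "from_nat_into U j \<in> M" for j
      using from_nat_into[OF \<open>U \<noteq> {}\<close>, of j] K(2) by (auto simp: U_def)
    fix p and s :: real assume p: "p \<in> M" and "s > 0"
    obtain n where n: "inverse (real (Suc n)) < s" using reals_Archimedean[OF \<open>s > 0\<close>] by blast
    obtain c where c: "c \<in> K n" "p \<in> mball c (inverse (real (Suc n)))" using K(3) p by blast
    have "c \<in> U" using c by (auto simp: U_def)
    then obtain j where "c = from_nat_into U j"
      using \<open>countable U\<close> by (metis from_nat_into_surj)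
    then show "\<exists>j. d p (from_nat_into U j) < s"
      using c(2) n commute[of p c] by (intro exI[of _ j]) auto
  qed
qed

lemma CM_eq_on_dense:
  assumes f: "f \<in> carrier CM" and g: "g \<in> carrier CM"
    and z: "\<And>p s. p \<in> M \<Longrightarrow> s > 0 \<Longrightarrow> \<exists>j::nat. d p (z j) < s" and zM: "\<And>j. z j \<in> M"
    and eq: "\<And>j. f (z j) = g (z j)"
  shows "f = g"
proof (rule extensionalityI[of _ M])
  show "f \<in> extensional M" "g \<in> extensional M" using f g by (auto simp: carrier_CM)
  fix p assume p: "p \<in> M"
  have "continuous_map mtopology Met_TC.mtopology (\<lambda>p. f p - g p)"
    using f g by (auto simp: carrier_CM intro!: continuous_map_diff)
  then have *: "\<exists>s>0. \<forall>q. q \<in> M \<and> d p q < s \<longrightarrow> dist (f p - g p) (f q - g q) < e" if "e > 0" for e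
    unfolding metric_continuous_map[OF Met_TC.Metric_space_axioms] using p that by blast
  show "f p = g p"
  proof (rule ccontr)
    assume "f p \<noteq> g p"
    then have "cmod (f p - g p) > 0" by simp
    from *[OF this] obtain s where s: "s > 0" 
      "\<And>q. q \<in> M \<Longrightarrow> d p q < s \<Longrightarrow> dist (f p - g p) (f q - g q) < cmod (f p - g p)" by blast
    obtain j where "d p (z j) < s" using z[OF p s(1)] by blast
    from s(2)[OF zM this] eq[of j] show False by (simp add: dist_norm)
  qed
qed

end

section \<open>The bridge between matrices and functions\<close>

text \<open>The points \<open>x i\<close> form an \<open>\<epsilon>\<close>-net of a compact space and the sequence \<open>z\<close> is dense.  The separation of
the net and the choice of \<open>r\<close> are governed by the assumptions of \<open>matrix_net\<close>.\<close>

locale metric_net = Metric_space X d + matrix_net k "\<lambda>i j. d (x i) (x j)" r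
  for X :: "'x set" and d :: "'x \<Rightarrow> 'x \<Rightarrow> real" and k :: nat and x :: "nat \<Rightarrow> 'x" and r :: real +
  fixes \<epsilon> :: real and z :: "nat \<Rightarrow> 'x"
  assumes compact: "compact_space mtopology"
    and x: "\<And>i. i < k \<Longrightarrow> x i \<in> X"
    and net: "\<And>p. p \<in> X \<Longrightarrow> \<exists>i<k. d (x i) p < \<epsilon>"
    and r_le: "r \<le> \<epsilon>"
    and z: "\<And>j. z j \<in> X"
    and dense: "\<And>p s. p \<in> X \<Longrightarrow> s > 0 \<Longrightarrow> \<exists>j. d p (z j) < s"
begin

text \<open>For each \<open>j\<close>, the points \<open>near_pt i j\<close> are a perturbation of the net by at most \<open>\<epsilon>\<close>, and they
include \<open>z j\<close> because some \<open>x i\<close> is close to it.\<close>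

definition near_pt :: "nat \<Rightarrow> nat \<Rightarrow> 'x" where
  "near_pt i j = (if d (x i) (z j) < \<epsilon> then z j else x i)"

lemma near_pt: "i < k \<Longrightarrow> near_pt i j \<in> X"
  using x z by (simp add: near_pt_def)

lemma dist_near_pt: "i < k \<Longrightarrow> d (x i) (near_pt i j) \<le> \<epsilon>"
  using x r r_le by (simp add: near_pt_def)

sublocale S: coded_sequences "matrix_cstar k" encode_seq
  by unfold_locales (rule inj_on_encode_seq)

definition diag_at :: "('x \<Rightarrow> complex) \<Rightarrow> nat \<Rightarrow> complex mat" where
  "diag_at f j = diagonal k (\<lambda>i. f (near_pt i j))"

lemma diag_at_closed [simp]: "diag_at f j \<in> carrier_mat k k"
  by (simp add: diag_at_def)

definition \<pi>\<^sub>A :: "complex mat \<Rightarrow> universe" where "\<pi>\<^sub>A a = encode_seq (\<lambda>j. a)"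
definition \<pi>\<^sub>B :: "('x \<Rightarrow> complex) \<Rightarrow> universe" where "\<pi>\<^sub>B f = encode_seq (diag_at f)"

lemma diag_at_bounded: 
  assumes f: "f \<in> carrier CM"
  shows "diag_at f \<in> bounded_seqs A"
proof -
  obtain C where C: "\<And>p. p \<in> X \<Longrightarrow> cmod (f p) \<le> C"
    using compact_imp_bounded_CM[OF compact f] by blast
  have "0 \<le> C" using C[OF z[of 0]] by (meson norm_ge_zero order_trans)
  then show ?thesis
    by (intro S.bounded_seqsI[of _ C]) (auto simp: diag_at_def intro!: nrm_diagonal_le C near_pt)
qed

lemma unital_star_mono_A: "unital_star_mono A S.D \<pi>\<^sub>A"
  unfolding \<pi>\<^sub>A_def by (rule S.unital_star_mono_const)

text \<open>Injectivity: every point \<open>z j\<close> occurs among the \<open>near_pt i j\<close>, so equality of the images of two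
continuous functions forces their equality on a dense set.\<close>

lemma unital_star_mono_B: "unital_star_mono CM S.D \<pi>\<^sub>B"
  unfolding unital_star_mono_def
proof (intro conjI ballI allI ring_hom_memI inj_onI)
  fix f assume f: "f \<in> carrier CM"
  note bf = diag_at_bounded[OF f]
  show "\<pi>\<^sub>B f \<in> carrier S.D" unfolding \<pi>\<^sub>B_def by (rule S.enc_closed[OF bf])
  have "diag_at (adj CM f) = (\<lambda>j. adj A (diag_at f j))"
    by (rule ext) (auto simp: diag_at_def diagonal_adjoint near_pt intro!: eq_matI)
  then show "\<pi>\<^sub>B (adj CM f) = adj S.D (\<pi>\<^sub>B f)"
    unfolding \<pi>\<^sub>B_def S.D_simps(4)[OF bf] by simp
  show "\<pi>\<^sub>B (c \<odot>\<^bsub>CM\<^esub> f) = c \<odot>\<^bsub>S.D\<^esub> \<pi>\<^sub>B f" for c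
  proof -
    have "diag_at (c \<odot>\<^bsub>CM\<^esub> f) = (\<lambda>j. c \<odot>\<^bsub>A\<^esub> diag_at f j)"
      by (rule ext) (auto simp: diag_at_def near_pt intro!: eq_matI)
    then show ?thesis unfolding \<pi>\<^sub>B_def S.D_simps(3)[OF bf] by simp
  qed
  fix g assume g: "g \<in> carrier CM"
  note bg = diag_at_bounded[OF g]
  have "diag_at (f \<otimes>\<^bsub>CM\<^esub> g) = (\<lambda>j. diag_at f j \<otimes>\<^bsub>A\<^esub> diag_at g j)"
    by (rule ext) (auto simp: diag_at_def diagonal_mult near_pt intro!: eq_matI)
  then show "\<pi>\<^sub>B (f \<otimes>\<^bsub>CM\<^esub> g) = \<pi>\<^sub>B f \<otimes>\<^bsub>S.D\<^esub> \<pi>\<^sub>B g"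
    unfolding \<pi>\<^sub>B_def S.D_simps(1)[OF bf bg] by simp
  have "diag_at (f \<oplus>\<^bsub>CM\<^esub> g) = (\<lambda>j. diag_at f j \<oplus>\<^bsub>A\<^esub> diag_at g j)"
    by (rule ext) (auto simp: diag_at_def near_pt intro!: eq_matI)
  then show "\<pi>\<^sub>B (f \<oplus>\<^bsub>CM\<^esub> g) = \<pi>\<^sub>B f \<oplus>\<^bsub>S.D\<^esub> \<pi>\<^sub>B g"
    unfolding \<pi>\<^sub>B_def S.D_simps(2)[OF bf bg] by simp
  assume eq: "\<pi>\<^sub>B f = \<pi>\<^sub>B g"
  have "diag_at f = diag_at g"
    using inj_onD[OF S.inj eq[unfolded \<pi>\<^sub>B_def] bf bg] .
  have "f (z j) = g (z j)" for j
  proof -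
    obtain i where i: "i < k" "d (x i) (z j) < \<epsilon>" using net[OF z] by blast
    have "diag_at f j $$ (i, i) = diag_at g j $$ (i, i)" using \<open>diag_at f = diag_at g\<close> by simp
    then show ?thesis using i by (simp add: diag_at_def near_pt_def)
  qed
  then show "f = g" using CM_eq_on_dense[OF f g, of z] dense z by blast
next
  have "diag_at \<one>\<^bsub>CM\<^esub> = (\<lambda>j. \<one>\<^bsub>A\<^esub>)"
    by (rule ext) (auto simp: diag_at_def near_pt intro!: eq_matI)
  then show "\<pi>\<^sub>B \<one>\<^bsub>CM\<^esub> = \<one>\<^bsub>S.D\<^esub>" unfolding \<pi>\<^sub>B_def S.D_simps(6) by simp
qed

lemma nrm_bridge_le:
  assumes a: "a \<in> carrier_mat k k" and f: "f \<in> carrier CM"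
    and le: "\<And>j. nrm A (a - diag_at f j) \<le> c"
  shows "nrm S.D (\<pi>\<^sub>A a \<otimes>\<^bsub>S.D\<^esub> \<one>\<^bsub>S.D\<^esub> \<ominus>\<^bsub>S.D\<^esub> \<one>\<^bsub>S.D\<^esub> \<otimes>\<^bsub>S.D\<^esub> \<pi>\<^sub>B f) \<le> c"
proof -
  interpret D: unital_cstar_algebra S.D by (rule S.unital_cstar_algebra_D)
  have ac: "a \<in> carrier A" using a by simp
  note ba = S.bounded_seqs_const[OF ac] and bf = diag_at_bounded[OF f]
  have eq: "\<pi>\<^sub>A a \<otimes>\<^bsub>S.D\<^esub> \<one>\<^bsub>S.D\<^esub> \<ominus>\<^bsub>S.D\<^esub> \<one>\<^bsub>S.D\<^esub> \<otimes>\<^bsub>S.D\<^esub> \<pi>\<^sub>B f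
      = encode_seq (\<lambda>j. a \<ominus>\<^bsub>A\<^esub> diag_at f j)"
    unfolding \<pi>\<^sub>A_def \<pi>\<^sub>B_def D.r_one[OF S.enc_closed[OF ba]] D.l_one[OF S.enc_closed[OF bf]]
    by (rule S.D_minus[OF ba bf])
  show ?thesis
    unfolding eq S.D_simps(5)[OF S.bounded_seqs_minus[OF ba bf]]
    by (rule cSUP_least) (use le a in simp_all)
qed

lemma nrm_diag_close:
  assumes f: "\<And>p q. p \<in> X \<Longrightarrow> q \<in> X \<Longrightarrow> cmod (f p - f q) \<le> d p q"
    and a: "\<And>i. i < k \<Longrightarrow> a i = f (x i)"
  shows "nrm A (diagonal k a - diag_at f j) \<le> \<epsilon>"
proof -
  have "diagonal k a - diag_at f j = diagonal k (\<lambda>i. f (x i) - f (near_pt i j))"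
    by (intro eq_matI) (auto simp: diag_at_def a)
  moreover have "cmod (f (x i) - f (near_pt i j)) \<le> \<epsilon>" if "i < k" for i
    using f[OF x[OF that] near_pt[OF that]] dist_near_pt[OF that] order_trans by blast
  ultimately show ?thesis using r r_le by (simp add: nrm_diagonal_le)
qed

text \<open>The diagonal of \<open>a\<close> is real and 1-Lipschitz on the net, so it extends to a 1-Lipschitz function
on \<open>X\<close>.  One \<open>\<epsilon>\<close> pays for the off-diagonal part, the other for the distance of \<open>near_pt i j\<close> from \<open>x i\<close>.\<close>

lemma reach_from_matrix:
  assumes "a \<in> lip_ball A L"
  shows "\<exists>f\<in>lip_ball CM (Lip X d). \<forall>j. nrm A (a - diag_at f j) \<le> 2 * \<epsilon>"
proof -
  have sa: "a \<in> self_adjoint A" and l1: "net_lip a \<le> 1" using assms by (auto simp: lip_ball_eq)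
  note a = self_adjointD[OF sa]
  define g where "g i = Re (a $$ (i, i))" for i
  have g: "a $$ (i, i) = complex_of_real (g i)" if "i < k" for i
  proof -
    have "mat_adjoint a = a" using sa by (simp add: self_adjoint_def)
    then have "cnj (a $$ (i, i)) = a $$ (i, i)" using mat_adjoint_index[OF a that that] by simp
    then show ?thesis by (metis Reals_cnj_iff g_def of_real_Re)
  qed
  have g_lip: "\<bar>g i - g j\<bar> \<le> d (x i) (x j)" if "i < k" "j < k" for i j
  proof (cases "i = j")
    case False
    have "\<bar>g i - g j\<bar> = cmod (a $$ (i, i) - a $$ (j, j))"
      using that by (simp add: g flip: of_real_diff)
    also have "\<dots> \<le> net_lip a * d (x i) (x j)" by (rule diag_diff_le_net_lip[OF a that False])
    also have "\<dots> \<le> d (x i) (x j)" using l1 by (simp add: mult_left_le_one_le net_lip_nonneg[OF a])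
    finally show ?thesis .
  qed simp
  have "\<exists>f0. (\<forall>p\<in>X. \<forall>q\<in>X. \<bar>f0 p - f0 q\<bar> \<le> d p q) \<and> (\<forall>i<k. f0 (x i) = g i)"
    by (rule mcshane_extension[OF k x g_lip])
  then obtain f0 where f0: "\<And>p q. p \<in> X \<Longrightarrow> q \<in> X \<Longrightarrow> \<bar>f0 p - f0 q\<bar> \<le> d p q" "\<And>i. i < k \<Longrightarrow> f0 (x i) = g i"
    by blast
  define f where "f = (\<lambda>p\<in>X. complex_of_real (f0 p))"
  have f: "f \<in> lip_ball CM (Lip X d)" unfolding f_def by (rule CM_lip_ballI[OF f0(1)])
  have "nrm A (a - diag_at f j) \<le> 2 * \<epsilon>" for j
  proof -
    have "a - diag_at f j = offdiag_part k a + (diag_part k a - diag_at f j)"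
      using a by (intro eq_matI) (auto simp: offdiag_part_def diag_at_def)
    then have "nrm A (a - diag_at f j) \<le> nrm A (offdiag_part k a) + nrm A (diag_part k a - diag_at f j)"
      using nrm_matrix_add_le[OF offdiag_part_closed[OF a] minus_carrier_mat[OF diag_at_closed], of "diag_part k a" f j]
      by simp
    moreover have "nrm A (offdiag_part k a) \<le> net_lip a * r" by (rule offdiag_le_net_lip[OF a])
    moreover have "net_lip a * r \<le> 1 * r" using l1 r by (intro mult_right_mono) auto
    moreover have "nrm A (diag_part k a - diag_at f j) \<le> \<epsilon>"
      unfolding diag_part_def
      by (rule nrm_diag_close) (use CM_lip_ballD(3)[OF f] f0(2) g x in \<open>auto simp: f_def\<close>)
    ultimately show ?thesis using r_le by linarith
  qed
  then show ?thesis using f by blast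
qed

lemma reach_from_function:
  assumes f: "f \<in> lip_ball CM (Lip X d)"
  shows "\<exists>a\<in>lip_ball A L. \<forall>j. nrm A (a - diag_at f j) \<le> \<epsilon>"
proof -
  define a where "a = diagonal k (\<lambda>i. f (x i))"
  have a: "a \<in> carrier_mat k k" by (simp add: a_def)
  have "cnj (f (x i)) = f (x i)" if "i < k" for i
    using CM_lip_ballD(2)[OF f x[OF that]] by (simp add: Reals_cnj_iff)
  then have "mat_adjoint a = a"
    unfolding a_def diagonal_adjoint by (intro eq_matI) auto
  moreover have "net_lip a \<le> 1"
    unfolding net_lip_le_iff[OF a]
  proof (intro conjI allI impI)
    fix i j assume "i < k" "j < k" "i \<noteq> j"
    then show "cmod (a $$ (i, i) - a $$ (j, j)) \<le> 1 * d (x i) (x j)"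
      using CM_lip_ballD(3)[OF f x x] by (simp add: a_def)
  next
    have "offdiag_part k a = 0\<^sub>m k k" by (intro eq_matI) (auto simp: a_def)
    then show "nrm A (offdiag_part k a) \<le> 1 * r" using r nrm_matrix_eq_0[of "0\<^sub>m k k" k] by simp
  qed
  ultimately have "a \<in> lip_ball A L" using a by (simp add: lip_ball_eq self_adjoint_def)
  moreover have "nrm A (a - diag_at f j) \<le> \<epsilon>" for j
    unfolding a_def by (rule nrm_diag_close) (use CM_lip_ballD(3)[OF f] in auto)
  ultimately show ?thesis by blast
qed

lemma reach_le: "bridge_reach A L CM (Lip X d) S.D \<pi>\<^sub>A \<pi>\<^sub>B \<one>\<^bsub>S.D\<^esub> \<le> ennreal (2 * \<epsilon>)"
  unfolding bridge_reach_def
proof (rule hausdorff_le)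
  fix s assume "s \<in> \<pi>\<^sub>A ` lip_ball A L"
  then obtain a where a: "a \<in> lip_ball A L" "s = \<pi>\<^sub>A a" by blast
  obtain f where f: "f \<in> lip_ball CM (Lip X d)" "\<And>j. nrm A (a - diag_at f j) \<le> 2 * \<epsilon>"
    using reach_from_matrix[OF a(1)] by blast
  have ac: "a \<in> carrier_mat k k" using a(1) by (simp add: lip_ball_eq self_adjointD)
  show "\<exists>t\<in>\<pi>\<^sub>B ` lip_ball CM (Lip X d).
      ennreal (nrm S.D (s \<otimes>\<^bsub>S.D\<^esub> \<one>\<^bsub>S.D\<^esub> \<ominus>\<^bsub>S.D\<^esub> \<one>\<^bsub>S.D\<^esub> \<otimes>\<^bsub>S.D\<^esub> t)) \<le> ennreal (2 * \<epsilon>)"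
    unfolding a(2)
    by (rule bexI[OF _ imageI[OF f(1)]]) (intro ennreal_leI nrm_bridge_le ac CM_lip_ballD(1) f)
next
  fix t assume "t \<in> \<pi>\<^sub>B ` lip_ball CM (Lip X d)"
  then obtain f where f: "f \<in> lip_ball CM (Lip X d)" "t = \<pi>\<^sub>B f" by blast
  obtain a where a: "a \<in> lip_ball A L" "\<And>j. nrm A (a - diag_at f j) \<le> \<epsilon>"
    using reach_from_function[OF f(1)] by blast
  have ac: "a \<in> carrier_mat k k" using a(1) by (simp add: lip_ball_eq self_adjointD)
  have "\<epsilon> \<le> 2 * \<epsilon>" using r r_le by linarith
  then show "\<exists>s\<in>\<pi>\<^sub>A ` lip_ball A L.
      ennreal (nrm S.D (s \<otimes>\<^bsub>S.D\<^esub> \<one>\<^bsub>S.D\<^esub> \<ominus>\<^bsub>S.D\<^esub> \<one>\<^bsub>S.D\<^esub> \<otimes>\<^bsub>S.D\<^esub> t)) \<le> ennreal (2 * \<epsilon>)"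
    unfolding f(2)
    by (intro bexI[OF _ imageI[OF a(1)]] ennreal_leI nrm_bridge_le ac CM_lip_ballD(1)[OF f(1)] order_trans[OF a(2)])
qed

lemma level_states_eq: "level_states S.D \<one>\<^bsub>S.D\<^esub> = states S.D"
  by (rule level_states_one[OF S.unital_cstar_algebra_D])

text \<open>A state of the matrix algebra is the restriction of its extension through an index of the
sequence, so the two sets of states coincide.\<close>

lemma side_height_A: "side_height A L S.D \<pi>\<^sub>A \<one>\<^bsub>S.D\<^esub> \<le> c"
  unfolding side_height_def level_states_eq
proof (rule hausdorff_le)
  fix \<phi> assume \<phi>: "\<phi> \<in> states A"
  let ?\<psi> = "restrict (\<lambda>p. \<phi> (S.dec p 0)) (carrier S.D)"
  have eq: "restrict (?\<psi> \<circ> \<pi>\<^sub>A) (carrier A) = \<phi>"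
  proof (rule extensionalityI[of _ "carrier A"])
    show "\<phi> \<in> extensional (carrier A)" using \<phi> unfolding states_def by blast
    fix a assume a: "a \<in> carrier A"
    note ba = S.bounded_seqs_const[OF a]
    show "restrict (?\<psi> \<circ> \<pi>\<^sub>A) (carrier A) a = \<phi> a"
      using a S.enc_closed[OF ba] S.dec_enc[OF ba] by (simp add: \<pi>\<^sub>A_def)
  qed simp
  have "\<phi> \<in> (\<lambda>\<phi>. restrict (\<phi> \<circ> \<pi>\<^sub>A) (carrier A)) ` states S.D"
    by (rule image_eqI) (rule eq[symmetric], rule S.state_at_index[OF \<phi>])
  then show "\<exists>\<psi>\<in>(\<lambda>\<phi>. restrict (\<phi> \<circ> \<pi>\<^sub>A) (carrier A)) ` states S.D. mk A L \<phi> \<psi> \<le> c"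
    using mk_self by blast
next
  fix \<psi> assume "\<psi> \<in> (\<lambda>\<phi>. restrict (\<phi> \<circ> \<pi>\<^sub>A) (carrier A)) ` states S.D"
  then obtain \<phi> where \<phi>: "\<phi> \<in> states S.D" "\<psi> = restrict (\<phi> \<circ> \<pi>\<^sub>A) (carrier A)" by blast
  have "\<psi> \<in> states A"
    unfolding \<phi>(2) by (rule restrict_state[OF unital_star_mono_A \<phi>(1) A.one_closed A.a_closed A.m_closed
      A.smult_closed A.adj_closed])
  then show "\<exists>\<phi>\<in>states A. mk A L \<phi> \<psi> \<le> c"
    using mk_self by blast
qed

text \<open>Normalized tent functions \<open>max 0 (\<epsilon> - d (x i) p)\<close>; their sum is positive because the \<open>x i\<close> form an
\<open>\<epsilon>\<close>-net.\<close>

lemma partition_of_unity: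
  "\<exists>h. (\<forall>i<k. \<forall>p\<in>X. 0 \<le> h i p \<and> (\<epsilon> \<le> d (x i) p \<longrightarrow> h i p = 0)) \<and> (\<forall>p\<in>X. (\<Sum>i<k. h i p) = 1) \<and>
       (\<forall>i<k. (\<lambda>p\<in>X. complex_of_real (h i p)) \<in> carrier CM)"
proof -
  define t where "t i p = max 0 (\<epsilon> - d (x i) p)" for i p
  define T where "T p = (\<Sum>i<k. t i p)" for p
  have t: "0 \<le> t i p" for i p by (simp add: t_def)
  have T: "0 < T p" if p: "p \<in> X" for p
  proof -
    obtain i where i: "i < k" "d (x i) p < \<epsilon>" using net[OF p] by blast
    have "0 < t i p" using i by (simp add: t_def)
    also have "t i p \<le> T p" unfolding T_def using i t by (intro member_le_sum) auto
    finally show ?thesis .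
  qed
  have tc: "continuous_map mtopology euclideanreal (t i)" if i: "i < k" for i
  proof -
    have "\<bar>d (x i) p - d (x i) q\<bar> \<le> d p q" if "p \<in> X" "q \<in> X" for p q
      using triangle[OF x[OF i] that(1) that(2)] triangle[OF x[OF i] that(2) that(1)] commute[of p q] by linarith
    then have "continuous_map mtopology euclideanreal (d (x i))"
      by (intro nonexpansive_continuous_map) (simp add: dist_real_def)
    then show ?thesis unfolding t_def by (intro continuous_intros) auto
  qed
  have Tc: "continuous_map mtopology euclideanreal T"
    unfolding T_def by (intro continuous_map_sum) (auto intro: tc)
  have hc: "continuous_map mtopology euclideanreal (\<lambda>p. t i p / T p)" if "i < k" for i
    by (intro continuous_map_real_divide tc that Tc) (use T in fastforce)
  have "(\<lambda>p\<in>X. complex_of_real (t i p / T p)) \<in> carrier CM" if "i < k" for i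
  proof (rule CM_restrictI)
    have "continuous_map mtopology euclidean (complex_of_real \<circ> (\<lambda>p. t i p / T p))"
      by (rule continuous_map_compose[OF hc[OF that]]) (simp add: continuous_intros)
    then show "continuous_map mtopology euclidean (\<lambda>p. complex_of_real (t i p / T p))"
      by (simp add: o_def)
  qed
  moreover have "(\<Sum>i<k. t i p / T p) = 1" if "p \<in> X" for p
    using T[OF that] by (simp add: T_def flip: sum_divide_distrib)
  moreover have "0 \<le> t i p / T p \<and> (\<epsilon> \<le> d (x i) p \<longrightarrow> t i p / T p = 0)" if "p \<in> X" for i p
    using T[OF that] t[of i p] by (simp add: t_def)
  ultimately show ?thesis by (intro exI[of _ "\<lambda>i p. t i p / T p"]) blast
qed

text \<open>The weights are the values of \<open>\<mu>\<close> at a partition of unity \<open>h\<close> subordinate to the \<open>\<epsilon>\<close>-balls around the net.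
Where \<open>h i\<close> is nonzero, \<open>f\<close> differs from \<open>f (near_pt i 0)\<close> by at most \<open>2 \<epsilon>\<close>, hence so does \<open>f\<close> from
\<open>\<Sum>i. f (near_pt i 0) h i\<close> everywhere.\<close>

lemma state_close_to_diagonal:
  assumes \<mu>: "\<mu> \<in> states CM"
  shows "\<exists>w. (\<forall>i<k. 0 \<le> w i) \<and> (\<Sum>i<k. w i) = 1 \<and>
      (\<forall>f\<in>lip_ball CM (Lip X d). cmod (\<mu> f - (\<Sum>i<k. complex_of_real (w i) * f (near_pt i 0))) \<le> 2 * \<epsilon>)"
proof -
  obtain h where h: "\<And>i p. i < k \<Longrightarrow> p \<in> X \<Longrightarrow> 0 \<le> h i p" 
    and h0: "\<And>i p. i < k \<Longrightarrow> p \<in> X \<Longrightarrow> \<epsilon> \<le> d (x i) p \<Longrightarrow> h i p = 0"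
    and h1: "\<And>p. p \<in> X \<Longrightarrow> (\<Sum>i<k. h i p) = 1"
    and hc: "\<And>i. i < k \<Longrightarrow> (\<lambda>p\<in>X. complex_of_real (h i p)) \<in> carrier CM"
    using partition_of_unity by blast
  define H where "H i = (\<lambda>p\<in>X. complex_of_real (h i p))" for i
  have Hc: "H i \<in> carrier CM" if "i < k" for i using hc[OF that] by (simp add: H_def)
  have "\<mu> (H i) \<in> \<real>\<^sub>\<ge>\<^sub>0" if "i < k" for i
    by (rule CM_state_nonneg[OF \<mu> Hc[OF that]]) (simp add: H_def h[OF that])
  then have "\<forall>i\<in>{..<k}. \<exists>w. \<mu> (H i) = complex_of_real w \<and> 0 \<le> w"
    by (metis lessThan_iff nonneg_Reals_cases)
  then obtain w where w: "\<And>i. i < k \<Longrightarrow> \<mu> (H i) = complex_of_real (w i)" "\<And>i. i < k \<Longrightarrow> 0 \<le> w i"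
    by (metis lessThan_iff)
  have sums: "(\<lambda>p\<in>X. \<Sum>i<k. c i * H i p) \<in> carrier CM" 
     "\<mu> (\<lambda>p\<in>X. \<Sum>i<k. c i * H i p) = (\<Sum>i<k. c i * complex_of_real (w i))" for c
    using CM_state_sum[OF \<mu>, of "{..<k}" H c] Hc w by auto
  have "(\<lambda>p\<in>X. \<Sum>i<k. 1 * H i p) = \<one>\<^bsub>CM\<^esub>"
    unfolding cont_simps by (rule restrict_ext) (simp add: H_def h1 flip: of_real_sum)
  moreover have "\<mu> \<one>\<^bsub>CM\<^esub> = 1" using \<mu> unfolding states_def by blast
  ultimately have "complex_of_real (\<Sum>i<k. w i) = 1"
    using sums(2)[of "\<lambda>_. 1"] by simp
  then have w1: "(\<Sum>i<k. w i) = 1" by (simp only: of_real_eq_1_iff)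
  have "cmod (\<mu> f - (\<Sum>i<k. complex_of_real (w i) * f (near_pt i 0))) \<le> 2 * \<epsilon>"
    if f: "f \<in> lip_ball CM (Lip X d)" for f
  proof -
    note fc = CM_lip_ballD(1)[OF f] and fr = CM_lip_ballD(2)[OF f] and fl = CM_lip_ballD(3)[OF f]
    define F where "F = (\<lambda>p\<in>X. \<Sum>i<k. - f (near_pt i 0) * H i p)"
    have F: "F \<in> carrier CM" unfolding F_def by (rule sums(1))
    \<comment> \<open>By \<open>\<Sum>i. h i = 1\<close>, the difference is a weighted mean of the numbers \<open>f p - f (near_pt i 0)\<close>.\<close>
    define g where "g = f \<oplus>\<^bsub>CM\<^esub> F"
    have g: "g \<in> carrier CM" using CM_closed(1)[OF fc F] by (simp add: g_def)
    have gp: "g p = (\<Sum>i<k. complex_of_real (h i p) * (f p - f (near_pt i 0)))" if p: "p \<in> X" for p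
    proof -
      have "f p = complex_of_real (\<Sum>i<k. h i p) * f p" using h1[OF p] by simp
      also have "\<dots> = (\<Sum>i<k. complex_of_real (h i p) * f p)" by (simp add: sum_distrib_right)
      finally show ?thesis
        using p by (simp add: g_def F_def H_def right_diff_distrib sum_subtractf sum_negf mult.commute)
    qed
    have "cmod (\<mu> g) \<le> 2 * \<epsilon>"
    proof (rule CM_state_bound[OF \<mu> g])
      fix p assume p: "p \<in> X"
      show "g p \<in> \<real>" unfolding gp[OF p] using fr[OF p] fr[OF near_pt] by (intro sum_in_Reals Reals_mult Reals_diff) auto
      have "cmod (g p) \<le> (\<Sum>i<k. h i p * (2 * \<epsilon>))"
        unfolding gp[OF p]
      proof (rule sum_norm_le)
        fix i assume "i \<in> {..<k}"
        then have i: "i < k" by simp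
        show "cmod (complex_of_real (h i p) * (f p - f (near_pt i 0))) \<le> h i p * (2 * \<epsilon>)"
        proof (cases "\<epsilon> \<le> d (x i) p")
          case True
          then show ?thesis using h0[OF i p] by simp
        next
          case False
          have "cmod (f p - f (near_pt i 0)) \<le> d p (near_pt i 0)" by (rule fl[OF p near_pt[OF i]])
          also have "\<dots> \<le> d p (x i) + d (x i) (near_pt i 0)" by (rule triangle[OF p x[OF i] near_pt[OF i]])
          also have "\<dots> \<le> 2 * \<epsilon>" using False dist_near_pt[OF i, of 0] commute[of p "x i"] by linarith
          finally show ?thesis using h[OF i p] by (simp add: norm_mult mult_left_mono)
        qed
      qed
      also have "\<dots> = 2 * \<epsilon>" using h1[OF p] by (simp flip: sum_distrib_right)
      finally show "cmod (g p) \<le> 2 * \<epsilon>" .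
    qed
    moreover have "\<mu> g = \<mu> f + \<mu> F" using \<mu> fc F unfolding states_def g_def by blast
    moreover have "\<mu> F = - (\<Sum>i<k. complex_of_real (w i) * f (near_pt i 0))"
      unfolding F_def sums(2) by (simp add: sum_negf mult.commute)
    ultimately show ?thesis by simp
  qed
  then show ?thesis using w(2) w1 by blast
qed

text \<open>The convex combination of point evaluations approximating \<open>\<mu>\<close> is the restriction of a
diagonal state at the index 0.\<close>

lemma side_height_B: "side_height CM (Lip X d) S.D \<pi>\<^sub>B \<one>\<^bsub>S.D\<^esub> \<le> ennreal (2 * \<epsilon>)"
  unfolding side_height_def level_states_eq
proof (rule hausdorff_le)
  fix \<mu> assume \<mu>: "\<mu> \<in> states CM"
  obtain w where w: "\<And>i. i < k \<Longrightarrow> 0 \<le> w i" "(\<Sum>i<k. w i) = 1" and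
    close: "\<And>f. f \<in> lip_ball CM (Lip X d) \<Longrightarrow> cmod (\<mu> f - (\<Sum>i<k. complex_of_real (w i) * f (near_pt i 0))) \<le> 2 * \<epsilon>"
    using state_close_to_diagonal[OF \<mu>] by blast
  define \<phi> where "\<phi> = restrict (\<lambda>a. \<Sum>i<k. complex_of_real (w i) * a $$ (i, i)) (carrier_mat k k)"
  have \<phi>: "\<phi> \<in> states A" unfolding \<phi>_def by (rule diagonal_state[OF w])
  define \<psi> where "\<psi> = restrict (\<lambda>p. \<phi> (S.dec p 0)) (carrier S.D)"
  have \<psi>: "\<psi> \<in> states S.D" unfolding \<psi>_def by (rule S.state_at_index[OF \<phi>])
  have "mk CM (Lip X d) \<mu> (restrict (\<psi> \<circ> \<pi>\<^sub>B) (carrier CM)) \<le> ennreal (2 * \<epsilon>)"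
    unfolding mk_def
  proof (intro SUP_least ennreal_leI)
    fix f assume f: "f \<in> lip_ball CM (Lip X d)"
    note fc = CM_lip_ballD(1)[OF f]
    note bf = diag_at_bounded[OF fc]
    have "restrict (\<psi> \<circ> \<pi>\<^sub>B) (carrier CM) f = \<phi> (diag_at f 0)"
      using fc S.enc_closed[OF bf] S.dec_enc[OF bf] by (simp add: \<psi>_def \<pi>\<^sub>B_def)
    also have "\<dots> = (\<Sum>i<k. complex_of_real (w i) * f (near_pt i 0))"
      by (simp add: \<phi>_def diag_at_def)
    finally show "cmod (\<mu> f - restrict (\<psi> \<circ> \<pi>\<^sub>B) (carrier CM) f) \<le> 2 * \<epsilon>"
      using close[OF f] by simp
  qed
  then show "\<exists>\<psi>\<in>(\<lambda>\<phi>. restrict (\<phi> \<circ> \<pi>\<^sub>B) (carrier CM)) ` states S.D. mk CM (Lip X d) \<mu> \<psi> \<le> ennreal (2 * \<epsilon>)"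
    by (rule bexI[where P = "\<lambda>\<psi>. mk CM (Lip X d) \<mu> \<psi> \<le> ennreal (2 * \<epsilon>)"]) (rule imageI[OF \<psi>])
next
  fix \<psi> assume "\<psi> \<in> (\<lambda>\<phi>. restrict (\<phi> \<circ> \<pi>\<^sub>B) (carrier CM)) ` states S.D"
  then obtain \<phi> where \<phi>: "\<phi> \<in> states S.D" "\<psi> = restrict (\<phi> \<circ> \<pi>\<^sub>B) (carrier CM)" by blast
  have "\<psi> \<in> states CM"
    unfolding \<phi>(2)
    by (rule restrict_state[OF unital_star_mono_B \<phi>(1)]; unfold cont_simps; intro CM_const CM_closed CM_closed1)
  then show "\<exists>\<mu>\<in>states CM. mk CM (Lip X d) \<mu> \<psi> \<le> ennreal (2 * \<epsilon>)"
    using mk_self by blast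
qed

lemma bridge_through_sequences: "bridge A CM S.D \<pi>\<^sub>A \<pi>\<^sub>B \<one>\<^bsub>S.D\<^esub>"
proof -
  interpret D: unital_cstar_algebra S.D by (rule S.unital_cstar_algebra_D)
  have "(\<Sum>i<k. if i = 0 then 1 else 0 :: real) = 1" using k by simp
  then have "restrict (\<lambda>a. \<Sum>i<k. complex_of_real (if i = 0 then 1 else 0) * a $$ (i, i)) (carrier_mat k k) \<in> states A"
    by (intro diagonal_state) auto
  then have "states S.D \<noteq> {}" using S.state_at_index by blast
  then show ?thesis
    unfolding bridge_def level_states_eq
    using D.unital_cstar_algebra_axioms unital_star_mono_A unital_star_mono_B D.one_closed by blast
qed

lemma propinquity_le: "propinquity F (A, L) (CM, Lip X d) \<le> ennreal (2 * \<epsilon>)"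
proof -
  let ?r = "bridge_length A L CM (Lip X d) S.D \<pi>\<^sub>A \<pi>\<^sub>B \<one>\<^bsub>S.D\<^esub>"
  have "bridge_between (A, L) (CM, Lip X d) ?r"
    unfolding bridge_between_def using bridge_through_sequences by auto
  then have "propinquity F (A, L) (CM, Lip X d) \<le> ?r"
    unfolding propinquity_def by (intro Inf_lower) auto
  also have "\<dots> \<le> ennreal (2 * \<epsilon>)"
    unfolding bridge_length_def bridge_height_def
    by (intro max.boundedI reach_le side_height_A side_height_B)
  finally show ?thesis .
qed

end

lemma finite_metric_separation:
  assumes "finite K"
  shows "\<exists>r>0. \<forall>p\<in>K. \<forall>q\<in>K. 0 < d p q \<longrightarrow> r \<le> (d p q :: real)"
proof -
  define V where "V = {v \<in> (\<lambda>(p, q). d p q) ` (K \<times> K). 0 < v}"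
  have fin: "finite V" unfolding V_def using assms by auto
  have "0 < Min (insert 1 V)" using fin by (subst Min_gr_iff) (auto simp: V_def)
  moreover have "Min (insert 1 V) \<le> d p q" if "p \<in> K" "q \<in> K" "0 < d p q" for p q
    using fin that by (intro Min_le) (auto simp: V_def)
  ultimately show ?thesis by blast
qed

lemma (in Metric_space) matrix_approximation:
  assumes compact: "compact_space mtopology" and "M \<noteq> {}" and \<epsilon>: "0 < \<epsilon>"
  shows "\<exists>A L. full_matrix_algebra A \<and> qcms (CD_fun 2 0) (A, L) \<and>
           propinquity (CD_fun 2 0) (A, L) (cont_cstar M d, Lip M d) \<le> ennreal \<epsilon>"
proof -
  obtain z where z: "\<And>j::nat. z j \<in> M" "\<And>p s. p \<in> M \<Longrightarrow> s > 0 \<Longrightarrow> \<exists>j. d p (z j) < s"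
    using compact_imp_dense_sequence[OF compact \<open>M \<noteq> {}\<close>] by metis
  obtain K where K: "finite K" "K \<subseteq> M" "M \<subseteq> (\<Union>c\<in>K. mball c (\<epsilon> / 2))"
    using compact \<epsilon> unfolding compact_space_eq_mcomplete_mtotally_bounded mtotally_bounded_def
    by (meson half_gt_zero)
  obtain x where x: "bij_betw x {..<card K} K"
    using ex_bij_betw_nat_finite[OF K(1)] by (auto simp: lessThan_atLeast0)
  have xK: "x i \<in> K" if "i < card K" for i using bij_betwE[OF x] that by auto
  obtain s where s: "s > 0" "\<And>p q. p \<in> K \<Longrightarrow> q \<in> K \<Longrightarrow> 0 < d p q \<Longrightarrow> s \<le> d p q"
    using finite_metric_separation[OF K(1), of d] by blast
  \<comment> \<open>The bridge over an \<open>\<epsilon>/2\<close>-net has length at most \<open>\<epsilon>\<close>, and \<open>r \<le> s/2\<close> gives the quasi-Leibniz constant 2.\<close>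
  define r where "r = min (\<epsilon> / 2) (s / 2)"
  interpret N: metric_net M d "card K" x r "\<epsilon> / 2" z
  proof unfold_locales
    have "K \<noteq> {}" using K(3) \<open>M \<noteq> {}\<close> by auto
    then show "1 \<le> card K" using K(1) by (simp add: Suc_le_eq card_gt_0_iff)
    show "0 < r" using \<epsilon> s(1) by (simp add: r_def)
    fix i j assume ij: "i < card K" "j < card K" "i \<noteq> j"
    have "x i \<noteq> x j" using x ij by (auto simp: bij_betw_def inj_on_def)
    moreover have "x i \<in> M" "x j \<in> M" using xK ij K(2) by auto
    ultimately have "s \<le> d (x i) (x j)" using s(2) xK ij by (simp add: mdist_pos_less)
    then show "2 * r \<le> d (x i) (x j)" by (simp add: r_def)
  next
    fix p assume "p \<in> M"
    then obtain c where c: "c \<in> K" "d c p < \<epsilon> / 2" using K(3) by auto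
    then obtain i where "i < card K" "c = x i" using x by (auto simp: bij_betw_def)
    then show "\<exists>i<card K. d (x i) p < \<epsilon> / 2" using c by blast
  qed (use compact xK K(2) z in \<open>auto simp: r_def\<close>)
  have "full_matrix_algebra N.A" unfolding full_matrix_algebra_def using N.k by blast
  moreover have "qcms (CD_fun 2 0) (N.A, N.L)" using N.quasi_leibniz_qcms by (simp add: qcms_def)
  moreover have "propinquity (CD_fun 2 0) (N.A, N.L) (cont_cstar M d, Lip M d) \<le> ennreal \<epsilon>"
    using N.propinquity_le[of "CD_fun 2 0"] by simp
  ultimately show ?thesis by blast
qed

theorem corollary2p4:
  fixes X :: "'x set" and d :: "'x \<Rightarrow> 'x \<Rightarrow> real"
  assumes "Metric_space X d"
    and "compact_space (Metric_space.mtopology X d)"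
    and "X \<noteq> {}"
  shows "\<exists>(A :: nat \<Rightarrow> complex mat cstar) (L :: nat \<Rightarrow> complex mat \<Rightarrow> ennreal).
           (\<forall>n. full_matrix_algebra (A n) \<and> qcms (CD_fun 2 0) (A n, L n)) \<and>
           (\<lambda>n. propinquity (CD_fun 2 0) (A n, L n) (cont_cstar X d, Lip X d)) \<longlonglongrightarrow> 0"
proof -
  interpret Metric_space X d by fact
  have "\<forall>n::nat. \<exists>A L. full_matrix_algebra A \<and> qcms (CD_fun 2 0) (A, L) \<and>
      propinquity (CD_fun 2 0) (A, L) (cont_cstar X d, Lip X d) \<le> ennreal (inverse (real (Suc n)))"
    by (intro allI matrix_approximation assms) simp
  then obtain A L where AL: "\<And>n::nat. full_matrix_algebra (A n)" "\<And>n. qcms (CD_fun 2 0) (A n, L n)"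
    "\<And>n. propinquity (CD_fun 2 0) (A n, L n) (cont_cstar X d, Lip X d) \<le> ennreal (inverse (real (Suc n)))"
    by metis
  have "(\<lambda>n. ennreal (inverse (real (Suc n)))) \<longlonglongrightarrow> ennreal 0"
    by (intro tendsto_ennrealI LIMSEQ_inverse_real_of_nat)
  then have lim: "(\<lambda>n. ennreal (inverse (real (Suc n)))) \<longlonglongrightarrow> 0" by simp
  have "(\<lambda>n. propinquity (CD_fun 2 0) (A n, L n) (cont_cstar X d, Lip X d)) \<longlonglongrightarrow> 0"
    by (rule tendsto_sandwich[OF _ _ tendsto_const lim]) (intro always_eventually allI zero_le AL(3))+
  then show ?thesis using AL(1,2) by blast
qed

end
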